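(* Let $M$ be a smooth $n$-manifold, $V$ a rank $n$ real vector bundle on $M$ with a flat connection $\nabla$, and let $\mathcal{J}=F^{-1}(\pi^*\underline{\mathcal{J}})F$ be a $\nabla$-semi-flat generalized almost complex structure on $X=\mathrm{tot}(V)$. Let $\mathcal{S}$ be the sheaf of flat sections of $V\oplus V^\vee$ (for $\nabla\oplus\nabla^\vee$) and let $\mathcal{M}:V\oplus V^\vee\to T_M\oplus T_M^\vee$ be the bundle isomorphism $$\mathcal{M}=\begin{pmatrix}\mathcal{J}_{13}&\mathcal{J}_{22}^\vee\\-\mathcal{J}_{31}^\vee&\mathcal{J}_{12}^\vee\end{pmatrix}$$ built from the blocks of $\underline{\mathcal{J}}$. Then $\mathcal{J}$ is integrable if and only if all pairwise Courant brackets of sections of the sheaf $\mathcal{M}(\mathcal{S})\subseteq T_M\oplus T_M^\vee$ vanish.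
   Context: On $W\oplus W^\vee$ ($W$ a real vector bundle) use the pairing $\langle v+f,w+g\rangle=-\tfrac12(f(w)+g(v))$. A generalized almost complex structure on $W$ is an automorphism $\mathcal{J}$ of $W\oplus W^\vee$ which is orthogonal for this pairing and satisfies $\mathcal{J}^2=-1$. A generalized almost complex structure on a manifold $N$ is one on $W=T_N$. The Courant bracket is $[X+\xi,Y+\eta]=[X,Y]+\mathcal{L}_X\eta-\mathcal{L}_Y\xi+\tfrac12 d(\iota_Y\xi-\iota_X\eta)$. A generalized almost complex structure on $N$ is integrable if the sheaf of sections of its $(+i)$-eigenbundle in $(T_N\oplus T_N^\vee)\otimes\mathbb{C}$ is closed under the ($\mathbb{C}$-bilinearly extended) Courant bracket. Let $\pi:X=\mathrm{tot}(V)\to M$, and let $0\to\pi^*V\xrightarrow{j}T_X\xrightarrow{d\pi}\pi^*T_M\to0$ be the tangent sequence. A connection $\nabla$ on $V$ gives a splitting: if $S$ is the tautological section of $\pi^*V$, then $D=(\pi^*\nabla)(S):T_X\to\pi^*V$ satisfies $D\circ j=1$; let $\alpha:\pi^*T_M\to T_X$ be the corresponding map with $d\pi\circ\alpha=1$, $D\circ\alpha=0$. Set $$F:T_X\oplus T_X^\vee\to\pi^*V\oplus\pi^*T_M\oplus\pi^*V^\vee\oplus\pi^*T_M^\vee,\quad F(w+\xi)=(Dw,\ d\pi\,w,\ j^\vee\xi,\ \alpha^\vee\xi),$$ an isomorphism. When $\mathrm{rank}\,V=\dim M$ and $\nabla$ is flat, a $\nabla$-semi-flat generalized almost complex structure on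 $X$ is one of the form $\mathcal{J}=F^{-1}(\pi^*\underline{\mathcal{J}})F$ with $\underline{\mathcal{J}}$ a generalized almost complex structure on $V\oplus T_M$ that is adapted: $\underline{\mathcal{J}}(V\oplus V^\vee)=T_M\oplus T_M^\vee$. Such a $\underline{\mathcal{J}}$ has, on $V\oplus T_M\oplus V^\vee\oplus T_M^\vee$, the block form $$\underline{\mathcal{J}}=\begin{pmatrix}0&\mathcal{J}_{12}&0&\mathcal{J}_{22}\\ \mathcal{J}_{13}&0&-\mathcal{J}_{22}^\vee&0\\0&\mathcal{J}_{31}&0&-\mathcal{J}_{13}^\vee\\-\mathcal{J}_{31}^\vee&0&-\mathcal{J}_{12}^\vee&0\end{pmatrix},$$ with $\mathcal{J}_{12}:T_M\to V$, $\mathcal{J}_{22}:T_M^\vee\to V$, $\mathcal{J}_{13}:V\to T_M$, $\mathcal{J}_{31}:T_M\to V^\vee$. *)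

theory Defs
  imports "HOL-Analysis.Analysis"
begin

section \<open>Smooth maps between open subsets of normed spaces\<close>

primrec C_on :: "nat \<Rightarrow> 'a::real_normed_vector set \<Rightarrow> ('a \<Rightarrow> 'b::real_normed_vector) \<Rightarrow> bool" where
  "C_on 0 S f \<longleftrightarrow> continuous_on S f"
| "C_on (Suc r) S f \<longleftrightarrow> (\<forall>u\<in>S. f differentiable (at u)) \<and>
     (\<forall>w. C_on r S (\<lambda>u. frechet_derivative f (at u) w))"

definition smooth_on :: "'a::real_normed_vector set \<Rightarrow> ('a \<Rightarrow> 'b::real_normed_vector) \<Rightarrow> bool" where
  "smooth_on S f \<longleftrightarrow> (\<forall>r. C_on r S f)"


section \<open>Manifolds and their tangent bundles\<close>

text \<open>
  An atlas is an indexed family of charts: \<open>coord A k\<close> maps the open set \<open>chart_dom A k\<close> into the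
  model space \<open>'e\<close>.  The underlying point set of the manifold is the whole type \<open>'p\<close>.
\<close>

record ('k, 'p, 'e) atlas =
  idx :: "'k set"
  chart_dom :: "'k \<Rightarrow> 'p set"
  coord :: "'k \<Rightarrow> 'p \<Rightarrow> 'e"

definition par :: "('k, 'p, 'e, 'z) atlas_scheme \<Rightarrow> 'k \<Rightarrow> 'e \<Rightarrow> 'p" where
  "par A k = inv_into (chart_dom A k) (coord A k)"

definition smooth_manifold ::
    "('k, 'p::{t2_space, second_countable_topology}, 'e::euclidean_space, 'z) atlas_scheme \<Rightarrow> bool" where
  "smooth_manifold A \<longleftrightarrow>
     (\<Union>k\<in>idx A. chart_dom A k) = UNIV \<and>
     (\<forall>k\<in>idx A. open (chart_dom A k) \<and> open (coord A k ` chart_dom A k) \<and>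
        (\<exists>g. homeomorphism (chart_dom A k) (coord A k ` chart_dom A k) (coord A k) g)) \<and>
     (\<forall>k\<in>idx A. \<forall>l\<in>idx A.
        smooth_on (coord A k ` (chart_dom A k \<inter> chart_dom A l)) (coord A l \<circ> par A k))"

text \<open>
  A vector bundle over the manifold with local frames over the chart domains is described by its
  transition maps: \<open>g k l p\<close> sends the components of a fibre element at \<open>p\<close> in the frame \<open>k\<close> to its
  components in the frame \<open>l\<close>.  A section over \<open>U\<close> is the family of its component functions; only
  the values at points of \<open>U \<inter> chart_dom A k\<close> with \<open>k \<in> idx A\<close> carry information.

  Covectors are given by their components in the dual frame, so that a covector \<open>f\<close> takes
  the value \<open>f \<bullet> v\<close> on \<open>v\<close>, and the dual of a linear map is its \<open>adjoint\<close>.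
\<close>

definition jac :: "('k, 'p, 'e::euclidean_space, 'z) atlas_scheme \<Rightarrow> 'k \<Rightarrow> 'k \<Rightarrow> 'p \<Rightarrow> 'e \<Rightarrow> 'e" where
  "jac A k l p = frechet_derivative (coord A l \<circ> par A k) (at (coord A k p))"

definition sum_trans :: "('k \<Rightarrow> 'k \<Rightarrow> 'p \<Rightarrow> 'v \<Rightarrow> 'v) \<Rightarrow> ('k \<Rightarrow> 'k \<Rightarrow> 'p \<Rightarrow> 'w \<Rightarrow> 'w)
    \<Rightarrow> 'k \<Rightarrow> 'k \<Rightarrow> 'p \<Rightarrow> 'v \<times> 'w \<Rightarrow> 'v \<times> 'w" where
  "sum_trans g h k l p = map_prod (g k l p) (h k l p)"

definition dual_trans :: "('k \<Rightarrow> 'k \<Rightarrow> 'p \<Rightarrow> 'w \<Rightarrow> 'w)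
    \<Rightarrow> 'k \<Rightarrow> 'k \<Rightarrow> 'p \<Rightarrow> 'w::euclidean_space \<Rightarrow> 'w" where
  "dual_trans g k l p = adjoint (g l k p)"

definition is_section :: "('k, 'p::topological_space, 'e::euclidean_space, 'z) atlas_scheme
    \<Rightarrow> ('k \<Rightarrow> 'k \<Rightarrow> 'p \<Rightarrow> 'w \<Rightarrow> 'w) \<Rightarrow> 'p set \<Rightarrow> ('k \<Rightarrow> 'p \<Rightarrow> 'w::real_normed_vector) \<Rightarrow> bool" where
  "is_section A g U s \<longleftrightarrow>
     (\<forall>k\<in>idx A. smooth_on (coord A k ` (U \<inter> chart_dom A k)) (s k \<circ> par A k)) \<and>
     (\<forall>k\<in>idx A. \<forall>l\<in>idx A. \<forall>p\<in>U \<inter> chart_dom A k \<inter> chart_dom A l. s l p = g k l p (s k p))"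

abbreviation gen_trans :: "('k \<Rightarrow> 'k \<Rightarrow> 'p \<Rightarrow> 'w \<Rightarrow> 'w)
    \<Rightarrow> 'k \<Rightarrow> 'k \<Rightarrow> 'p \<Rightarrow> 'w::euclidean_space \<times> 'w \<Rightarrow> 'w \<times> 'w" where
  "gen_trans g \<equiv> sum_trans g (dual_trans g)"


section \<open>Generalized almost complex structures\<close>

definition pairing :: "'w::euclidean_space \<times> 'w \<Rightarrow> 'w \<times> 'w \<Rightarrow> real" where
  "pairing a b = - (1/2) * (snd a \<bullet> fst b + snd b \<bullet> fst a)"

text \<open>
  \<open>gacs A g J\<close>: \<open>J\<close> is a generalized almost complex structure on the bundle \<open>W\<close> with transition
  maps \<open>g\<close>.
\<close>

definition gacs :: "('k, 'p::topological_space, 'e::euclidean_space, 'z) atlas_scheme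
    \<Rightarrow> ('k \<Rightarrow> 'k \<Rightarrow> 'p \<Rightarrow> 'w \<Rightarrow> 'w)
    \<Rightarrow> ('k \<Rightarrow> 'p \<Rightarrow> 'w::euclidean_space \<times> 'w \<Rightarrow> 'w \<times> 'w) \<Rightarrow> bool" where
  "gacs A g J \<longleftrightarrow>
     (\<forall>k\<in>idx A. \<forall>p\<in>chart_dom A k.
        linear (J k p) \<and> (\<forall>a. J k p (J k p a) = - a) \<and>
        (\<forall>a b. pairing (J k p a) (J k p b) = pairing a b)) \<and>
     (\<forall>k\<in>idx A. \<forall>a. smooth_on (coord A k ` chart_dom A k) (\<lambda>u. J k (par A k u) a)) \<and>
     (\<forall>k\<in>idx A. \<forall>l\<in>idx A. \<forall>p\<in>chart_dom A k \<inter> chart_dom A l. \<forall>a.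
        J l p (gen_trans g k l p a) = gen_trans g k l p (J k p a))"


section \<open>Courant bracket and integrability\<close>

text \<open>Vector fields and one-forms on the model space, the latter as component vectors.\<close>

definition lie_bracket_loc :: "('e::euclidean_space \<Rightarrow> 'e) \<Rightarrow> ('e \<Rightarrow> 'e) \<Rightarrow> 'e \<Rightarrow> 'e" where
  "lie_bracket_loc X Y u = frechet_derivative Y (at u) (X u) - frechet_derivative X (at u) (Y u)"

text \<open>\<open>(L\<^sub>X \<eta>)\<^sub>i = X\<^sup>j \<partial>\<^sub>j \<eta>\<^sub>i + \<eta>\<^sub>j \<partial>\<^sub>i X\<^sup>j\<close>\<close>

definition lie_form_loc :: "('e::euclidean_space \<Rightarrow> 'e) \<Rightarrow> ('e \<Rightarrow> 'e) \<Rightarrow> 'e \<Rightarrow> 'e" where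
  "lie_form_loc X \<eta> u =
     frechet_derivative \<eta> (at u) (X u) + adjoint (frechet_derivative X (at u)) (\<eta> u)"

definition d_loc :: "('e::euclidean_space \<Rightarrow> real) \<Rightarrow> 'e \<Rightarrow> 'e" where
  "d_loc f u = (\<Sum>b\<in>Basis. frechet_derivative f (at u) b *\<^sub>R b)"

definition courant_loc :: "('e::euclidean_space \<Rightarrow> 'e \<times> 'e) \<Rightarrow> ('e \<Rightarrow> 'e \<times> 'e) \<Rightarrow> 'e \<Rightarrow> 'e \<times> 'e" where
  "courant_loc s t u =
     (let X = fst \<circ> s; \<xi> = snd \<circ> s; Y = fst \<circ> t; \<eta> = snd \<circ> t in
       (lie_bracket_loc X Y u,
        lie_form_loc X \<eta> u - lie_form_loc Y \<xi> u + (1/2) *\<^sub>R d_loc (\<lambda>z. \<xi> z \<bullet> Y z - \<eta> z \<bullet> X z) u))"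

definition courant :: "('k, 'p, 'e::euclidean_space, 'z) atlas_scheme
    \<Rightarrow> ('k \<Rightarrow> 'p \<Rightarrow> 'e \<times> 'e) \<Rightarrow> ('k \<Rightarrow> 'p \<Rightarrow> 'e \<times> 'e) \<Rightarrow> 'k \<Rightarrow> 'p \<Rightarrow> 'e \<times> 'e" where
  "courant A s t k p = courant_loc (s k \<circ> par A k) (t k \<circ> par A k) (coord A k p)"

text \<open>
  The complexification of \<open>W\<close> is \<open>W \<times> W\<close>, with \<open>(a, b)\<close> standing for \<open>a + i b\<close>.
\<close>

definition courant_complex :: "('k, 'p, 'e::euclidean_space, 'z) atlas_scheme
    \<Rightarrow> ('k \<Rightarrow> 'p \<Rightarrow> ('e \<times> 'e) \<times> ('e \<times> 'e)) \<Rightarrow> ('k \<Rightarrow> 'p \<Rightarrow> ('e \<times> 'e) \<times> ('e \<times> 'e))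
    \<Rightarrow> 'k \<Rightarrow> 'p \<Rightarrow> ('e \<times> 'e) \<times> ('e \<times> 'e)" where
  "courant_complex A s t k p =
     (let a = (\<lambda>k p. fst (s k p)); b = (\<lambda>k p. snd (s k p));
          c = (\<lambda>k p. fst (t k p)); d = (\<lambda>k p. snd (t k p)) in
       (courant A a c k p - courant A b d k p, courant A a d k p + courant A b c k p))"

text \<open>Sections over \<open>U\<close> of the \<open>(+i)\<close>-eigenbundle: \<open>J (a + i b) = i (a + i b) = - b + i a\<close>.\<close>

definition eigen_section :: "('k, 'p::topological_space, 'e::euclidean_space, 'z) atlas_scheme
    \<Rightarrow> ('k \<Rightarrow> 'p \<Rightarrow> 'e \<times> 'e \<Rightarrow> 'e \<times> 'e) \<Rightarrow> 'p set
    \<Rightarrow> ('k \<Rightarrow> 'p \<Rightarrow> ('e \<times> 'e) \<times> ('e \<times> 'e)) \<Rightarrow> bool" where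
  "eigen_section A J U s \<longleftrightarrow>
     is_section A (sum_trans (gen_trans (jac A)) (gen_trans (jac A))) U s \<and>
     (\<forall>k\<in>idx A. \<forall>p\<in>U \<inter> chart_dom A k.
        map_prod (J k p) (J k p) (s k p) = (- snd (s k p), fst (s k p)))"

definition integrable_gacs :: "('k, 'p::topological_space, 'e::euclidean_space, 'z) atlas_scheme
    \<Rightarrow> ('k \<Rightarrow> 'p \<Rightarrow> 'e \<times> 'e \<Rightarrow> 'e \<times> 'e) \<Rightarrow> bool" where
  "integrable_gacs A J \<longleftrightarrow>
     (\<forall>U s t. open U \<longrightarrow> eigen_section A J U s \<longrightarrow> eigen_section A J U t \<longrightarrow>
        eigen_section A J U (courant_complex A s t))"


section \<open>Vector bundles\<close>

text \<open>
  The type \<open>'v\<close> is the total space, \<open>proj\<close> the bundle projection and \<open>triv B k\<close> the fibre component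
  of a trivialization over the domain of the chart \<open>k\<close> of the base.  Using one index for both charts
  and trivializations is no restriction, as one may index by pairs and restrict to the
  intersection of the domains.  The vector space structure of the fibres is the one transported
  by the trivializations, which is well defined because the transition maps are linear.
\<close>

record ('k, 'p, 'e, 'v, 'f) vbundle = "('k, 'p, 'e) atlas" +
  proj :: "'v \<Rightarrow> 'p"
  triv :: "'k \<Rightarrow> 'v \<Rightarrow> 'f"

definition vtrans :: "('k, 'p, 'e, 'v, 'f, 'z) vbundle_scheme \<Rightarrow> 'k \<Rightarrow> 'k \<Rightarrow> 'p \<Rightarrow> 'f \<Rightarrow> 'f" where
  "vtrans B k l p v =
     triv B l (inv_into (proj B -` chart_dom B k) (\<lambda>e. (proj B e, triv B k e)) (p, v))"

definition smooth_vector_bundle ::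
    "('k, 'p::{t2_space, second_countable_topology}, 'e::euclidean_space,
      'v::topological_space, 'f::euclidean_space, 'z) vbundle_scheme \<Rightarrow> bool" where
  "smooth_vector_bundle B \<longleftrightarrow>
     smooth_manifold B \<and> continuous_on UNIV (proj B) \<and>
     (\<forall>k\<in>idx B. \<exists>g. homeomorphism (proj B -` chart_dom B k) (chart_dom B k \<times> UNIV)
        (\<lambda>e. (proj B e, triv B k e)) g) \<and>
     (\<forall>k\<in>idx B. \<forall>l\<in>idx B.
        (\<forall>p\<in>chart_dom B k \<inter> chart_dom B l. linear (vtrans B k l p)) \<and>
        (\<forall>v. smooth_on (coord B k ` (chart_dom B k \<inter> chart_dom B l))
           (\<lambda>u. vtrans B k l (par B k u) v)))"

text \<open>The manifold structure of the total space.\<close>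

definition total_atlas :: "('k, 'p, 'e, 'v, 'f, 'z) vbundle_scheme \<Rightarrow> ('k, 'v, 'e \<times> 'f) atlas" where
  "total_atlas B = \<lparr> idx = idx B, chart_dom = (\<lambda>k. proj B -` chart_dom B k),
     coord = (\<lambda>k e. (coord B k (proj B e), triv B k e)) \<rparr>"


section \<open>Connections\<close>

text \<open>
  A connection is given by its local connection forms: in the frame \<open>k\<close>, the covariant derivative
  is \<open>\<nabla>\<^sub>w s = \<partial>\<^sub>w s + \<omega> k p w s\<close>.
\<close>

definition nabla :: "('k, 'p, 'e::euclidean_space, 'z) atlas_scheme
    \<Rightarrow> ('k \<Rightarrow> 'p \<Rightarrow> 'e \<Rightarrow> 'f \<Rightarrow> 'f) \<Rightarrow> ('k \<Rightarrow> 'p \<Rightarrow> 'f::euclidean_space)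
    \<Rightarrow> 'k \<Rightarrow> 'p \<Rightarrow> 'e \<Rightarrow> 'f" where
  "nabla A \<omega> s k p w = frechet_derivative (s k \<circ> par A k) (at (coord A k p)) w + \<omega> k p w (s k p)"

text \<open>
  The last condition is the gauge transformation law \<open>\<omega>\<^sub>l g = g \<omega>\<^sub>k - dg\<close>, that is,
  \<open>\<nabla>\<^sub>w s\<close> transforms like an element of the fibre.
\<close>

definition connection :: "('k, 'p::topological_space, 'e::euclidean_space, 'v,
    'f::euclidean_space, 'z) vbundle_scheme \<Rightarrow> ('k \<Rightarrow> 'p \<Rightarrow> 'e \<Rightarrow> 'f \<Rightarrow> 'f) \<Rightarrow> bool" where
  "connection B \<omega> \<longleftrightarrow>
     (\<forall>k\<in>idx B. \<forall>p\<in>chart_dom B k. bilinear (\<omega> k p)) \<and>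
     (\<forall>k\<in>idx B. \<forall>w v. smooth_on (coord B k ` chart_dom B k) (\<lambda>u. \<omega> k (par B k u) w v)) \<and>
     (\<forall>k\<in>idx B. \<forall>l\<in>idx B. \<forall>p\<in>chart_dom B k \<inter> chart_dom B l. \<forall>w v.
        \<omega> l p (jac B k l p w) (vtrans B k l p v) =
        vtrans B k l p (\<omega> k p w v)
          - frechet_derivative (\<lambda>u. vtrans B k l (par B k u) v) (at (coord B k p)) w)"

text \<open>The curvature \<open>d\<omega> + \<omega> \<and> \<omega>\<close>.\<close>

definition curvature :: "('k, 'p, 'e::euclidean_space, 'z) atlas_scheme
    \<Rightarrow> ('k \<Rightarrow> 'p \<Rightarrow> 'e \<Rightarrow> 'f \<Rightarrow> 'f::euclidean_space) \<Rightarrow> 'k \<Rightarrow> 'p \<Rightarrow> 'e \<Rightarrow> 'e \<Rightarrow> 'f \<Rightarrow> 'f" where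
  "curvature A \<omega> k p w w' v =
     frechet_derivative (\<lambda>u. \<omega> k (par A k u) w' v) (at (coord A k p)) w
     - frechet_derivative (\<lambda>u. \<omega> k (par A k u) w v) (at (coord A k p)) w'
     + \<omega> k p w (\<omega> k p w' v) - \<omega> k p w' (\<omega> k p w v)"

definition flat_connection :: "('k, 'p::topological_space, 'e::euclidean_space, 'v,
    'f::euclidean_space, 'z) vbundle_scheme \<Rightarrow> ('k \<Rightarrow> 'p \<Rightarrow> 'e \<Rightarrow> 'f \<Rightarrow> 'f) \<Rightarrow> bool" where
  "flat_connection B \<omega> \<longleftrightarrow> connection B \<omega> \<and>
     (\<forall>k\<in>idx B. \<forall>p\<in>chart_dom B k. \<forall>w w' v. curvature B \<omega> k p w w' v = 0)"

text \<open>The connection forms of \<open>\<nabla> \<oplus> \<nabla>\<^sup>\<or>\<close> on the sum of a bundle and its dual.\<close>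

definition gen_connection :: "('k \<Rightarrow> 'p \<Rightarrow> 'e \<Rightarrow> 'f \<Rightarrow> 'f::euclidean_space)
    \<Rightarrow> 'k \<Rightarrow> 'p \<Rightarrow> 'e \<Rightarrow> 'f \<times> 'f \<Rightarrow> 'f \<times> 'f" where
  "gen_connection \<omega> k p w = map_prod (\<omega> k p w) (\<lambda>f. - adjoint (\<omega> k p w) f)"

definition flat_sections :: "('k, 'p::topological_space, 'e::euclidean_space, 'v,
    'f::euclidean_space, 'z) vbundle_scheme \<Rightarrow> ('k \<Rightarrow> 'p \<Rightarrow> 'e \<Rightarrow> 'f \<Rightarrow> 'f)
    \<Rightarrow> 'p set \<Rightarrow> ('k \<Rightarrow> 'p \<Rightarrow> 'f \<times> 'f) set" where
  "flat_sections B \<omega> U = {s. is_section B (gen_trans (vtrans B)) U s \<and>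
     (\<forall>k\<in>idx B. \<forall>p\<in>U \<inter> chart_dom B k. \<forall>w. nabla B (gen_connection \<omega>) s k p w = 0)}"


section \<open>The tangent sequence of the total space and its splitting\<close>

text \<open>
  Below, a tangent vector of the total space at \<open>e\<close> is given in the chart \<open>k\<close>, and elements
  of the fibres of the pulled back bundles at \<open>e\<close> in the corresponding frame \<open>k\<close> of the base.
\<close>

definition d_proj :: "('k, 'p, 'e::euclidean_space, 'v, 'f::euclidean_space, 'z) vbundle_scheme
    \<Rightarrow> 'k \<Rightarrow> 'v \<Rightarrow> 'e \<times> 'f \<Rightarrow> 'e" where
  "d_proj B k e = frechet_derivative (coord B k \<circ> proj B \<circ> par (total_atlas B) k)
     (at (coord (total_atlas B) k e))"

text \<open>The map \<open>j\<close>: the derivative of the inclusion of the fibre through \<open>e\<close>.\<close>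

definition vert :: "('k, 'p, 'e::euclidean_space, 'v, 'f::euclidean_space, 'z) vbundle_scheme
    \<Rightarrow> 'k \<Rightarrow> 'v \<Rightarrow> 'f \<Rightarrow> 'e \<times> 'f" where
  "vert B k e = frechet_derivative
     (\<lambda>y. coord (total_atlas B) k
        (inv_into (proj B -` chart_dom B k) (\<lambda>e'. (proj B e', triv B k e')) (proj B e, y)))
     (at (triv B k e))"

definition pullback_connection :: "('k, 'p, 'e::euclidean_space, 'v, 'f::euclidean_space, 'z) vbundle_scheme
    \<Rightarrow> ('k \<Rightarrow> 'p \<Rightarrow> 'e \<Rightarrow> 'f \<Rightarrow> 'f) \<Rightarrow> 'k \<Rightarrow> 'v \<Rightarrow> 'e \<times> 'f \<Rightarrow> 'f \<Rightarrow> 'f" where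
  "pullback_connection B \<omega> k e w = \<omega> k (proj B e) (d_proj B k e w)"

text \<open>
  \<open>D = (\<pi>\<^sup>*\<nabla>) S\<close>; the components of the tautological section \<open>S\<close> are the maps \<open>triv B k\<close>.
\<close>

definition vert_proj :: "('k, 'p, 'e::euclidean_space, 'v, 'f::euclidean_space, 'z) vbundle_scheme
    \<Rightarrow> ('k \<Rightarrow> 'p \<Rightarrow> 'e \<Rightarrow> 'f \<Rightarrow> 'f) \<Rightarrow> 'k \<Rightarrow> 'v \<Rightarrow> 'e \<times> 'f \<Rightarrow> 'f" where
  "vert_proj B \<omega> = nabla (total_atlas B) (pullback_connection B \<omega>) (triv B)"

text \<open>The map \<open>\<alpha>\<close>; it is well defined by lemma \<open>hor_lift_unique\<close>.\<close>

definition hor_lift :: "('k, 'p, 'e::euclidean_space, 'v, 'f::euclidean_space, 'z) vbundle_scheme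
    \<Rightarrow> ('k \<Rightarrow> 'p \<Rightarrow> 'e \<Rightarrow> 'f \<Rightarrow> 'f) \<Rightarrow> 'k \<Rightarrow> 'v \<Rightarrow> 'e \<Rightarrow> 'e \<times> 'f" where
  "hor_lift B \<omega> k e = (THE a. linear a \<and> (\<forall>x. d_proj B k e (a x) = x) \<and>
     (\<forall>x. vert_proj B \<omega> k e (a x) = 0))"

lemma total_atlas_image:
  assumes B: "smooth_vector_bundle B" and k: "k \<in> idx B"
  shows "coord (total_atlas B) k ` chart_dom (total_atlas B) k
    = (coord B k ` chart_dom B k) \<times> UNIV"
proof -
  obtain g where g: "homeomorphism (proj B -` chart_dom B k) (chart_dom B k \<times> UNIV)
      (\<lambda>e. (proj B e, triv B k e)) g"
    using B k unfolding smooth_vector_bundle_def by blast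
  have im: "(\<lambda>e. (proj B e, triv B k e)) ` (proj B -` chart_dom B k) = chart_dom B k \<times> UNIV"
    using homeomorphism_image1[OF g] .
  have "coord (total_atlas B) k ` chart_dom (total_atlas B) k
      = map_prod (coord B k) id ` ((\<lambda>e. (proj B e, triv B k e)) ` (proj B -` chart_dom B k))"
    by (simp add: total_atlas_def image_image)
  also have "\<dots> = (coord B k ` chart_dom B k) \<times> UNIV"
    unfolding im by (simp add: map_prod_surj_on)
  finally show ?thesis .
qed

lemma coord_par_total_atlas:
  assumes B: "smooth_vector_bundle B" and k: "k \<in> idx B"
    and x: "x \<in> coord B k ` chart_dom B k"
  shows "coord B k (proj B (par (total_atlas B) k (x, y))) = x"
    and "triv B k (par (total_atlas B) k (x, y)) = y"
proof -
  have "(x, y) \<in> coord (total_atlas B) k ` chart_dom (total_atlas B) k"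
    unfolding total_atlas_image[OF B k] using x by simp
  then have "coord (total_atlas B) k (par (total_atlas B) k (x, y)) = (x, y)"
    unfolding par_def by (rule f_inv_into_f)
  then show "coord B k (proj B (par (total_atlas B) k (x, y))) = x"
    and "triv B k (par (total_atlas B) k (x, y)) = y"
    by (simp_all add: total_atlas_def)
qed

lemma par_total_atlas_derivs:
  assumes B: "smooth_vector_bundle B" and k: "k \<in> idx B" and e: "proj B e \<in> chart_dom B k"
  defines "c \<equiv> coord (total_atlas B) k e"
  shows "((coord B k \<circ> proj B \<circ> par (total_atlas B) k) has_derivative fst) (at c)"
    and "((triv B k \<circ> par (total_atlas B) k) has_derivative snd) (at c)"
proof -
  have op: "open (coord B k ` chart_dom B k)"
    using B k unfolding smooth_vector_bundle_def smooth_manifold_def by blast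
  then have op: "open ((coord B k ` chart_dom B k) \<times> UNIV)"
    by (simp add: open_Times)
  have c: "c \<in> (coord B k ` chart_dom B k) \<times> UNIV"
    using e by (auto simp: c_def total_atlas_def)
  show "((coord B k \<circ> proj B \<circ> par (total_atlas B) k) has_derivative fst) (at c)"
    by (rule has_derivative_transform_within_open[OF _ op c, where f = fst])
       (auto intro!: bounded_linear_imp_has_derivative bounded_linear_fst
         simp: coord_par_total_atlas(1)[OF B k])
  show "((triv B k \<circ> par (total_atlas B) k) has_derivative snd) (at c)"
    by (rule has_derivative_transform_within_open[OF _ op c, where f = snd])
       (auto intro!: bounded_linear_imp_has_derivative bounded_linear_snd
         simp: coord_par_total_atlas(2)[OF B k])
qed

lemma d_proj_eq:
  assumes "smooth_vector_bundle B" "k \<in> idx B" "proj B e \<in> chart_dom B k"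
  shows "d_proj B k e = fst"
  using frechet_derivative_at[OF par_total_atlas_derivs(1)[OF assms]] by (simp add: d_proj_def)

lemma vert_eq:
  assumes B: "smooth_vector_bundle B" and k: "k \<in> idx B" and e: "proj B e \<in> chart_dom B k"
  shows "vert B k e v = (0, v)"
proof -
  obtain g where g: "homeomorphism (proj B -` chart_dom B k) (chart_dom B k \<times> UNIV)
      (\<lambda>e. (proj B e, triv B k e)) g"
    using B k unfolding smooth_vector_bundle_def by blast
  let ?h = "inv_into (proj B -` chart_dom B k) (\<lambda>e'. (proj B e', triv B k e'))"
  have "(proj B (?h (proj B e, y)), triv B k (?h (proj B e, y))) = (proj B e, y)" for y
    using f_inv_into_f[of "(proj B e, y)" "\<lambda>e'. (proj B e', triv B k e')" "proj B -` chart_dom B k"]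
      homeomorphism_image1[OF g] e by auto
  then have "(\<lambda>y. coord (total_atlas B) k (?h (proj B e, y))) = (\<lambda>y. (coord B k (proj B e), y))"
    by (simp add: total_atlas_def)
  moreover have "((\<lambda>y. (coord B k (proj B e), y)) has_derivative (\<lambda>y. (0, y))) (at (triv B k e))"
    by (auto intro!: derivative_eq_intros)
  ultimately show ?thesis
    unfolding vert_def by (simp add: frechet_derivative_at[symmetric])
qed

lemma vert_proj_eq:
  assumes "smooth_vector_bundle B" "k \<in> idx B" "proj B e \<in> chart_dom B k"
  shows "vert_proj B \<omega> k e w = snd w + \<omega> k (proj B e) (fst w) (triv B k e)"
  using frechet_derivative_at[OF par_total_atlas_derivs(2)[OF assms]]
  by (simp add: vert_proj_def nabla_def pullback_connection_def d_proj_eq[OF assms])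

lemma hor_lift_unique:
  assumes B: "smooth_vector_bundle B" and con: "connection B \<omega>"
    and k: "k \<in> idx B" and e: "proj B e \<in> chart_dom B k"
  shows "\<exists>!a. linear a \<and> (\<forall>x. d_proj B k e (a x) = x) \<and> (\<forall>x. vert_proj B \<omega> k e (a x) = 0)"
proof -
  let ?a = "\<lambda>x. (x, - \<omega> k (proj B e) x (triv B k e))"
  have "bilinear (\<omega> k (proj B e))"
    using con k e unfolding connection_def by blast
  then have "linear ?a"
    by (auto intro!: linearI simp: bilinear_ladd bilinear_lmul)
  then show ?thesis
    by (intro ex1I[of _ ?a])
       (auto simp: d_proj_eq[OF B k e] vert_proj_eq[OF B k e] fun_eq_iff prod_eq_iff
         eq_neg_iff_add_eq_0)
qed

lemma hor_lift_eq:
  assumes B: "smooth_vector_bundle B" and con: "connection B \<omega>"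
    and k: "k \<in> idx B" and e: "proj B e \<in> chart_dom B k"
  shows "hor_lift B \<omega> k e = (\<lambda>x. (x, - \<omega> k (proj B e) x (triv B k e)))"
  unfolding hor_lift_def
proof (rule the1_equality[OF hor_lift_unique[OF assms]], intro conjI allI)
  have "bilinear (\<omega> k (proj B e))"
    using con k e unfolding connection_def by blast
  then show "linear (\<lambda>x. (x, - \<omega> k (proj B e) x (triv B k e)))"
    by (auto intro!: linearI simp: bilinear_ladd bilinear_lmul)
qed (simp_all add: d_proj_eq[OF B k e] vert_proj_eq[OF B k e])

text \<open>The fibre of \<open>(V \<oplus> T\<^sub>M) \<oplus> (V \<oplus> T\<^sub>M)\<^sup>\<or>\<close> is modelled on \<open>('f \<times> 'e) \<times> ('f \<times> 'e)\<close>.\<close>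

definition F_map :: "('k, 'p, 'e::euclidean_space, 'v, 'f::euclidean_space, 'z) vbundle_scheme
    \<Rightarrow> ('k \<Rightarrow> 'p \<Rightarrow> 'e \<Rightarrow> 'f \<Rightarrow> 'f) \<Rightarrow> 'k \<Rightarrow> 'v
    \<Rightarrow> ('e \<times> 'f) \<times> ('e \<times> 'f) \<Rightarrow> ('f \<times> 'e) \<times> ('f \<times> 'e)" where
  "F_map B \<omega> k e = (\<lambda>(w, \<xi>).
     ((vert_proj B \<omega> k e w, d_proj B k e w),
      (adjoint (vert B k e) \<xi>, adjoint (hor_lift B \<omega> k e) \<xi>)))"


lemma F_map_eq:
  assumes B: "smooth_vector_bundle B" and con: "connection B \<omega>"
    and k: "k \<in> idx B" and e: "proj B e \<in> chart_dom B k"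
  defines "h \<equiv> \<lambda>x. \<omega> k (proj B e) x (triv B k e)"
  shows "linear h"
    and "F_map B \<omega> k e ((x, y), (\<xi>, \<eta>)) = ((y + h x, x), (\<eta>, \<xi> - adjoint h \<eta>))"
proof -
  have bil: "bilinear (\<omega> k (proj B e))"
    using con k e unfolding connection_def by blast
  then show h: "linear h"
    by (auto intro!: linearI simp: h_def bilinear_ladd bilinear_lmul)
  have v: "adjoint (vert B k e) = snd"
    by (rule adjoint_unique) (auto simp: vert_eq[OF B k e])
  have a: "adjoint (hor_lift B \<omega> k e) = (\<lambda>\<xi>. fst \<xi> - adjoint h (snd \<xi>))"
    by (rule adjoint_unique)
       (auto simp: hor_lift_eq[OF B con k e] h_def[symmetric] inner_diff_right adjoint_works[OF h]
         fun_cong[OF h_def[THEN meta_eq_to_obj_eq], symmetric])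
  show "F_map B \<omega> k e ((x, y), (\<xi>, \<eta>)) = ((y + h x, x), (\<eta>, \<xi> - adjoint h \<eta>))"
    by (simp add: F_map_def d_proj_eq[OF B k e] vert_proj_eq[OF B k e] v a h_def)
qed

lemma bij_F_map:
  assumes "smooth_vector_bundle B" "connection B \<omega>" "k \<in> idx B" "proj B e \<in> chart_dom B k"
  shows "bij (F_map B \<omega> k e)"
proof (rule o_bij)
  let ?h = "\<lambda>x. \<omega> k (proj B e) x (triv B k e)"
  let ?g = "\<lambda>((v, x), (f, \<zeta>)). ((x, v - ?h x), (\<zeta> + adjoint ?h f, f))"
  show "?g \<circ> F_map B \<omega> k e = id" "F_map B \<omega> k e \<circ> ?g = id"
    by (auto simp: fun_eq_iff F_map_eq(2)[OF assms])
qed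

lemma pairing_F_map:
  assumes "smooth_vector_bundle B" "connection B \<omega>" "k \<in> idx B" "proj B e \<in> chart_dom B k"
  shows "pairing (F_map B \<omega> k e a) (F_map B \<omega> k e b) = pairing a b"
proof -
  obtain x y \<xi> \<eta> where a: "a = ((x, y), (\<xi>, \<eta>))" by (metis surj_pair)
  obtain x' y' \<xi>' \<eta>' where b: "b = ((x', y'), (\<xi>', \<eta>'))" by (metis surj_pair)
  show ?thesis
    unfolding a b F_map_eq(2)[OF assms]
    by (simp add: pairing_def inner_add inner_diff adjoint_clauses[OF F_map_eq(1)[OF assms]])
qed


section \<open>Semi-flat generalized almost complex structures\<close>

definition adapted :: "('k, 'p, 'e::euclidean_space, 'v, 'f::euclidean_space, 'z) vbundle_scheme
    \<Rightarrow> ('k \<Rightarrow> 'p \<Rightarrow> ('f \<times> 'e) \<times> ('f \<times> 'e) \<Rightarrow> ('f \<times> 'e) \<times> ('f \<times> 'e)) \<Rightarrow> bool" where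
  "adapted B J \<longleftrightarrow> (\<forall>k\<in>idx B. \<forall>p\<in>chart_dom B k.
     J k p ` {((v, 0), (f, 0)) | v f. True} = {((0, x), (0, \<xi>)) | x \<xi>. True})"

text \<open>
  \<open>J = F\<^sup>-\<^sup>1 (\<pi>\<^sup>* J\<^sub>0) F\<close>.  That \<open>J\<close> squares to \<open>- 1\<close> and is orthogonal is a consequence, by
  \<open>bij_F_map\<close> and \<open>pairing_F_map\<close>, and is therefore not demanded separately.
\<close>

definition semi_flat :: "('k, 'p::topological_space, 'e::euclidean_space, 'v::topological_space,
    'f::euclidean_space, 'z) vbundle_scheme \<Rightarrow> ('k \<Rightarrow> 'p \<Rightarrow> 'e \<Rightarrow> 'f \<Rightarrow> 'f)
    \<Rightarrow> ('k \<Rightarrow> 'p \<Rightarrow> ('f \<times> 'e) \<times> ('f \<times> 'e) \<Rightarrow> ('f \<times> 'e) \<times> ('f \<times> 'e))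
    \<Rightarrow> ('k \<Rightarrow> 'v \<Rightarrow> ('e \<times> 'f) \<times> ('e \<times> 'f) \<Rightarrow> ('e \<times> 'f) \<times> ('e \<times> 'f)) \<Rightarrow> bool" where
  "semi_flat B \<omega> J\<^sub>0 J \<longleftrightarrow>
     gacs B (sum_trans (vtrans B) (jac B)) J\<^sub>0 \<and> adapted B J\<^sub>0 \<and>
     (\<forall>k\<in>idx B. \<forall>e\<in>proj B -` chart_dom B k.
        J k e = inv (F_map B \<omega> k e) \<circ> J\<^sub>0 k (proj B e) \<circ> F_map B \<omega> k e)"

text \<open>
  The blocks \<open>J\<^sub>1\<^sub>2 : T\<^sub>M \<rightarrow> V\<close>, \<open>J\<^sub>2\<^sub>2 : T\<^sub>M\<^sup>\<or> \<rightarrow> V\<close>, \<open>J\<^sub>1\<^sub>3 : V \<rightarrow> T\<^sub>M\<close> and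
  \<open>J\<^sub>3\<^sub>1 : T\<^sub>M \<rightarrow> V\<^sup>\<or>\<close> occupy the positions (1,2), (1,4), (2,1) and (3,2).
\<close>

definition blk12 :: "(('f \<times> 'e) \<times> ('f \<times> 'e) \<Rightarrow> ('f \<times> 'e) \<times> ('f \<times> 'e))
    \<Rightarrow> 'e::euclidean_space \<Rightarrow> 'f::euclidean_space" where
  "blk12 J x = fst (fst (J ((0, x), (0, 0))))"

definition blk22 :: "(('f \<times> 'e) \<times> ('f \<times> 'e) \<Rightarrow> ('f \<times> 'e) \<times> ('f \<times> 'e))
    \<Rightarrow> 'e::euclidean_space \<Rightarrow> 'f::euclidean_space" where
  "blk22 J \<xi> = fst (fst (J ((0, 0), (0, \<xi>))))"

definition blk13 :: "(('f \<times> 'e) \<times> ('f \<times> 'e) \<Rightarrow> ('f \<times> 'e) \<times> ('f \<times> 'e))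
    \<Rightarrow> 'f::euclidean_space \<Rightarrow> 'e::euclidean_space" where
  "blk13 J v = snd (fst (J ((v, 0), (0, 0))))"

definition blk31 :: "(('f \<times> 'e) \<times> ('f \<times> 'e) \<Rightarrow> ('f \<times> 'e) \<times> ('f \<times> 'e))
    \<Rightarrow> 'e::euclidean_space \<Rightarrow> 'f::euclidean_space" where
  "blk31 J x = fst (snd (J ((0, x), (0, 0))))"

definition M_map :: "(('f \<times> 'e) \<times> ('f \<times> 'e) \<Rightarrow> ('f \<times> 'e) \<times> ('f \<times> 'e))
    \<Rightarrow> 'f::euclidean_space \<times> 'f \<Rightarrow> 'e::euclidean_space \<times> 'e" where
  "M_map J = (\<lambda>(v, f).
     (blk13 J v + adjoint (blk22 J) f, - adjoint (blk31 J) v + adjoint (blk12 J) f))"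

text \<open>The sections over \<open>U\<close> of the image sheaf \<open>\<M>(\<S>)\<close>.\<close>

definition M_sheaf :: "('k, 'p::topological_space, 'e::euclidean_space, 'v,
    'f::euclidean_space, 'z) vbundle_scheme \<Rightarrow> ('k \<Rightarrow> 'p \<Rightarrow> 'e \<Rightarrow> 'f \<Rightarrow> 'f)
    \<Rightarrow> ('k \<Rightarrow> 'p \<Rightarrow> ('f \<times> 'e) \<times> ('f \<times> 'e) \<Rightarrow> ('f \<times> 'e) \<times> ('f \<times> 'e))
    \<Rightarrow> 'p set \<Rightarrow> ('k \<Rightarrow> 'p \<Rightarrow> 'e \<times> 'e) set" where
  "M_sheaf B \<omega> J U = {\<sigma>. \<exists>s\<in>flat_sections B \<omega> U.
     \<forall>k\<in>idx B. \<forall>p\<in>U \<inter> chart_dom B k. \<sigma> k p = M_map (J k p) (s k p)}"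

end

theory Submission
  imports Defs
begin

text \<open>
  Denote by \<open>s\<^sup>0\<close> the lift to the total space of a flat section \<open>s\<close> of \<open>V \<oplus> V\<^sup>\<or>\<close>.  For flat
  \<open>s\<close> and \<open>t\<close> one has \<open>[s\<^sup>0, t\<^sup>0] = 0\<close> and \<open>[s\<^sup>0, J t\<^sup>0] = 0\<close>, while \<open>[J s\<^sup>0, J t\<^sup>0]\<close> is the
  horizontal lift of the Courant bracket of \<open>\<M> s\<close> and \<open>\<M> t\<close>.  The bracket of the eigensections
  \<open>s\<^sup>0 - i J s\<^sup>0\<close> and \<open>t\<^sup>0 - i J t\<^sup>0\<close> is therefore the real section \<open>- [J s\<^sup>0, J t\<^sup>0]\<close>, which lies in
  the eigenbundle only if it vanishes.

  Conversely, the obstruction to the bracket of two eigensections being an eigensection is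
  tensorial, and so is the failure of this bracket to transform correctly between two charts.  Both
  can thus be tested, point by point, on combinations of \<open>s\<^sup>0\<close> and \<open>J t\<^sup>0\<close> with \<open>s\<close>, \<open>t\<close> flat, and
  these have arbitrary values at the point because flat sections with prescribed value exist locally.

  In a frame with connection form \<open>A\<close>, the latter are limits of the Picard iterates along rays,
  \<open>f\<^sub>n\<^sub>+\<^sub>1 (x) = c - \<integral>\<^sub>0\<^sup>1 A (x\<^sub>0 + t h) h (f\<^sub>n (x\<^sub>0 + t h)) dt\<close> with \<open>h = x - x\<^sub>0\<close>.  Flatness makes
  \<open>D f\<^sub>n + A f\<^sub>n\<close> tend to zero uniformly on a small ball, so the limit is differentiable and
  parallel in all directions, and smooth since its derivative is as regular as itself.
\<close>

section \<open>Calculus of smooth maps\<close>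

text \<open>The pointwise test rests on the form \<open>dorfman Q (s u) - dorfman P (t u)\<close>
  that the 1/2 d term gives the Courant bracket: each half is bilinear in one value and one
  derivative. Vanishing brackets of lifts thus become symmetry relations at a single point, and
  these survive linear combination. From a in an eigensection a - i J a, subtract a combination of
  lifts with the same value at the point. The remainder is zero there, so no derivative of J or of a
  transition map enters into the derivatives of the remainder and of its image under J. Let R be its
  derivative. In the bracket, the pairing terms containing R cancel because J is orthogonal, hence
  skew. What is left is (1 - i J) applied to R in the complex tangent direction of the other
  section. This lies in the eigenbundle and transforms correctly. Since sections are families of
  components, one per chart, closure under the bracket includes the transformation law, which is
  obtained in this way for eigensections.\<close>

lemma has_derivative_cong_open:
  assumes "open S" "u \<in> S" "\<And>x. x \<in> S \<Longrightarrow> f x = g x"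
  shows "(f has_derivative f') (at u) \<longleftrightarrow> (g has_derivative f') (at u)"
  using assms by (metis has_derivative_transform_within_open)

lemma frechet_derivative_eqI:
  assumes "(f has_derivative f') (at u)"
  shows "frechet_derivative f (at u) = f'"
  using frechet_derivative_at[OF assms] by simp

lemma frechet_derivative_cong_open:
  assumes "open S" "u \<in> S" "\<And>x. x \<in> S \<Longrightarrow> f x = g x"
  shows "frechet_derivative f (at u) = frechet_derivative g (at u)"
  unfolding frechet_derivative_def using has_derivative_cong_open[OF assms] by simp

lemma C_on_SucD:
  assumes "C_on (Suc r) S f"
  shows "\<And>u. u \<in> S \<Longrightarrow> (f has_derivative frechet_derivative f (at u)) (at u)"
    and "\<And>w. C_on r S (\<lambda>u. frechet_derivative f (at u) w)"
  using assms by (auto simp: frechet_derivative_works)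

lemma C_on_cong:
  assumes "open S" "\<And>x. x \<in> S \<Longrightarrow> f x = g x" "C_on r S f"
  shows "C_on r S g"
  using assms(2,3)
proof (induction r arbitrary: f g)
  case 0
  then show ?case by (simp cong: continuous_on_cong)
next
  case (Suc r)
  have eq: "frechet_derivative f (at u) = frechet_derivative g (at u)" if "u \<in> S" for u
    using frechet_derivative_cong_open[OF assms(1) that] Suc.prems(1) by blast
  have "g differentiable (at u)" if "u \<in> S" for u
    using C_on_SucD(1)[OF Suc.prems(2) that]
      has_derivative_cong_open[OF assms(1) that, of f g] Suc.prems(1)
    unfolding differentiable_def by blast
  moreover have "C_on r S (\<lambda>u. frechet_derivative g (at u) w)" for w
    using Suc.IH[of "\<lambda>u. frechet_derivative f (at u) w"] C_on_SucD(2)[OF Suc.prems(2)] eq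
    by simp
  ultimately show ?case by simp
qed

lemma C_on_SucI:
  assumes "open S" "\<And>u. u \<in> S \<Longrightarrow> (f has_derivative f' u) (at u)"
    and "\<And>w. C_on r S (\<lambda>u. f' u w)"
  shows "C_on (Suc r) S f"
proof -
  have "C_on r S (\<lambda>u. frechet_derivative f (at u) w)" for w
    by (rule C_on_cong[OF assms(1) _ assms(3)[of w]])
       (simp add: frechet_derivative_eqI[OF assms(2)])
  then show ?thesis
    using assms(2) by (auto simp: differentiable_def)
qed

lemma C_on_Suc_imp: "C_on (Suc r) S f \<Longrightarrow> C_on r S f"
proof (induction r arbitrary: f)
  case 0
  then show ?case
    by (auto intro!: continuous_at_imp_continuous_on differentiable_imp_continuous_within)
qed simp

lemma C_on_subset: "C_on r S f \<Longrightarrow> T \<subseteq> S \<Longrightarrow> C_on r T f"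
  by (induction r arbitrary: f) (auto intro: continuous_on_subset)

lemma C_on_const: "C_on r S (\<lambda>x. c)"
  by (induction r arbitrary: c) auto

lemma C_on_bounded_linear:
  assumes "open S" "bounded_linear h" "C_on r S f"
  shows "C_on r S (\<lambda>x. h (f x))"
  using assms(3)
proof (induction r arbitrary: f)
  case 0
  then show ?case
    using bounded_linear.continuous_on[OF assms(2)] by simp
next
  case (Suc r)
  note D = C_on_SucD[OF Suc.prems]
  show ?case
    by (rule C_on_SucI[OF assms(1)])
       (use D Suc.IH in \<open>auto intro!: bounded_linear.has_derivative[OF assms(2)]\<close>)
qed

lemma C_on_add:
  assumes "open S" "C_on r S f" "C_on r S g"
  shows "C_on r S (\<lambda>x. f x + g x)"
  using assms(2,3)
proof (induction r arbitrary: f g)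
  case (Suc r)
  note D = C_on_SucD[OF Suc.prems(1)] C_on_SucD[OF Suc.prems(2)]
  show ?case
    by (rule C_on_SucI[OF assms(1)]) (use D Suc.IH in \<open>auto intro!: has_derivative_add\<close>)
qed (simp add: continuous_on_add)

lemma C_on_scaleR:
  assumes "open S" "C_on r S c" "C_on r S f"
  shows "C_on r S (\<lambda>x. c x *\<^sub>R f x)"
  using assms(2,3)
proof (induction r arbitrary: c f)
  case (Suc r)
  note D = C_on_SucD[OF Suc.prems(1)] C_on_SucD[OF Suc.prems(2)]
  note C = C_on_Suc_imp[OF Suc.prems(1)] C_on_Suc_imp[OF Suc.prems(2)]
  show ?case
    by (rule C_on_SucI[OF assms(1) has_derivative_scaleR])
       (use D C Suc.IH in \<open>auto intro!: C_on_add[OF assms(1)]\<close>)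
qed (simp add: continuous_on_scaleR)

lemma C_on_sum:
  assumes "open S" "\<And>i. i \<in> I \<Longrightarrow> C_on r S (f i)"
  shows "C_on r S (\<lambda>x. \<Sum>i\<in>I. f i x)"
  using assms(2)
  by (induction I rule: infinite_finite_induct) (auto intro: C_on_const C_on_add[OF assms(1)])

section \<open>Families of linear maps, given by their values on fixed vectors\<close>

lemma linear_Basis_expand:
  assumes "linear L"
  shows "L x = (\<Sum>b\<in>Basis. (x \<bullet> b) *\<^sub>R L b)"
proof -
  have "L x = L (\<Sum>b\<in>Basis. (x \<bullet> b) *\<^sub>R b)"
    by (simp add: euclidean_representation)
  then show ?thesis
    using assms by (simp add: linear_sum linear_cmul)
qed

text \<open>Regularity of a family of linear maps means regularity of \<open>L x b\<close> for each
  fixed \<open>b\<close>. Expanding the argument in a basis turns the application into a finite sum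
  of products.\<close>

lemma C_on_apply:
  fixes g :: "'a::real_normed_vector \<Rightarrow> 'b::euclidean_space"
  assumes S: "open S" and L: "\<And>x. x \<in> S \<Longrightarrow> linear (L x)" "\<And>b. C_on r S (\<lambda>x. L x b)"
    and g: "C_on r S g"
  shows "C_on r S (\<lambda>x. L x (g x))"
proof -
  have "C_on r S (\<lambda>x. \<Sum>b\<in>Basis. (g x \<bullet> b) *\<^sub>R L x b)"
    by (intro C_on_sum[OF S] C_on_scaleR[OF S _ L(2)]
        C_on_bounded_linear[OF S bounded_linear_inner_left g])
  then show ?thesis
    by (rule C_on_cong[OF S, rotated]) (rule linear_Basis_expand[OF L(1), symmetric])
qed

text \<open>By the chain rule the derivative is a linear family applied to a vector, and the family
  is again a composition with \<open>g\<close>. So the induction varies \<open>f\<close> alone, and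
  \<open>C_on_apply\<close> closes the step.\<close>

lemma C_on_compose:
  fixes g :: "'a::real_normed_vector \<Rightarrow> 'b::euclidean_space"
  assumes S: "open S" and T: "open T" "g ` S \<subseteq> T"
    and "C_on r T f" "C_on r S g"
  shows "C_on r S (\<lambda>x. f (g x))"
  using assms(4,5)
proof (induction r arbitrary: f)
  case 0
  then show ?case
    using T(2) by (auto intro: continuous_on_compose2)
next
  case (Suc r)
  note D = C_on_SucD[OF Suc.prems(1)] C_on_SucD[OF Suc.prems(2)]
  have gT: "g u \<in> T" if "u \<in> S" for u using T(2) that by auto
  show ?case
  proof (rule C_on_SucI[OF S])
    show "((\<lambda>x. f (g x)) has_derivative
       (\<lambda>w. frechet_derivative f (at (g u)) (frechet_derivative g (at u) w))) (at u)"
      if "u \<in> S" for u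
      using has_derivative_compose[OF D(3)[OF that] D(1)[OF gT[OF that]]] .
    show "C_on r S (\<lambda>u. frechet_derivative f (at (g u)) (frechet_derivative g (at u) w))" for w
    proof (rule C_on_apply[OF S])
      show "linear (frechet_derivative f (at (g u)))" if "u \<in> S" for u
        using D(1)[OF gT[OF that]] by (rule has_derivative_linear)
      show "C_on r S (\<lambda>x. frechet_derivative f (at (g x)) b)" for b
        by (rule Suc.IH[OF D(2) C_on_Suc_imp[OF Suc.prems(2)]])
    qed (rule D)
  qed
qed

lemma smooth_on_subset: "smooth_on S f \<Longrightarrow> T \<subseteq> S \<Longrightarrow> smooth_on T f"
  by (auto simp: smooth_on_def intro: C_on_subset)

lemma smooth_on_cong:
  assumes "open S" "smooth_on S f" "\<And>x. x \<in> S \<Longrightarrow> f x = g x"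
  shows "smooth_on S g"
  using assms by (auto simp: smooth_on_def intro: C_on_cong)

lemma smooth_on_has_derivative:
  assumes "smooth_on S f" "u \<in> S"
  shows "(f has_derivative frechet_derivative f (at u)) (at u)"
  using assms C_on_SucD(1) unfolding smooth_on_def by blast

lemma smooth_on_frechet:
  "smooth_on S f \<Longrightarrow> smooth_on S (\<lambda>u. frechet_derivative f (at u) w)"
  unfolding smooth_on_def using C_on_SucD(2) by blast

lemma smooth_on_imp_continuous_on: "smooth_on S f \<Longrightarrow> continuous_on S f"
  unfolding smooth_on_def using C_on.simps(1) by blast

lemma smooth_on_const: "smooth_on S (\<lambda>x. c)"
  by (simp add: smooth_on_def C_on_const)

lemma smooth_on_add:
  "open S \<Longrightarrow> smooth_on S f \<Longrightarrow> smooth_on S g \<Longrightarrow> smooth_on S (\<lambda>x. f x + g x)"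
  by (simp add: smooth_on_def C_on_add)

lemma smooth_on_scaleR:
  "open S \<Longrightarrow> smooth_on S c \<Longrightarrow> smooth_on S f \<Longrightarrow> smooth_on S (\<lambda>x. c x *\<^sub>R f x)"
  by (simp add: smooth_on_def C_on_scaleR)

lemma smooth_on_sum:
  "open S \<Longrightarrow> (\<And>i. i \<in> I \<Longrightarrow> smooth_on S (f i)) \<Longrightarrow> smooth_on S (\<lambda>x. \<Sum>i\<in>I. f i x)"
  by (simp add: smooth_on_def C_on_sum)

lemma smooth_on_bounded_linear:
  "open S \<Longrightarrow> bounded_linear h \<Longrightarrow> smooth_on S f \<Longrightarrow> smooth_on S (\<lambda>x. h (f x))"
  by (simp add: smooth_on_def C_on_bounded_linear)

lemma smooth_on_fst: "open S \<Longrightarrow> smooth_on S f \<Longrightarrow> smooth_on S (\<lambda>x. fst (f x))"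
  by (rule smooth_on_bounded_linear[OF _ bounded_linear_fst])

lemma smooth_on_snd: "open S \<Longrightarrow> smooth_on S f \<Longrightarrow> smooth_on S (\<lambda>x. snd (f x))"
  by (rule smooth_on_bounded_linear[OF _ bounded_linear_snd])

lemma smooth_on_minus: "open S \<Longrightarrow> smooth_on S f \<Longrightarrow> smooth_on S (\<lambda>x. - f x)"
  by (rule smooth_on_bounded_linear[OF _ bounded_linear_minus[OF bounded_linear_ident]])

lemma smooth_on_diff:
  "open S \<Longrightarrow> smooth_on S f \<Longrightarrow> smooth_on S g \<Longrightarrow> smooth_on S (\<lambda>x. f x - g x)"
  using smooth_on_add[OF _ _ smooth_on_minus] by fastforce

lemma smooth_on_ident: "open S \<Longrightarrow> smooth_on S (\<lambda>x. x)"
  unfolding smooth_on_def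
proof
  fix r assume S: "open S"
  show "C_on r S (\<lambda>x. x)"
  proof (cases r)
    case (Suc r)
    show ?thesis
      unfolding Suc by (rule C_on_SucI[OF S has_derivative_ident]) (rule C_on_const)
  qed (simp add: continuous_on_id)
qed

lemma smooth_on_apply:
  fixes g :: "'a::real_normed_vector \<Rightarrow> 'b::euclidean_space"
  assumes "open S" "\<And>x. x \<in> S \<Longrightarrow> linear (L x)" "\<And>b. smooth_on S (\<lambda>x. L x b)" "smooth_on S g"
  shows "smooth_on S (\<lambda>x. L x (g x))"
  using assms by (simp add: smooth_on_def C_on_apply)

lemma smooth_on_compose:
  fixes g :: "'a::real_normed_vector \<Rightarrow> 'b::euclidean_space"
  assumes "open S" "open T" "smooth_on T f" "smooth_on S g" "\<And>x. x \<in> S \<Longrightarrow> g x \<in> T"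
  shows "smooth_on S (\<lambda>x. f (g x))"
  unfolding smooth_on_def
proof
  fix r
  show "C_on r S (\<lambda>x. f (g x))"
    by (rule C_on_compose[OF assms(1,2)]) (use assms(3-5) in \<open>auto simp: smooth_on_def\<close>)
qed

lemma smooth_on_Pair:
  assumes "open S" "smooth_on S f" "smooth_on S g"
  shows "smooth_on S (\<lambda>x. (f x, g x))"
proof -
  have "smooth_on S (\<lambda>x. (f x, 0) + (0, g x))"
    by (intro smooth_on_add[OF assms(1)]
        smooth_on_bounded_linear[OF assms(1) bounded_linear_Pair assms(2)]
        smooth_on_bounded_linear[OF assms(1) bounded_linear_Pair assms(3)]
        bounded_linear_ident bounded_linear_zero)
  then show ?thesis by simp
qed

lemma smooth_on_inner:
  fixes f g :: "'a::real_normed_vector \<Rightarrow> 'b::euclidean_space"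
  assumes "open S" "smooth_on S f" "smooth_on S g"
  shows "smooth_on S (\<lambda>x. f x \<bullet> g x)"
  by (rule smooth_on_apply[OF assms(1) _ _ assms(3)])
     (auto intro!: smooth_on_bounded_linear[OF assms(1) bounded_linear_inner_left assms(2)]
       bounded_linear.linear[OF bounded_linear_inner_right])

lemmas smooth_on_intros = smooth_on_const smooth_on_ident smooth_on_add smooth_on_diff
  smooth_on_minus smooth_on_scaleR smooth_on_sum smooth_on_fst smooth_on_snd smooth_on_Pair
  smooth_on_inner

lemma adjoint_expand:
  fixes L :: "'a::euclidean_space \<Rightarrow> 'b::euclidean_space"
  assumes "linear L"
  shows "adjoint L y = (\<Sum>b\<in>Basis. (y \<bullet> L b) *\<^sub>R b)"
  using euclidean_representation[of "adjoint L y"] by (simp add: adjoint_clauses[OF assms])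

lemma smooth_on_adjoint:
  fixes L :: "'c::real_normed_vector \<Rightarrow> 'a::euclidean_space \<Rightarrow> 'b::euclidean_space"
  assumes "open S" "\<And>x. x \<in> S \<Longrightarrow> linear (L x)" "\<And>b. smooth_on S (\<lambda>x. L x b)" "smooth_on S g"
  shows "smooth_on S (\<lambda>x. adjoint (L x) (g x))"
proof -
  have "smooth_on S (\<lambda>x. \<Sum>b\<in>Basis. (g x \<bullet> L x b) *\<^sub>R b)"
    by (intro smooth_on_intros assms)
  then show ?thesis
    by (rule smooth_on_cong[OF assms(1)]) (simp add: adjoint_expand[OF assms(2)])
qed

lemma continuous_on_apply:
  fixes g :: "'a::topological_space \<Rightarrow> 'b::euclidean_space"
    and L :: "'a \<Rightarrow> 'b \<Rightarrow> 'c::real_normed_vector"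
  assumes L: "\<And>x. x \<in> S \<Longrightarrow> linear (L x)" "\<And>b. continuous_on S (\<lambda>x. L x b)"
    and g: "continuous_on S g"
  shows "continuous_on S (\<lambda>x. L x (g x))"
proof -
  have "continuous_on S (\<lambda>x. \<Sum>b\<in>Basis. (g x \<bullet> b) *\<^sub>R L x b)"
    by (intro continuous_intros L g)
  then show ?thesis
    by (rule continuous_on_eq) (rule linear_Basis_expand[OF L(1), symmetric])
qed

text \<open>Derivatives are unique, so linearity in the parameter passes to the derivative. This
  lets the derivatives for basis vectors determine those for all parameters.\<close>

lemma linear_derivative_param:
  fixes L :: "'a::real_normed_vector \<Rightarrow> 'b::real_vector \<Rightarrow> 'c::real_normed_vector"
  assumes S: "open S" "u \<in> S" and L: "\<And>x. x \<in> S \<Longrightarrow> linear (L x)"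
    and L': "\<And>c. ((\<lambda>x. L x c) has_derivative L' c) (at u)"
  shows "linear (\<lambda>c. L' c w)"
proof (rule linearI)
  fix a b :: 'b and r :: real
  have "((\<lambda>x. L x (a + b)) has_derivative (\<lambda>w. L' a w + L' b w)) (at u)"
    by (rule has_derivative_transform_within_open[OF has_derivative_add[OF L' L'] S])
       (simp add: linear_add[OF L])
  then show "L' (a + b) w = L' a w + L' b w"
    using has_derivative_unique[OF L'] by metis
  have "((\<lambda>x. L x (r *\<^sub>R a)) has_derivative (\<lambda>w. r *\<^sub>R L' a w)) (at u)"
    by (rule has_derivative_transform_within_open[OF has_derivative_scaleR_right[OF L'] S])
       (simp add: linear_cmul[OF L])
  then show "L' (r *\<^sub>R a) w = r *\<^sub>R L' a w"
    using has_derivative_unique[OF L'] by metis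
qed

section \<open>Product rules for a linear family applied to a vector\<close>

lemma has_derivative_apply:
  fixes g :: "'a::real_normed_vector \<Rightarrow> 'b::euclidean_space"
  assumes S: "open S" "u \<in> S" and L: "\<And>x. x \<in> S \<Longrightarrow> linear (L x)"
    and L': "\<And>b. ((\<lambda>x. L x b) has_derivative L' b) (at u)"
    and g: "(g has_derivative g') (at u)"
  shows "((\<lambda>x. L x (g x)) has_derivative (\<lambda>w. L' (g u) w + L u (g' w))) (at u)"
proof -
  have lin: "L' c w = (\<Sum>b\<in>Basis. (c \<bullet> b) *\<^sub>R L' b w)" for c w
    using linear_Basis_expand[OF linear_derivative_param[OF S L L']] .
  have "((\<lambda>x. \<Sum>b\<in>Basis. (g x \<bullet> b) *\<^sub>R L x b) has_derivative
      (\<lambda>w. \<Sum>b\<in>Basis. (g u \<bullet> b) *\<^sub>R L' b w + (g' w \<bullet> b) *\<^sub>R L u b)) (at u)"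
    by (intro has_derivative_sum has_derivative_scaleR has_derivative_inner_left L' g)
  then have "((\<lambda>x. L x (g x)) has_derivative
      (\<lambda>w. \<Sum>b\<in>Basis. (g u \<bullet> b) *\<^sub>R L' b w + (g' w \<bullet> b) *\<^sub>R L u b)) (at u)"
    by (rule has_derivative_transform_within_open[OF _ S]) (rule linear_Basis_expand[OF L, symmetric])
  then show ?thesis
    by (simp add: sum.distrib lin[of "g u", symmetric] linear_Basis_expand[OF L[OF S(2)], symmetric])
qed

text \<open>At a zero of \<open>c\<close> the product rule asks only for continuity of the other
  factor: c m - c' m(u) = (c - c') m + c' (m - m(u)), and both terms are small compared with the
  increment.\<close>

lemma has_derivative_scaleR_vanishing:
  fixes m :: "'a::real_normed_vector \<Rightarrow> 'c::real_normed_vector"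
  assumes c: "(c has_derivative c') (at u)" "c u = 0" and m: "isCont m u"
  shows "((\<lambda>x. c x *\<^sub>R m x) has_derivative (\<lambda>w. c' w *\<^sub>R m u)) (at u)"
  unfolding has_derivative_at
proof
  have bl: "bounded_linear c'"
    using c(1) by (rule has_derivative_bounded_linear)
  obtain K where K: "\<And>w. \<bar>c' w\<bar> \<le> norm w * K"
    using bounded_linear.bounded[OF bl] by auto
  have Kh: "\<bar>c' h\<bar> \<le> norm h * \<bar>K\<bar>" for h
    by (rule order_trans[OF K mult_left_mono]) auto
  show "bounded_linear (\<lambda>w. c' w *\<^sub>R m u)"
    by (rule bounded_linear_scaleR_const[OF bl])
  have m0: "((\<lambda>h. m (u + h)) \<longlongrightarrow> m u) (at 0)"
    using m by (simp add: isCont_iff)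
  have c0: "((\<lambda>h. \<bar>c (u + h) - c' h\<bar> / norm h) \<longlongrightarrow> 0) (at 0)"
    using c by (simp add: has_derivative_at)
  have lim: "((\<lambda>h. \<bar>c (u + h) - c' h\<bar> / norm h * norm (m (u + h))
      + \<bar>K\<bar> * norm (m (u + h) - m u)) \<longlongrightarrow> 0 * norm (m u) + \<bar>K\<bar> * norm (m u - m u)) (at 0)"
    by (intro tendsto_add tendsto_mult c0 tendsto_norm m0 tendsto_const tendsto_diff)
  then have lim': "((\<lambda>h. \<bar>c (u + h) - c' h\<bar> / norm h * norm (m (u + h))
      + \<bar>K\<bar> * norm (m (u + h) - m u)) \<longlongrightarrow> 0) (at 0)"
    by simp
  have "norm (c (u + h) *\<^sub>R m (u + h) - c u *\<^sub>R m u - c' h *\<^sub>R m u) / norm h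
      \<le> \<bar>c (u + h) - c' h\<bar> / norm h * norm (m (u + h)) + \<bar>K\<bar> * norm (m (u + h) - m u)" for h
  proof (cases "h = 0")
    case False
    have "c (u + h) *\<^sub>R m (u + h) - c u *\<^sub>R m u - c' h *\<^sub>R m u
        = (c (u + h) - c' h) *\<^sub>R m (u + h) + c' h *\<^sub>R (m (u + h) - m u)"
      using c(2) by (simp add: scaleR_diff_left scaleR_diff_right)
    also have "norm \<dots> \<le> \<bar>c (u + h) - c' h\<bar> * norm (m (u + h)) + \<bar>c' h\<bar> * norm (m (u + h) - m u)"
      using norm_triangle_ineq by (metis norm_scaleR)
    also have "\<dots> \<le> \<bar>c (u + h) - c' h\<bar> * norm (m (u + h))
        + (norm h * \<bar>K\<bar>) * norm (m (u + h) - m u)"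
      by (intro add_left_mono mult_right_mono Kh norm_ge_zero)
    finally have "norm (c (u + h) *\<^sub>R m (u + h) - c u *\<^sub>R m u - c' h *\<^sub>R m u) / norm h
      \<le> (\<bar>c (u + h) - c' h\<bar> * norm (m (u + h)) + (norm h * \<bar>K\<bar>) * norm (m (u + h) - m u)) / norm h"
      by (rule divide_right_mono) simp
    then show ?thesis
      using False by (simp add: add_divide_distrib)
  qed simp
  then have le: "norm (norm (c (u + h) *\<^sub>R m (u + h) - c u *\<^sub>R m u - c' h *\<^sub>R m u) / norm h)
      \<le> \<bar>c (u + h) - c' h\<bar> / norm h * norm (m (u + h)) + \<bar>K\<bar> * norm (m (u + h) - m u)" for h
    by simp
  define F where "F = (\<lambda>h. norm (c (u + h) *\<^sub>R m (u + h) - c u *\<^sub>R m u - c' h *\<^sub>R m u) / norm h)"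
  define G where "G = (\<lambda>h. \<bar>c (u + h) - c' h\<bar> / norm h * norm (m (u + h))
      + \<bar>K\<bar> * norm (m (u + h) - m u))"
  have "norm (F h) \<le> G h" for h
    using le unfolding F_def G_def .
  then have "\<forall>\<^sub>F h in at 0. norm (F h) \<le> G h"
    by (simp only: eventually_True)
  then have "(F \<longlongrightarrow> 0) (at 0)"
    using lim' unfolding G_def[symmetric] by (rule Lim_null_comparison)
  then show "(\<lambda>h. norm (c (u + h) *\<^sub>R m (u + h) - c u *\<^sub>R m u - c' h *\<^sub>R m u) / norm h) \<midarrow>0\<rightarrow> 0"
    unfolding F_def .
qed

text \<open>The source of tensoriality: for a section that vanishes at \<open>u\<close>, a bundle
  map enters the derivative only through its value at \<open>u\<close>.\<close>

lemma has_derivative_apply_vanishing: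
  fixes g :: "'a::real_normed_vector \<Rightarrow> 'b::euclidean_space"
    and L :: "'a \<Rightarrow> 'b \<Rightarrow> 'c::real_normed_vector"
  assumes S: "open S" "u \<in> S" and L: "\<And>x. x \<in> S \<Longrightarrow> linear (L x)"
    and cont: "\<And>b. continuous_on S (\<lambda>x. L x b)"
    and g: "(g has_derivative g') (at u)" "g u = 0"
  shows "((\<lambda>x. L x (g x)) has_derivative (\<lambda>w. L u (g' w))) (at u)"
proof -
  define F where "F = (\<lambda>x. \<Sum>b\<in>Basis. (g x \<bullet> b) *\<^sub>R L x b)"
  have cont': "isCont (\<lambda>x. L x b) u" for b
    using cont[of b] S by (metis continuous_on_eq_continuous_at)
  have trm: "((\<lambda>x. (g x \<bullet> b) *\<^sub>R L x b) has_derivative (\<lambda>w. (g' w \<bullet> b) *\<^sub>R L u b)) (at u)" for b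
    using has_derivative_scaleR_vanishing[OF has_derivative_inner_left[OF g(1)] _ cont'] g(2)
    by simp
  have "(F has_derivative (\<lambda>w. \<Sum>b\<in>Basis. (g' w \<bullet> b) *\<^sub>R L u b)) (at u)"
    unfolding F_def by (rule has_derivative_sum) (rule trm)
  also have "(\<lambda>w. \<Sum>b\<in>Basis. (g' w \<bullet> b) *\<^sub>R L u b) = (\<lambda>w. L u (g' w))"
    by (rule ext) (rule linear_Basis_expand[OF L[OF S(2)], symmetric])
  finally show ?thesis
    by (rule has_derivative_transform_within_open[OF _ S])
       (simp add: F_def linear_Basis_expand[OF L, symmetric])
qed

section \<open>Local flat sections\<close>

text \<open>\<open>A\<close> is a connection form in one frame and chart, \<open>A'\<close> its
  derivative as an explicit parameter, and \<open>flat\<close> says that the curvature vanishes. The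
  bound on \<open>K * r\<close> gives 2 * K * r <= 1/4, the factor gained in
  \<open>defect_T\<close>, where two terms of size \<open>K * r\<close> occur.\<close>

locale flat_ball =
  fixes A :: "'e::euclidean_space \<Rightarrow> 'e \<Rightarrow> 'f::euclidean_space \<Rightarrow> 'f"
    and A' :: "'e \<Rightarrow> 'e \<Rightarrow> 'f \<Rightarrow> 'e \<Rightarrow> 'f"
    and x0 :: 'e and r K :: real
  assumes bil: "x \<in> ball x0 r \<Longrightarrow> bilinear (A x)"
    and der: "x \<in> ball x0 r \<Longrightarrow> ((\<lambda>u. A u w v) has_derivative A' x w v) (at x)"
    and cont': "continuous_on (ball x0 r) (\<lambda>x. A' x w v h)"
    and flat: "x \<in> ball x0 r \<Longrightarrow>
      A' x w v h - A' x h v w + A x h (A x w v) - A x w (A x h v) = 0"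
    and r: "0 < r" and K: "0 \<le> K" "8 * K * r \<le> 1"
    and bound: "x \<in> ball x0 r \<Longrightarrow> norm (A x w v) \<le> K * norm w * norm v"
begin

abbreviation "U \<equiv> ball x0 r"

definition pt :: "'e \<Rightarrow> real \<Rightarrow> 'e" where "pt x t = x0 + t *\<^sub>R (x - x0)"

lemma pt_in: "x \<in> U \<Longrightarrow> t \<in> {0..1} \<Longrightarrow> pt x t \<in> U"
proof -
  assume x: "x \<in> U" and t: "t \<in> {0..1}"
  have "norm (t *\<^sub>R (x - x0)) \<le> norm (x - x0)"
    using t by (simp add: mult_left_le_one_le)
  then show "pt x t \<in> U"
    using x by (simp add: pt_def dist_norm norm_minus_commute)
qed

lemma cont: "continuous_on U (\<lambda>x. A x w v)"
  using der by (auto intro!: continuous_at_imp_continuous_on has_derivative_continuous)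

lemma lin: "x \<in> U \<Longrightarrow> linear (A x w)" "x \<in> U \<Longrightarrow> linear (\<lambda>w. A x w v)"
  using bil unfolding bilinear_def by auto

lemma lin':
  assumes "x \<in> U"
  shows "linear (\<lambda>h. A' x w v h)" "linear (\<lambda>v. A' x w v h)" "linear (\<lambda>w. A' x w v h)"
proof -
  show "linear (\<lambda>h. A' x w v h)"
    using has_derivative_linear[OF der[OF assms]] .
  show "linear (\<lambda>v. A' x w v h)"
    by (rule linear_derivative_param[OF open_ball assms lin(1) der[OF assms]])
  show "linear (\<lambda>w. A' x w v h)"
    by (rule linear_derivative_param[OF open_ball assms lin(2) der[OF assms]])
qed

text \<open>The derivative is carried as data because the iteration updates a map together with its
  derivative.\<close>

definition C1 :: "('e \<Rightarrow> 'f) \<Rightarrow> ('e \<Rightarrow> 'e \<Rightarrow> 'f) \<Rightarrow> bool" where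
  "C1 f f' \<longleftrightarrow> (\<forall>x\<in>U. (f has_derivative f' x) (at x)) \<and> (\<forall>h. continuous_on U (\<lambda>x. f' x h))"

lemma der_A_apply:
  assumes "C1 f f'" "x \<in> U"
  shows "((\<lambda>x. A x w (f x)) has_derivative (\<lambda>h. A' x w (f x) h + A x w (f' x h))) (at x)"
  by (rule has_derivative_apply[OF open_ball assms(2)])
     (use assms lin der in \<open>auto simp: C1_def\<close>)

text \<open>The covariant derivative of \<open>f\<close> in the direction \<open>h\<close>, which
  the iteration drives to zero.\<close>

definition defect :: "('e \<Rightarrow> 'f) \<Rightarrow> ('e \<Rightarrow> 'e \<Rightarrow> 'f) \<Rightarrow> 'e \<Rightarrow> 'e \<Rightarrow> 'f" where
  "defect f f' x h = f' x h + A x h (f x)"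

definition integrand :: "('e \<Rightarrow> 'f) \<Rightarrow> 'e \<Rightarrow> real \<Rightarrow> 'f" where
  "integrand f x t = A (pt x t) (x - x0) (f (pt x t))"

definition integrand' :: "('e \<Rightarrow> 'f) \<Rightarrow> ('e \<Rightarrow> 'e \<Rightarrow> 'f) \<Rightarrow> 'e \<Rightarrow> real \<Rightarrow> 'e \<Rightarrow> 'f" where
  "integrand' f f' x t h = A' (pt x t) (x - x0) (f (pt x t)) (t *\<^sub>R h)
     + A (pt x t) (x - x0) (f' (pt x t) (t *\<^sub>R h)) + A (pt x t) h (f (pt x t))"

lemma der_integrand:
  assumes C: "C1 f f'" and x: "x \<in> U" and t: "t \<in> {0..1}"
  shows "((\<lambda>x. integrand f x t) has_derivative integrand' f f' x t) (at x)"
proof -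
  have p: "((\<lambda>x. pt x t) has_derivative (\<lambda>h. t *\<^sub>R h)) (at x)"
    unfolding pt_def by (auto intro!: derivative_eq_intros)
  have "((\<lambda>x. A (pt x t) w (f (pt x t))) has_derivative
      (\<lambda>h. A' (pt x t) w (f (pt x t)) (t *\<^sub>R h) + A (pt x t) w (f' (pt x t) (t *\<^sub>R h)))) (at x)" for w
    using has_derivative_compose[OF p der_A_apply[OF C pt_in[OF x t]]] .
  note W = this
  have X: "((\<lambda>x. x - x0) has_derivative (\<lambda>h. h)) (at x)"
    by (auto intro!: derivative_eq_intros)
  show ?thesis
    unfolding integrand_def integrand'_def
    by (rule has_derivative_apply[OF open_ball x lin(2)[OF pt_in[OF _ t]] W X])
qed

lemma cont_pt: "continuous_on (U \<times> {0..1}) (\<lambda>z. pt (fst z) (snd z))"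
  unfolding pt_def by (intro continuous_intros)

lemma cont_comp_pt:
  assumes "continuous_on U g"
  shows "continuous_on (U \<times> {0..1}) (\<lambda>z. g (pt (fst z) (snd z)))"
  by (rule continuous_on_compose2[OF assms cont_pt]) (auto simp: pt_in simp del: mem_ball)

lemma C1_cont: "C1 f f' \<Longrightarrow> continuous_on U f"
  by (auto simp: C1_def intro!: continuous_at_imp_continuous_on has_derivative_continuous)

text \<open>Joint continuity is built up slot by slot: \<open>A\<close> and \<open>A'\<close> are
  linear in each argument, so \<open>continuous_on_apply\<close> lets one fixed argument after the
  other vary.\<close>

lemma cont_integrand':
  assumes C: "C1 f f'"
  shows "continuous_on (U \<times> {0..1}) (\<lambda>z. integrand' f f' (fst z) (snd z) h)"
proof -
  have f: "continuous_on (U \<times> {0..1}) (\<lambda>z. f (pt (fst z) (snd z)))"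
    using cont_comp_pt[OF C1_cont[OF C]] .
  have X: "continuous_on (U \<times> {0..1::real}) (\<lambda>z. fst z - x0)"
    "continuous_on (U \<times> {0..1::real}) (\<lambda>z. snd z *\<^sub>R h)"
    by (intro continuous_intros)+
  have P: "pt (fst z) (snd z) \<in> U" if "z \<in> U \<times> {0..1}" for z
    using that by (auto simp: pt_in simp del: mem_ball)
  have f': "continuous_on (U \<times> {0..1}) (\<lambda>z. f' (pt (fst z) (snd z)) (snd z *\<^sub>R h))"
    by (rule continuous_on_apply[OF _ cont_comp_pt X(2)])
       (use C P in \<open>auto simp: C1_def intro: has_derivative_linear\<close>)
  have A: "continuous_on (U \<times> {0..1}) (\<lambda>z. A (pt (fst z) (snd z)) w (g z))"
    if "continuous_on (U \<times> {0..1}) g" for w g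
    by (rule continuous_on_apply[OF lin(1)[OF P] cont_comp_pt[OF cont] that])
  have AA: "continuous_on (U \<times> {0..1}) (\<lambda>z. A (pt (fst z) (snd z)) (fst z - x0) (g z))"
    if "continuous_on (U \<times> {0..1}) g" for g
    by (rule continuous_on_apply[OF lin(2)[OF P] A[OF that] X(1)])
  have A'1: "continuous_on (U \<times> {0..1}) (\<lambda>z. A' (pt (fst z) (snd z)) w v (snd z *\<^sub>R h))" for w v
    by (rule continuous_on_apply[OF lin'(1)[OF P] cont_comp_pt[OF cont'] X(2)])
  have A'2: "continuous_on (U \<times> {0..1})
      (\<lambda>z. A' (pt (fst z) (snd z)) w (f (pt (fst z) (snd z))) (snd z *\<^sub>R h))" for w
    by (rule continuous_on_apply[OF lin'(2)[OF P] A'1 f])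
  have A'3: "continuous_on (U \<times> {0..1})
      (\<lambda>z. A' (pt (fst z) (snd z)) (fst z - x0) (f (pt (fst z) (snd z))) (snd z *\<^sub>R h))"
    by (rule continuous_on_apply[OF lin'(3)[OF P] A'2 X(1)])
  show ?thesis
    unfolding integrand'_def by (intro continuous_on_add A'3 AA f' A f)
qed

text \<open>
  A fixed point of \<open>T c\<close> is parallel along the rays from \<open>x0\<close> and has the value \<open>c\<close> at \<open>x0\<close>.
\<close>

definition T :: "'f \<Rightarrow> ('e \<Rightarrow> 'f) \<Rightarrow> 'e \<Rightarrow> 'f" where
  "T c f x = c - integral {0..1} (integrand f x)"

definition T' :: "('e \<Rightarrow> 'f) \<Rightarrow> ('e \<Rightarrow> 'e \<Rightarrow> 'f) \<Rightarrow> 'e \<Rightarrow> 'e \<Rightarrow> 'f" where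
  "T' f f' x h = - integral {0..1} (\<lambda>t. integrand' f f' x t h)"

lemma cont_fixed:
  assumes "continuous_on (U \<times> {0..1}) (\<lambda>z. G (fst z) (snd z))" "x \<in> U"
  shows "continuous_on {0..1::real} (G x)"
proof -
  have "continuous_on {0..1::real} (\<lambda>t. (x, t))" by (intro continuous_intros)
  then have "continuous_on {0..1} (\<lambda>t. G (fst (x, t)) (snd (x, t)))"
    by (rule continuous_on_compose2[OF assms(1)]) (use assms(2) in auto)
  then show ?thesis by simp
qed

lemma cont_integrand:
  assumes C: "continuous_on U f" and x: "x \<in> U"
  shows "continuous_on {0..1} (integrand f x)"
proof -
  have f: "continuous_on {0..1} (\<lambda>t. f (pt x t))"
    using cont_fixed[OF cont_comp_pt[OF C], of x] x by auto
  have A: "continuous_on {0..1} (\<lambda>t. A (pt x t) w v)" for w v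
    using cont_fixed[OF cont_comp_pt[OF cont], of x] x by auto
  have "continuous_on {0..1} (\<lambda>t. A (pt x t) (x - x0) (f (pt x t)))"
    by (rule continuous_on_apply[OF lin(1)[OF pt_in[OF x]] A f])
  then show ?thesis
    by (simp add: integrand_def[abs_def])
qed

lemma C1_T:
  assumes C: "C1 f f'"
  shows "C1 (T c f) (T' f f')"
  unfolding C1_def
proof (intro conjI ballI allI)
  fix x assume x: "x \<in> U"
  \<comment> \<open>\<open>leibniz_rule\<close> wants the derivative as a continuous map into
    bounded linear functions. In finite dimension, continuity on each fixed vector suffices.\<close>
  define fx where "fx = (\<lambda>x t. Blinfun (integrand' f f' x t))"
  have bl: "blinfun_apply (fx x t) = integrand' f f' x t" if "x \<in> U" "t \<in> {0..1}" for x t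
    unfolding fx_def
    by (intro bounded_linear_Blinfun_apply has_derivative_bounded_linear[OF der_integrand[OF C that]])
  have cfx: "continuous_on (U \<times> {0..1}) (\<lambda>z. fx (fst z) (snd z))"
  proof (rule continuous_on_blinfun_componentwise)
    fix i :: 'e
    show "continuous_on (U \<times> {0..1}) (\<lambda>z. blinfun_apply (fx (fst z) (snd z)) i)"
      by (rule continuous_on_eq[OF cont_integrand'[OF C, of i]]) (auto simp: bl)
  qed
  have "((\<lambda>x. integral (cbox 0 1) (integrand f x)) has_derivative
      blinfun_apply (integral (cbox 0 1) (fx x))) (at x within U)"
  proof (rule leibniz_rule)
    show "((\<lambda>x. integrand f x t) has_derivative blinfun_apply (fx x t)) (at x within U)"
      if "x \<in> U" "t \<in> cbox 0 1" for x and t :: real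
      using der_integrand[OF C, of x t] bl[of x t] that
      by (auto intro: has_derivative_at_withinI)
    show "integrand f x integrable_on cbox 0 1" if "x \<in> U" for x
      using cont_integrand[OF C1_cont[OF C] that] by (auto intro: integrable_continuous_interval)
    show "continuous_on (U \<times> cbox 0 1) (\<lambda>(x, t). fx x t)"
      using cfx by (simp add: case_prod_unfold)
  qed (use x in auto)
  then have "((\<lambda>x. integral {0..1} (integrand f x)) has_derivative
      blinfun_apply (integral {0..1} (fx x))) (at x)"
    using x by (simp add: at_within_open[OF _ open_ball])
  moreover have "blinfun_apply (integral {0..1} (fx x)) = (\<lambda>h. integral {0..1} (\<lambda>t. integrand' f f' x t h))"
  proof
    fix h
    have "fx x integrable_on {0..1}"
      using cont_fixed[OF cfx x] by (auto intro: integrable_continuous_interval)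
    then have "blinfun_apply (integral {0..1} (fx x)) h = integral {0..1} (\<lambda>t. blinfun_apply (fx x t) h)"
      by (rule blinfun_apply_integral)
    also have "\<dots> = integral {0..1} (\<lambda>t. integrand' f f' x t h)"
      by (rule integral_cong) (simp add: bl[OF x])
    finally show "blinfun_apply (integral {0..1} (fx x)) h = integral {0..1} (\<lambda>t. integrand' f f' x t h)" .
  qed
  ultimately show "(T c f has_derivative T' f f' x) (at x)"
    unfolding T_def T'_def by (auto intro!: derivative_eq_intros)
next
  fix h
  have "continuous_on U (\<lambda>x. integral (cbox 0 1) (\<lambda>t. integrand' f f' x t h))"
    by (rule integral_continuous_on_param)
       (use cont_integrand'[OF C, of h] in \<open>simp add: case_prod_unfold\<close>)
  then show "continuous_on U (\<lambda>x. T' f f' x h)"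
    unfolding T'_def by (auto intro: continuous_on_minus)
qed

text \<open>
  By flatness, the integrand is a total derivative along the ray up to a term in the defect of \<open>f\<close>.
\<close>

lemma integrand'_eq:
  assumes C: "C1 f f'" and x: "x \<in> U" and t: "t \<in> {0..1}"
  defines "p \<equiv> pt x t" and "X \<equiv> x - x0"
  shows "integrand' f f' x t h =
    (A p h (f p) + t *\<^sub>R (A' p h (f p) X + A p h (f' p X)))
      - t *\<^sub>R (A p h (defect f f' p X) - A p X (defect f f' p h))"
proof -
  have p: "p \<in> U" using pt_in[OF x t] by (simp add: p_def)
  have l: "f' p (t *\<^sub>R h) = t *\<^sub>R f' p h"
    using C p by (auto simp: C1_def intro!: linear_cmul has_derivative_linear)
  have fl: "A' p X (f p) h = A' p h (f p) X - A p h (A p X (f p)) + A p X (A p h (f p))"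
    using flat[OF p, of X "f p" h] by (simp add: algebra_simps)
  show ?thesis
    unfolding integrand'_def p_def[symmetric] X_def[symmetric] l linear_cmul[OF lin'(1)[OF p]]
      linear_cmul[OF lin(1)[OF p]] fl defect_def linear_add[OF lin(1)[OF p]]
    by (simp add: scaleR_add_right scaleR_diff_right algebra_simps)
qed

text \<open>The new derivative is compared with the connection form on the old map \<open>f\<close>;
  replacing \<open>f\<close> by its image under \<open>T\<close> costs a further term, which
  \<open>iter_defect\<close> adds. Integrating the decomposition of the integrand over the ray
  leaves only the error \<open>E\<close>.\<close>

lemma defect_T:
  assumes C: "C1 f f'" and x: "x \<in> U"
    and e: "\<And>p h. p \<in> U \<Longrightarrow> norm (defect f f' p h) \<le> e * norm h"
  shows "norm (T' f f' x h + A x h (f x)) \<le> e / 4 * norm h"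
proof -
  define X where "X = x - x0"
  define G where "G = (\<lambda>t. A (pt x t) h (f (pt x t))
    + t *\<^sub>R (A' (pt x t) h (f (pt x t)) X + A (pt x t) h (f' (pt x t) X)))"
  define E where "E = (\<lambda>t. t *\<^sub>R (A (pt x t) h (defect f f' (pt x t) X)
    - A (pt x t) X (defect f f' (pt x t) h)))"
  have nX: "norm X \<le> r" using x by (simp add: X_def dist_norm norm_minus_commute)
  have e0: "0 \<le> e * norm h"
    using e[OF x, of h] norm_ge_zero order_trans by blast
  \<comment> \<open>\<open>G\<close> is the derivative of t A(pt x t) h (f (pt x t)). The factor t
    removes the boundary term at \<open>x0\<close>, so the integral is exactly the connection term
    at \<open>x\<close>.\<close>
  have "(G has_integral (1 *\<^sub>R A (pt x 1) h (f (pt x 1)) - 0 *\<^sub>R A (pt x 0) h (f (pt x 0)))) {0..1}"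
  proof (rule fundamental_theorem_of_calculus)
    fix t :: real assume t: "t \<in> {0..1}"
    have "(pt x has_vector_derivative X) (at t within {0..1})"
      unfolding pt_def X_def by (auto intro!: derivative_eq_intros)
    then have "(((\<lambda>y. A y h (f y)) \<circ> pt x) has_vector_derivative
        (A' (pt x t) h (f (pt x t)) X + A (pt x t) h (f' (pt x t) X))) (at t within {0..1})"
      by (rule vector_derivative_diff_chain_within)
         (rule has_derivative_at_withinI[OF der_A_apply[OF C pt_in[OF x t]]])
    then show "((\<lambda>t. t *\<^sub>R A (pt x t) h (f (pt x t))) has_vector_derivative G t) (at t within {0..1})"
      unfolding G_def comp_def by (auto intro!: derivative_eq_intros)
  qed simp
  then have G: "(G has_integral A x h (f x)) {0..1}"
    by (simp add: pt_def)
  have "continuous_on {0..1} (\<lambda>t. integrand' f f' x t h)"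
    by (rule cont_fixed[OF cont_integrand'[OF C] x])
  then have I: "(\<lambda>t. integrand' f f' x t h) integrable_on {0..1}"
    by (rule integrable_continuous_interval)
  have D: "((\<lambda>t. G t - integrand' f f' x t h) has_integral
      (A x h (f x) - integral {0..1} (\<lambda>t. integrand' f f' x t h))) {0..1}"
    by (intro has_integral_diff G integrable_integral I)
  have GE: "G t - integrand' f f' x t h = E t" if "t \<in> {0..1}" for t
    by (simp add: integrand'_eq[OF C x that] G_def E_def X_def)
  have "(E has_integral (A x h (f x) - integral {0..1} (\<lambda>t. integrand' f f' x t h))) {0..1}"
    by (rule has_integral_eq[OF GE D])
  then have E: "(E has_integral (A x h (f x) + T' f f' x h)) {0..1}"
    by (simp add: T'_def)
  have "norm (E t) \<le> e / 4 * norm h" if t: "t \<in> {0..1}" for t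
  proof -
    have p: "pt x t \<in> U" using pt_in[OF x t] .
    have "norm (A (pt x t) h (defect f f' (pt x t) X)) \<le> K * norm h * (e * norm X)"
      by (rule order_trans[OF bound[OF p] mult_left_mono[OF e[OF p]]]) (simp add: K)
    moreover have "norm (A (pt x t) X (defect f f' (pt x t) h)) \<le> K * norm X * (e * norm h)"
      by (rule order_trans[OF bound[OF p] mult_left_mono[OF e[OF p]]]) (simp add: K)
    ultimately have "norm (A (pt x t) h (defect f f' (pt x t) X)
        - A (pt x t) X (defect f f' (pt x t) h)) \<le> 2 * (K * norm X * (e * norm h))"
      by (intro norm_triangle_le_diff) (simp add: algebra_simps)
    also have "\<dots> \<le> 2 * (K * r * (e * norm h))"
      using nX K e0 by (intro mult_left_mono mult_right_mono) auto
    also have "\<dots> \<le> e / 4 * norm h"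
      using mult_right_mono[OF K(2) e0] by simp
    finally have "norm (A (pt x t) h (defect f f' (pt x t) X)
        - A (pt x t) X (defect f f' (pt x t) h)) \<le> e / 4 * norm h" .
    moreover have "norm (E t) \<le> 1 * norm (A (pt x t) h (defect f f' (pt x t) X)
        - A (pt x t) X (defect f f' (pt x t) h))"
      unfolding E_def norm_scaleR using t by (intro mult_right_mono) auto
    ultimately show ?thesis by simp
  qed
  then have "norm (A x h (f x) + T' f f' x h) \<le> e / 4 * norm h"
    using e0 has_integral_bound[of "e / 4 * norm h" E _ 0 "1::real"] E by simp
  then show ?thesis
    by (simp add: add.commute)
qed

lemma T_contract:
  assumes f: "continuous_on U f" and g: "continuous_on U g" and x: "x \<in> U"
    and d: "\<And>p. p \<in> U \<Longrightarrow> norm (f p - g p) \<le> d"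
  shows "norm (T c f x - T c g x) \<le> d / 4"
proof -
  have d0: "0 \<le> d" using d[OF x] norm_ge_zero order_trans by blast
  have nX: "norm (x - x0) \<le> r" using x by (simp add: dist_norm norm_minus_commute)
  have i: "integrand f x integrable_on {0..1}" "integrand g x integrable_on {0..1}"
    using cont_integrand[OF f x] cont_integrand[OF g x] by (auto intro: integrable_continuous_interval)
  have "T c f x - T c g x = integral {0..1} (\<lambda>t. integrand g x t - integrand f x t)"
    using i by (simp add: T_def integral_diff)
  moreover have "((\<lambda>t. integrand g x t - integrand f x t) has_integral
      integral {0..1} (\<lambda>t. integrand g x t - integrand f x t)) (cbox 0 1)"
    using i by (simp add: integrable_diff integrable_integral)
  moreover have "norm (integrand g x t - integrand f x t) \<le> d / 4" if t: "t \<in> {0..1}" for t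
  proof -
    have p: "pt x t \<in> U" using pt_in[OF x t] .
    have "integrand g x t - integrand f x t = A (pt x t) (x - x0) (g (pt x t) - f (pt x t))"
      by (simp add: integrand_def linear_diff[OF lin(1)[OF p]])
    also have "norm \<dots> \<le> K * norm (x - x0) * norm (g (pt x t) - f (pt x t))"
      by (rule bound[OF p])
    also have "\<dots> \<le> K * r * d"
      using d[OF p] nX K r by (intro mult_mono) (auto simp: norm_minus_commute)
    also have "\<dots> \<le> d / 4"
      using mult_right_mono[OF K(2) d0] d0 by simp
    finally show ?thesis .
  qed
  ultimately show ?thesis
    using d0 has_integral_bound[of "d / 4" "\<lambda>t. integrand g x t - integrand f x t" _ 0 "1::real"]
    by simp
qed

section \<open>Picard iteration and its limit\<close>

primrec iter :: "'f \<Rightarrow> nat \<Rightarrow> ('e \<Rightarrow> 'f) \<times> ('e \<Rightarrow> 'e \<Rightarrow> 'f)" where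
  "iter c 0 = (\<lambda>_. c, \<lambda>_ _. 0)"
| "iter c (Suc n) = (T c (fst (iter c n)), T' (fst (iter c n)) (snd (iter c n)))"

lemma C1_iter: "C1 (fst (iter c n)) (snd (iter c n))"
proof (induction n)
  case 0
  show ?case by (simp add: C1_def)
qed (simp add: C1_T)

lemma iter_x0: "fst (iter c n) x0 = c"
proof (cases n)
  case (Suc m)
  have "x0 \<in> U" using r by simp
  then have "integrand f x0 = (\<lambda>t. 0)" for f
    by (auto simp: integrand_def pt_def linear_0[OF lin(2)])
  then show ?thesis by (simp add: Suc T_def)
qed simp

lemma iter_diff:
  assumes "x \<in> U"
  shows "norm (fst (iter c (Suc n)) x - fst (iter c n) x) \<le> norm c * (1/4) ^ n"
  using assms
proof (induction n arbitrary: x)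
  case 0
  \<comment> \<open>The starting map, the constant \<open>c\<close>, is itself \<open>T c\<close> of
    the zero map, so the first difference is also covered by \<open>T_contract\<close>.\<close>
  have "((\<lambda>t. 0) has_integral 0) {0..1::real}"
    by simp
  then have "(integrand (\<lambda>_. 0) x has_integral 0) {0..1}"
    by (rule has_integral_eq[rotated])
       (simp add: integrand_def linear_0[OF lin(1)[OF pt_in[OF 0]]])
  then have "T c (\<lambda>_. 0) x = c"
    by (simp add: T_def integral_unique)
  moreover have "norm (T c (\<lambda>_. c) x - T c (\<lambda>_. 0) x) \<le> norm c / 4"
    by (rule T_contract[OF _ _ 0]) (auto intro: continuous_intros)
  ultimately have "norm (T c (\<lambda>_. c) x - c) * 4 \<le> norm c" by simp
  with norm_ge_zero[of "T c (\<lambda>_. c) x - c"] have "norm (T c (\<lambda>_. c) x - c) \<le> norm c" by linarith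
  then show ?case by simp
next
  case (Suc n)
  have "norm (T c (fst (iter c (Suc n))) x - T c (fst (iter c n)) x) \<le> norm c * (1/4) ^ n / 4"
    by (rule T_contract[OF C1_cont[OF C1_iter] C1_cont[OF C1_iter] Suc.prems Suc.IH])
  then show ?case by simp
qed

text \<open>With a bound C at the start, one step gives C/4 from \<open>defect_T\<close>, plus K
  norm(c) for passing from the old iterate to the new one. The rate 1/2 needs C/4 + K norm(c) <=
  C/2, which is where C = 4 K norm(c) comes from.\<close>

lemma iter_defect:
  assumes "x \<in> U"
  shows "norm (defect (fst (iter c n)) (snd (iter c n)) x h) \<le> 4 * K * norm c * (1/2) ^ n * norm h"
  using assms
proof (induction n arbitrary: x h)
  case 0
  have "norm (A x h c) \<le> K * norm h * norm c"
    by (rule bound[OF 0])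
  also have "\<dots> \<le> 4 * (K * norm h * norm c)"
    using K by simp
  finally show ?case by (simp add: defect_def algebra_simps)
next
  case (Suc n)
  let ?f = "fst (iter c n)" and ?f' = "snd (iter c n)"
  have pw: "(1/4::real) ^ n \<le> (1/2) ^ n" by (intro power_mono) auto
  have "defect (fst (iter c (Suc n))) (snd (iter c (Suc n))) x h
      = (T' ?f ?f' x h + A x h (?f x)) + A x h (fst (iter c (Suc n)) x - ?f x)"
    using linear_diff[OF lin(1)[OF Suc.prems]] by (simp add: defect_def)
  also have "norm \<dots> \<le> 4 * K * norm c * (1/2) ^ n / 4 * norm h + K * norm h * (norm c * (1/4) ^ n)"
    by (intro norm_triangle_mono defect_T[OF C1_iter Suc.prems Suc.IH]
        order_trans[OF bound[OF Suc.prems] mult_left_mono[OF iter_diff[OF Suc.prems]]])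
       (use K in auto)
  also have "\<dots> \<le> 4 * K * norm c * (1/2) ^ n / 4 * norm h + K * norm h * (norm c * (1/2) ^ n)"
    using pw K by (intro add_left_mono mult_left_mono) auto
  also have "\<dots> = 4 * K * norm c * (1/2) ^ Suc n * norm h"
    by simp
  finally show ?case .
qed

text \<open>The iterates converge uniformly to \<open>f\<close>, and by \<open>iter_defect\<close>
  their derivatives approach \<open>- A x h (F n x)\<close>. The derivative of the limit is thus
  known in advance, as the theorem on differentiating a sequence requires.\<close>

lemma flat_solution:
  obtains f where "f x0 = c" "\<And>x. x \<in> U \<Longrightarrow> (f has_derivative (\<lambda>h. - A x h (f x))) (at x)"
proof -
  define F where "F n = fst (iter c n)" for n
  define F' where "F' n = snd (iter c n)" for n
  define M where "M n = norm c * (1/4::real) ^ n" for n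
  have sM: "summable M"
    unfolding M_def by (intro summable_mult summable_geometric) simp
  have "uniform_limit U (\<lambda>n x. \<Sum>i<n. F (Suc i) x - F i x) (\<lambda>x. \<Sum>i. F (Suc i) x - F i x) sequentially"
    by (rule Weierstrass_m_test[OF _ sM]) (use iter_diff in \<open>simp add: F_def M_def\<close>)
  moreover have "(\<Sum>i<n. F (Suc i) x - F i x) = F n x - c" for n x
    using sum_lessThan_telescope[of "\<lambda>i. F i x" n] by (simp add: F_def)
  ultimately have ul0: "uniform_limit U (\<lambda>n x. F n x - c) (\<lambda>x. \<Sum>i. F (Suc i) x - F i x) sequentially"
    by simp
  define f where "f = (\<lambda>x. (\<Sum>i. F (Suc i) x - F i x) + c)"
  have "uniform_limit U (\<lambda>n x. (F n x - c) + c) f sequentially"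
    unfolding f_def by (intro uniform_limit_add ul0 uniform_limit_const)
  then have ul: "uniform_limit U F f sequentially"
    by simp
  have lim: "(\<lambda>n. F n x) \<longlonglongrightarrow> f x" if "x \<in> U" for x
    using tendsto_uniform_limitI[OF ul that] .
  have x0: "x0 \<in> U" using r by simp
  have "\<exists>g. \<forall>x\<in>U. (\<lambda>n. F n x) \<longlonglongrightarrow> g x \<and> (g has_derivative (\<lambda>h. - A x h (f x))) (at x within U)"
  proof (rule has_derivative_sequence[where f = F and f' = F' and l = "f x0", OF convex_ball _ _ x0])
    show "(\<lambda>n. F n x0) \<longlonglongrightarrow> f x0"
      by (rule lim[OF x0])
    show "(F n has_derivative F' n x) (at x within U)" if "x \<in> U" for n x
      using C1_iter[of c n] that by (auto simp: C1_def F_def F'_def intro: has_derivative_at_withinI)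
  next
    fix e :: real assume e: "0 < e"
    have "(\<lambda>n. 4 * K * norm c * (1/2::real) ^ n) \<longlonglongrightarrow> 4 * K * norm c * 0"
      by (intro tendsto_intros LIMSEQ_power_zero) simp
    then have "\<forall>\<^sub>F n in sequentially. 4 * K * norm c * (1/2::real) ^ n < e / 2"
      using e by (intro order_tendstoD(2)[of _ 0]) auto
    \<comment> \<open>Half of \<open>e\<close> goes to the defect, half to the error of
      \<open>F n\<close> multiplied by at most \<open>K\<close>. The summand 1 keeps the denominator
      nonzero when \<open>K\<close> is 0.\<close>
    moreover have "\<forall>\<^sub>F n in sequentially. \<forall>x\<in>U. dist (F n x) (f x) < e / (2 * (K + 1))"
      using e K by (intro uniform_limitD[OF ul]) auto
    ultimately show "\<forall>\<^sub>F n in sequentially. \<forall>x\<in>U. \<forall>h. norm (F' n x h - - A x h (f x)) \<le> e * norm h"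
    proof eventually_elim
      case (elim n)
      show ?case
      proof (intro ballI allI)
        fix x h assume x: "x \<in> U"
        have "F' n x h - - A x h (f x) = defect (F n) (F' n) x h + A x h (f x - F n x)"
          using linear_diff[OF lin(1)[OF x]] by (simp add: defect_def)
        also have "norm \<dots> \<le> e / 2 * norm h + K * norm h * (e / (2 * (K + 1)))"
        proof (rule norm_triangle_mono)
          show "norm (defect (F n) (F' n) x h) \<le> e / 2 * norm h"
            using iter_defect[OF x, of c n h] mult_right_mono[OF less_imp_le[OF elim(1)], of "norm h"]
            by (simp add: F_def F'_def)
          have "norm (f x - F n x) \<le> e / (2 * (K + 1))"
            using elim(2) x by (force simp: dist_norm norm_minus_commute)
          then show "norm (A x h (f x - F n x)) \<le> K * norm h * (e / (2 * (K + 1)))"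
            by (intro order_trans[OF bound[OF x] mult_left_mono]) (use K in auto)
        qed
        also have "K * norm h * (e / (2 * (K + 1))) = (K / (K + 1)) * (e / 2 * norm h)"
          using K by (simp add: field_simps)
        also have "\<dots> \<le> 1 * (e / 2 * norm h)"
          using K e by (intro mult_right_mono) auto
        finally show "norm (F' n x h - - A x h (f x)) \<le> e * norm h" by simp
      qed
    qed
  qed
  then obtain g where g: "\<And>x. x \<in> U \<Longrightarrow> (\<lambda>n. F n x) \<longlonglongrightarrow> g x"
    "\<And>x. x \<in> U \<Longrightarrow> (g has_derivative (\<lambda>h. - A x h (f x))) (at x within U)"
    by blast
  \<comment> \<open>The limit \<open>g\<close> returned by the sequence theorem has its derivative
    expressed through \<open>f\<close>; identifying the two on the ball turns this into an equation
    for \<open>g\<close> alone.\<close>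
  have gf: "g x = f x" if "x \<in> U" for x
    using LIMSEQ_unique[OF g(1)[OF that] lim[OF that]] .
  show ?thesis
  proof
    show "g x0 = c"
      using LIMSEQ_unique[OF g(1)[OF x0], of c] by (simp add: F_def iter_x0)
    show "(g has_derivative (\<lambda>h. - A x h (g x))) (at x)" if "x \<in> U" for x
      using g(2)[OF that] that by (simp add: at_within_open[OF _ open_ball] gf)
  qed
qed

end

section \<open>Regularity of solutions and choice of the ball\<close>

lemma smooth_on_flat_solution:
  fixes A :: "'e::euclidean_space \<Rightarrow> 'e \<Rightarrow> 'f::euclidean_space \<Rightarrow> 'f"
  assumes S: "open S" and lin: "\<And>x w. x \<in> S \<Longrightarrow> linear (A x w)"
    and smooth: "\<And>w v. smooth_on S (\<lambda>x. A x w v)"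
    and f: "\<And>x. x \<in> S \<Longrightarrow> (f has_derivative (\<lambda>h. - A x h (f x))) (at x)"
  shows "smooth_on S f"
  unfolding smooth_on_def
proof
  fix n
  show "C_on n S f"
  proof (induction n)
    case 0
    show ?case
      using f by (auto intro!: continuous_at_imp_continuous_on has_derivative_continuous)
  next
    case (Suc n)
    show ?case
    proof (rule C_on_SucI[OF S f])
      fix w
      have "C_on n S (\<lambda>x. A x w (f x))"
        by (rule C_on_apply[OF S lin]) (use smooth Suc in \<open>auto simp: smooth_on_def\<close>)
      then show "C_on n S (\<lambda>x. - A x w (f x))"
        by (rule C_on_bounded_linear[OF S bounded_linear_minus[OF bounded_linear_ident]])
    qed
  qed
qed

text \<open>Continuity of \<open>A\<close> is given only for fixed arguments. The sum of the norms
  on pairs of basis vectors is one continuous function that dominates the bilinear norm, and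
  compactness bounds it.\<close>

lemma bilinear_bound_on_cball:
  fixes A :: "'e::euclidean_space \<Rightarrow> 'a::euclidean_space \<Rightarrow> 'b::euclidean_space \<Rightarrow> 'c::real_normed_vector"
  assumes bil: "\<And>x. x \<in> cball x0 r \<Longrightarrow> bilinear (A x)"
    and cont: "\<And>w v. continuous_on (cball x0 r) (\<lambda>x. A x w v)"
  obtains K where "0 \<le> K" "\<And>x w v. x \<in> cball x0 r \<Longrightarrow> norm (A x w v) \<le> K * norm w * norm v"
proof -
  define g where "g = (\<lambda>x. \<Sum>b\<in>Basis. \<Sum>c\<in>Basis. norm (A x b c))"
  have "continuous_on (cball x0 r) g"
    unfolding g_def by (intro continuous_intros cont)
  then have "bounded (g ` cball x0 r)"
    by (intro compact_imp_bounded compact_continuous_image compact_cball)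
  then obtain K where K: "\<And>x. x \<in> cball x0 r \<Longrightarrow> norm (g x) \<le> K"
    unfolding bounded_iff by blast
  show ?thesis
  proof
    \<comment> \<open>For an empty ball the bound \<open>K\<close> could be negative, hence the
      absolute value.\<close>
    show "0 \<le> \<bar>K\<bar>" by simp
    fix x w v assume x: "x \<in> cball x0 r"
    note l = bil[OF x, unfolded bilinear_def]
    have "A x w v = (\<Sum>b\<in>Basis. \<Sum>c\<in>Basis. (w \<bullet> b) *\<^sub>R (v \<bullet> c) *\<^sub>R A x b c)"
    proof -
      have e: "A x b v = (\<Sum>c\<in>Basis. (v \<bullet> c) *\<^sub>R A x b c)" for b
        by (rule linear_Basis_expand[where L = "A x b"]) (use l in blast)
      have "A x w v = (\<Sum>b\<in>Basis. (w \<bullet> b) *\<^sub>R A x b v)"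
        by (rule linear_Basis_expand[where L = "\<lambda>w. A x w v"]) (use l in blast)
      also have "\<dots> = (\<Sum>b\<in>Basis. (w \<bullet> b) *\<^sub>R (\<Sum>c\<in>Basis. (v \<bullet> c) *\<^sub>R A x b c))"
        by (simp only: e)
      finally show ?thesis by (simp add: scaleR_sum_right)
    qed
    also have "norm \<dots> \<le> (\<Sum>b\<in>Basis. \<Sum>c\<in>Basis. norm w * norm v * norm (A x b c))"
      by (intro sum_norm_le) (auto simp: mult.assoc[symmetric] abs_mult
          intro!: mult_right_mono mult_mono Basis_le_norm)
    also have "\<dots> = norm w * norm v * g x"
      by (simp add: g_def sum_distrib_left)
    also have "\<dots> \<le> norm w * norm v * \<bar>K\<bar>"
      using K[OF x] by (intro mult_left_mono) auto
    finally show "norm (A x w v) \<le> \<bar>K\<bar> * norm w * norm v"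
      by (simp add: mult_ac)
  qed
qed

text \<open>The radius is obtained before the initial value: the equation is linear, so the
  smallness condition concerns \<open>A\<close> alone.\<close>

proposition local_flat_solution:
  fixes A :: "'e::euclidean_space \<Rightarrow> 'e \<Rightarrow> 'f::euclidean_space \<Rightarrow> 'f"
  assumes S: "open S" "x0 \<in> S" and bil: "\<And>x. x \<in> S \<Longrightarrow> bilinear (A x)"
    and smooth: "\<And>w v. smooth_on S (\<lambda>x. A x w v)"
    and flat: "\<And>x w w' v. x \<in> S \<Longrightarrow>
      frechet_derivative (\<lambda>u. A u w' v) (at x) w - frechet_derivative (\<lambda>u. A u w v) (at x) w'
        + A x w (A x w' v) - A x w' (A x w v) = 0"
  obtains r where "0 < r" "ball x0 r \<subseteq> S"
    "\<And>c. \<exists>f. smooth_on (ball x0 r) f \<and> f x0 = c \<and>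
      (\<forall>x\<in>ball x0 r. (f has_derivative (\<lambda>h. - A x h (f x))) (at x))"
proof -
  obtain r0 where r0: "0 < r0" "cball x0 r0 \<subseteq> S"
    using S open_contains_cball by blast
  obtain K where K: "0 \<le> K" "\<And>x w v. x \<in> cball x0 r0 \<Longrightarrow> norm (A x w v) \<le> K * norm w * norm v"
  proof (rule bilinear_bound_on_cball[of x0 r0 A])
    show "bilinear (A x)" if "x \<in> cball x0 r0" for x
      using bil r0 that by blast
    show "continuous_on (cball x0 r0) (\<lambda>x. A x w v)" for w v
      using smooth_on_imp_continuous_on[OF smooth] r0(2) by (rule continuous_on_subset)
  qed (rule that)
  \<comment> \<open>This makes \<open>8 * K * r\<close> at most K / (K + 1), with a denominator that
    is positive even for \<open>K = 0\<close>.\<close>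
  define r where "r = min r0 (1 / (8 * (K + 1)))"
  have r: "0 < r" "ball x0 r \<subseteq> cball x0 r0"
    using r0 K by (auto simp: r_def)
  then have sub: "ball x0 r \<subseteq> S" using r0 by blast
  have "8 * K * r \<le> 8 * K * (1 / (8 * (K + 1)))"
    using K by (intro mult_left_mono) (auto simp: r_def)
  also have "\<dots> \<le> 1"
    using K by (simp add: field_simps)
  finally have Kr: "8 * K * r \<le> 1" .
  interpret flat_ball A "\<lambda>x w v. frechet_derivative (\<lambda>u. A u w v) (at x)" x0 r K
  proof
    show "continuous_on (ball x0 r) (\<lambda>x. frechet_derivative (\<lambda>u. A u w v) (at x) h)" for w v h
      using smooth_on_imp_continuous_on[OF smooth_on_frechet[OF smooth]] sub
      by (rule continuous_on_subset)
  qed (use r K Kr sub bil flat smooth_on_has_derivative[OF smooth] in \<open>auto simp del: mem_ball\<close>)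
  show ?thesis
  proof
    show "\<exists>f. smooth_on (ball x0 r) f \<and> f x0 = c \<and>
      (\<forall>x\<in>ball x0 r. (f has_derivative (\<lambda>h. - A x h (f x))) (at x))" for c
    proof -
      obtain f where f: "f x0 = c" "\<And>x. x \<in> ball x0 r \<Longrightarrow> (f has_derivative (\<lambda>h. - A x h (f x))) (at x)"
        using flat_solution[of c] by blast
      have "smooth_on (ball x0 r) f"
        by (rule smooth_on_flat_solution[OF open_ball lin(1) smooth_on_subset[OF smooth sub] f(2)])
      with f show ?thesis by blast
    qed
  qed (use r sub in auto)
qed

section \<open>Charts and coordinate changes\<close>

text \<open>The chart conditions alone, over any topological space, so that the same lemmas serve
  the base and the total space. The point type of the latter does not carry the sort that
  \<open>smooth_manifold\<close> asks for.\<close>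

locale charts =
  fixes A :: "('k, 'p::topological_space, 'e::euclidean_space, 'z) atlas_scheme"
  assumes open_dom: "k \<in> idx A \<Longrightarrow> open (chart_dom A k)"
    and open_coord_dom: "k \<in> idx A \<Longrightarrow> open (coord A k ` chart_dom A k)"
    and homeo: "k \<in> idx A \<Longrightarrow>
      \<exists>g. homeomorphism (chart_dom A k) (coord A k ` chart_dom A k) (coord A k) g"
    and smooth_change: "k \<in> idx A \<Longrightarrow> l \<in> idx A \<Longrightarrow>
      smooth_on (coord A k ` (chart_dom A k \<inter> chart_dom A l)) (coord A l \<circ> par A k)"
begin

lemma inj_coord: "k \<in> idx A \<Longrightarrow> inj_on (coord A k) (chart_dom A k)"
proof -
  assume "k \<in> idx A"
  then obtain g where "homeomorphism (chart_dom A k) (coord A k ` chart_dom A k) (coord A k) g"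
    using homeo by blast
  then show "inj_on (coord A k) (chart_dom A k)"
    by (intro inj_on_inverseI[of _ g]) (rule homeomorphism_apply1)
qed

lemma par_coord: "k \<in> idx A \<Longrightarrow> p \<in> chart_dom A k \<Longrightarrow> par A k (coord A k p) = p"
  unfolding par_def by (rule inv_into_f_f[OF inj_coord])

lemma coord_par:
  assumes "k \<in> idx A" "u \<in> coord A k ` chart_dom A k"
  shows "coord A k (par A k u) = u" "par A k u \<in> chart_dom A k"
  using assms par_coord by auto

lemma par_image:
  assumes "k \<in> idx A" "u \<in> coord A k ` W" "W \<subseteq> chart_dom A k"
  shows "coord A k (par A k u) = u" "par A k u \<in> W" "par A k u \<in> chart_dom A k"
  using assms par_coord by auto

lemma continuous_coord: "k \<in> idx A \<Longrightarrow> continuous_on (chart_dom A k) (coord A k)"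
  using homeo unfolding homeomorphism_def by blast

lemma open_coord:
  assumes k: "k \<in> idx A" and W: "open W" "W \<subseteq> chart_dom A k"
  shows "open (coord A k ` W)"
proof -
  obtain g where g: "homeomorphism (chart_dom A k) (coord A k ` chart_dom A k) (coord A k) g"
    using homeo[OF k] by blast
  have "openin (top_of_set (chart_dom A k)) W"
    using W by (simp add: open_subset)
  then have "openin (top_of_set (coord A k ` chart_dom A k)) (coord A k ` W)"
    using homeomorphism_imp_open_map[OF g] by blast
  then show ?thesis
    using openin_open_eq[OF open_coord_dom[OF k]] by blast
qed

lemma open_coord_Int: "k \<in> idx A \<Longrightarrow> open W \<Longrightarrow> open (coord A k ` (W \<inter> chart_dom A k))"
  by (rule open_coord) (auto intro: open_dom)

lemma open_overlap:
  "k \<in> idx A \<Longrightarrow> l \<in> idx A \<Longrightarrow> open (coord A k ` (chart_dom A k \<inter> chart_dom A l))"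
  by (rule open_coord) (auto intro: open_dom)

lemma change_deriv:
  assumes "k \<in> idx A" "l \<in> idx A" "p \<in> chart_dom A k" "p \<in> chart_dom A l"
  shows "((coord A l \<circ> par A k) has_derivative jac A k l p) (at (coord A k p))"
  unfolding jac_def using assms by (intro smooth_on_has_derivative[OF smooth_change]) auto

lemma linear_jac:
  assumes "k \<in> idx A" "l \<in> idx A" "p \<in> chart_dom A k" "p \<in> chart_dom A l"
  shows "linear (jac A k l p)"
  using change_deriv[OF assms] by (rule has_derivative_linear)

lemma chart_change_eq:
  assumes "k \<in> idx A" "l \<in> idx A" "u \<in> coord A k ` (chart_dom A k \<inter> chart_dom A l)"
  shows "par A l (coord A l (par A k u)) = par A k u"
  using assms par_image[OF assms(1,3)] par_coord[OF assms(2)] by auto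

text \<open>The chain rule for one map on points read in two charts. The change of frame of a
  section is a separate matter.\<close>

lemma deriv_chart_change:
  assumes k: "k \<in> idx A" and l: "l \<in> idx A" and p: "p \<in> chart_dom A k" "p \<in> chart_dom A l"
    and h: "((\<lambda>u. h (par A l u)) has_derivative D) (at (coord A l p))"
  shows "((\<lambda>u. h (par A k u)) has_derivative (\<lambda>w. D (jac A k l p w))) (at (coord A k p))"
proof -
  have "((\<lambda>u. h (par A l ((coord A l \<circ> par A k) u))) has_derivative (\<lambda>w. D (jac A k l p w)))
      (at (coord A k p))"
    by (rule has_derivative_compose[OF change_deriv[OF k l p]])
       (use h par_coord[OF k p(1)] in simp)
  then show ?thesis
    by (rule has_derivative_transform_within_open[OF _ open_overlap[OF k l]])
       (use p k l chart_change_eq in auto)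
qed

lemma jac_jac:
  assumes k: "k \<in> idx A" and l: "l \<in> idx A" and p: "p \<in> chart_dom A k" "p \<in> chart_dom A l"
  shows "jac A l k p (jac A k l p w) = w"
proof -
  have "((\<lambda>u. coord A k (par A k u)) has_derivative (\<lambda>w. jac A l k p (jac A k l p w))) (at (coord A k p))"
    using deriv_chart_change[OF k l p] change_deriv[OF l k p(2,1)] by (simp add: comp_def)
  moreover have "((\<lambda>u. coord A k (par A k u)) has_derivative (\<lambda>w. w)) (at (coord A k p))"
    by (rule has_derivative_transform_within_open[OF has_derivative_ident open_coord_dom[OF k]])
       (use p coord_par[OF k] in auto)
  ultimately show ?thesis
    using has_derivative_unique by metis
qed

lemma smooth_chart_change:
  assumes k: "k \<in> idx A" and l: "l \<in> idx A"
    and W: "open W" "W \<subseteq> chart_dom A k \<inter> chart_dom A l"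
    and h: "smooth_on (coord A l ` W) (\<lambda>u. h (par A l u))"
  shows "smooth_on (coord A k ` W) (\<lambda>u. h (par A k u))"
proof -
  have oW: "open (coord A k ` W)" "open (coord A l ` W)"
    using W open_coord k l by auto
  have "smooth_on (coord A k ` W) (\<lambda>u. h (par A l ((coord A l \<circ> par A k) u)))"
  proof (rule smooth_on_compose[OF oW h])
    show "smooth_on (coord A k ` W) (coord A l \<circ> par A k)"
      by (rule smooth_on_subset[OF smooth_change[OF k l]]) (use W in auto)
    show "(coord A l \<circ> par A k) x \<in> coord A l ` W" if "x \<in> coord A k ` W" for x
      using par_image(2)[OF k that] W by auto
  qed
  then show ?thesis
  proof (rule smooth_on_cong[OF oW(1)])
    fix u assume "u \<in> coord A k ` W"
    then have "u \<in> coord A k ` (chart_dom A k \<inter> chart_dom A l)" using W by auto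
    then show "h (par A l ((coord A l \<circ> par A k) u)) = h (par A k u)"
      using chart_change_eq[OF k l] by simp
  qed
qed

lemma smooth_jac:
  assumes k: "k \<in> idx A" and l: "l \<in> idx A"
  shows "smooth_on (coord A k ` (chart_dom A k \<inter> chart_dom A l)) (\<lambda>u. jac A k l (par A k u) w)"
proof (rule smooth_on_cong[OF open_overlap[OF k l] smooth_on_frechet[OF smooth_change[OF k l]]])
  fix u assume u: "u \<in> coord A k ` (chart_dom A k \<inter> chart_dom A l)"
  show "frechet_derivative (coord A l \<circ> par A k) (at u) w = jac A k l (par A k u) w"
    using par_image(1)[OF k u] by (simp add: jac_def)
qed

text \<open>In \<open>gen_trans\<close>, vectors and covectors use Jacobians in opposite directions,
  so in the coordinates of a single chart both directions must be smooth.\<close>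

lemma smooth_jac':
  assumes k: "k \<in> idx A" and l: "l \<in> idx A"
  shows "smooth_on (coord A k ` (chart_dom A k \<inter> chart_dom A l)) (\<lambda>u. jac A l k (par A k u) w)"
  by (rule smooth_chart_change[OF k l])
     (use smooth_jac[OF l k] open_dom k l in \<open>auto simp: Int_commute\<close>)

end

lemma smooth_manifold_charts: "smooth_manifold A \<Longrightarrow> charts A"
  unfolding smooth_manifold_def by unfold_locales auto

section \<open>Charts of the total space\<close>

lemma smooth_comp_fst:
  fixes h :: "'a::euclidean_space \<Rightarrow> 'c::real_normed_vector"
  assumes "open S" "smooth_on S h"
  shows "smooth_on (S \<times> (UNIV :: 'b::euclidean_space set)) (\<lambda>z. h (fst z))"
proof -
  have S: "open (S \<times> (UNIV :: 'b set))" using assms(1) by (simp add: open_Times)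
  show ?thesis
    by (rule smooth_on_compose[OF S assms smooth_on_fst[OF S smooth_on_ident[OF S]]]) auto
qed

locale smooth_bundle =
  fixes B :: "('k, 'p::{t2_space, second_countable_topology}, 'e::euclidean_space,
      'v::topological_space, 'f::euclidean_space) vbundle"
  assumes vb: "smooth_vector_bundle B"
begin

sublocale base: charts B
  using vb smooth_manifold_charts unfolding smooth_vector_bundle_def by blast

lemma continuous_proj: "continuous_on UNIV (proj B)"
  using vb unfolding smooth_vector_bundle_def by blast

lemma linear_vtrans:
  assumes "k \<in> idx B" "l \<in> idx B" "p \<in> chart_dom B k" "p \<in> chart_dom B l"
  shows "linear (vtrans B k l p)"
  using vb assms unfolding smooth_vector_bundle_def by blast

lemma smooth_vtrans:
  assumes "k \<in> idx B" "l \<in> idx B"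
  shows "smooth_on (coord B k ` (chart_dom B k \<inter> chart_dom B l)) (\<lambda>u. vtrans B k l (par B k u) v)"
  using vb assms unfolding smooth_vector_bundle_def by blast

lemma triv_homeo:
  assumes "k \<in> idx B"
  obtains g where "homeomorphism (proj B -` chart_dom B k) (chart_dom B k \<times> UNIV)
    (\<lambda>e. (proj B e, triv B k e)) g"
  using vb assms unfolding smooth_vector_bundle_def by blast

lemma inj_triv: "k \<in> idx B \<Longrightarrow> inj_on (\<lambda>e. (proj B e, triv B k e)) (proj B -` chart_dom B k)"
proof -
  assume "k \<in> idx B"
  then obtain g where "homeomorphism (proj B -` chart_dom B k) (chart_dom B k \<times> UNIV)
    (\<lambda>e. (proj B e, triv B k e)) g"
    by (rule triv_homeo)
  then show "inj_on (\<lambda>e. (proj B e, triv B k e)) (proj B -` chart_dom B k)"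
    by (intro inj_on_inverseI[of _ g]) (rule homeomorphism_apply1)
qed

lemma vtrans_triv:
  assumes "k \<in> idx B" "proj B e \<in> chart_dom B k"
  shows "vtrans B k l (proj B e) (triv B k e) = triv B l e"
  using inv_into_f_f[OF inj_triv[OF assms(1)], of e] assms by (simp add: vtrans_def)

lemma ex_fibre_point:
  assumes "k \<in> idx B" "p \<in> chart_dom B k"
  obtains e where "proj B e = p" "triv B k e = v"
proof -
  obtain g where "homeomorphism (proj B -` chart_dom B k) (chart_dom B k \<times> UNIV)
    (\<lambda>e. (proj B e, triv B k e)) g"
    using triv_homeo[OF assms(1)] .
  then have "(\<lambda>e. (proj B e, triv B k e)) ` (proj B -` chart_dom B k) = chart_dom B k \<times> UNIV"
    unfolding homeomorphism_def by blast
  then have "(p, v) \<in> (\<lambda>e. (proj B e, triv B k e)) ` (proj B -` chart_dom B k)"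
    using assms(2) by simp
  then show ?thesis using that by auto
qed

text \<open>Transition maps are defined through points of the total space: with \<open>e\<close> the
  point that has component \<open>v\<close> in the frame \<open>k\<close>, both sides are
  \<open>triv B m e\<close>.\<close>

lemma vtrans_cocycle:
  assumes "k \<in> idx B" "l \<in> idx B" "p \<in> chart_dom B k" "p \<in> chart_dom B l"
  shows "vtrans B l m p (vtrans B k l p v) = vtrans B k m p v"
proof -
  obtain e where "proj B e = p" "triv B k e = v"
    using ex_fibre_point[OF assms(1,3)] .
  then show ?thesis
    using vtrans_triv assms by metis
qed

lemma vtrans_self:
  assumes "k \<in> idx B" "p \<in> chart_dom B k"
  shows "vtrans B k k p v = v"
proof -
  obtain e where "proj B e = p" "triv B k e = v"
    using ex_fibre_point[OF assms] .
  then show ?thesis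
    using vtrans_triv assms by metis
qed

abbreviation "TX \<equiv> total_atlas B"

lemma TX_simps [simp]:
  "idx TX = idx B" "chart_dom TX k = proj B -` chart_dom B k"
  "coord TX k e = (coord B k (proj B e), triv B k e)"
  by (simp_all add: total_atlas_def)

lemma TX_image:
  assumes k: "k \<in> idx B" and W: "W \<subseteq> chart_dom B k"
  shows "coord TX k ` (proj B -` W) = (coord B k ` W) \<times> UNIV"
proof (intro equalityI subsetI)
  fix z :: "'e \<times> 'f" assume "z \<in> (coord B k ` W) \<times> UNIV"
  then obtain p y where z: "z = (coord B k p, y)" "p \<in> W" by auto
  obtain e where e: "proj B e = p" "triv B k e = y"
    using ex_fibre_point[OF k] z(2) W by blast
  then have "z = coord TX k e" by (simp add: z)
  then show "z \<in> coord TX k ` (proj B -` W)" using e z by blast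
qed auto

lemma proj_par_TX:
  assumes k: "k \<in> idx B" and x: "x \<in> coord B k ` chart_dom B k"
  shows "proj B (par TX k (x, y)) = par B k x"
proof -
  have "(x, y) \<in> coord TX k ` chart_dom TX k"
    using total_atlas_image[OF vb k] x by simp
  then have "par TX k (x, y) \<in> chart_dom TX k"
    unfolding par_def by (rule inv_into_into)
  then have "proj B (par TX k (x, y)) \<in> chart_dom B k" by simp
  from base.par_coord[OF k this] show ?thesis
    by (simp add: coord_par_total_atlas(1)[OF vb k x])
qed

lemma triv_par_TX:
  assumes k: "k \<in> idx B" and x: "x \<in> coord B k ` chart_dom B k"
  shows "triv B k (par TX k (x, y)) = y"
  by (rule coord_par_total_atlas(2)[OF vb k x])

lemma triv_change:
  assumes k: "k \<in> idx B" and x: "x \<in> coord B k ` chart_dom B k"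
  shows "triv B l (par TX k (x, y)) = vtrans B k l (par B k x) y"
  using vtrans_triv[OF k, of "par TX k (x, y)" l] triv_par_TX[OF k x] proj_par_TX[OF k x]
    base.coord_par(2)[OF k x] by simp

sublocale total: charts TX
proof
  fix k assume "k \<in> idx TX"
  then have k: "k \<in> idx B" by simp
  show "open (chart_dom TX k)"
    using continuous_proj base.open_dom[OF k] by (simp add: open_vimage)
  show "open (coord TX k ` chart_dom TX k)"
    unfolding total_atlas_image[OF vb k] using base.open_coord_dom[OF k] by (simp add: open_Times)
  obtain g where g: "homeomorphism (proj B -` chart_dom B k) (chart_dom B k \<times> UNIV)
    (\<lambda>e. (proj B e, triv B k e)) g"
    using triv_homeo[OF k] .
  obtain c where c: "homeomorphism (chart_dom B k) (coord B k ` chart_dom B k) (coord B k) c"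
    using base.homeo[OF k] by blast
  have "homeomorphism (chart_dom B k \<times> UNIV) ((coord B k ` chart_dom B k) \<times> UNIV)
      (\<lambda>z. (coord B k (fst z), snd z)) (\<lambda>z :: 'e \<times> 'f. (c (fst z), snd z))"
    using c unfolding homeomorphism_def
    by (auto intro!: continuous_intros continuous_on_compose2[of _ _ _ fst] image_eqI)
  from homeomorphism_compose[OF g this]
  show "\<exists>g. homeomorphism (chart_dom TX k) (coord TX k ` chart_dom TX k) (coord TX k) g"
    unfolding total_atlas_image[OF vb k] by (auto simp: comp_def total_atlas_def)
next
  fix k l assume "k \<in> idx TX" "l \<in> idx TX"
  then have k: "k \<in> idx B" and l: "l \<in> idx B" by simp_all
  let ?S = "coord B k ` (chart_dom B k \<inter> chart_dom B l)"
  have S: "open ?S" by (rule base.open_overlap[OF k l])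
  have im: "coord TX k ` (chart_dom TX k \<inter> chart_dom TX l) = ?S \<times> UNIV"
    using TX_image[OF k, of "chart_dom B k \<inter> chart_dom B l"] by simp
  have S': "open (?S \<times> (UNIV :: 'f set))" using S by (simp add: open_Times)
  \<comment> \<open>In bundle coordinates a change of chart is (x, y) |-> (change of base chart at
    x, transition map at x applied to y), linear in y.\<close>
  have "smooth_on (?S \<times> (UNIV :: 'f set)) (\<lambda>z. (coord B l (par B k (fst z)), vtrans B k l (par B k (fst z)) (snd z)))"
  proof (rule smooth_on_Pair[OF S'])
    show "smooth_on (?S \<times> (UNIV :: 'f set)) (\<lambda>z. coord B l (par B k (fst z)))"
      by (rule smooth_comp_fst[OF S base.smooth_change[OF k l, unfolded comp_def]])
    show "smooth_on (?S \<times> (UNIV :: 'f set)) (\<lambda>z. vtrans B k l (par B k (fst z)) (snd z))"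
    proof (rule smooth_on_apply[where L = "\<lambda>z. vtrans B k l (par B k (fst z))" and g = snd, OF S'])
      show "linear (vtrans B k l (par B k (fst z)))" if "z \<in> ?S \<times> (UNIV :: 'f set)" for z
        using that base.par_image(2)[OF k, of "fst z" "chart_dom B k \<inter> chart_dom B l"]
        by (intro linear_vtrans[OF k l]) auto
      show "smooth_on (?S \<times> (UNIV :: 'f set)) (\<lambda>z. vtrans B k l (par B k (fst z)) b)" for b
        by (rule smooth_comp_fst[OF S smooth_vtrans[OF k l]])
      show "smooth_on (?S \<times> (UNIV :: 'f set)) snd"
        using smooth_on_snd[OF S' smooth_on_ident[OF S']] .
    qed
  qed
  then show "smooth_on (coord TX k ` (chart_dom TX k \<inter> chart_dom TX l)) (coord TX l \<circ> par TX k)"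
    unfolding im
  proof (rule smooth_on_cong[OF S'])
    fix z :: "'e \<times> 'f"
    assume z: "z \<in> ?S \<times> UNIV"
    obtain x y where xy: "z = (x, y)" by fastforce
    have x: "x \<in> coord B k ` chart_dom B k" using z xy by auto
    show "(coord B l (par B k (fst z)), vtrans B k l (par B k (fst z)) (snd z)) = (coord TX l \<circ> par TX k) z"
      by (simp add: xy proj_par_TX[OF k x] triv_change[OF k x])
  qed
qed

end

section \<open>Flat sections of the bundle and its dual\<close>

lemma has_derivative_adjoint:
  fixes L :: "'c::real_normed_vector \<Rightarrow> 'a::euclidean_space \<Rightarrow> 'b::euclidean_space"
  assumes S: "open S" "u \<in> S" and L: "\<And>x. x \<in> S \<Longrightarrow> linear (L x)"
    and L': "\<And>b. ((\<lambda>x. L x b) has_derivative L' b) (at u)"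
  shows "((\<lambda>x. adjoint (L x) y) has_derivative (\<lambda>h. adjoint (\<lambda>b. L' b h) y)) (at u)"
proof -
  have lin: "linear (\<lambda>b. L' b h)" for h
    by (rule linear_derivative_param[OF S L L'])
  have "((\<lambda>x. \<Sum>b\<in>Basis. (y \<bullet> L x b) *\<^sub>R b) has_derivative
      (\<lambda>h. \<Sum>b\<in>Basis. (y \<bullet> L' b h) *\<^sub>R b)) (at u)"
    by (intro has_derivative_sum has_derivative_scaleR_left has_derivative_inner_right L')
  then have "((\<lambda>x. \<Sum>b\<in>Basis. (y \<bullet> L x b) *\<^sub>R b) has_derivative
      (\<lambda>h. adjoint (\<lambda>b. L' b h) y)) (at u)"
    unfolding adjoint_expand[OF lin] .
  then show ?thesis
    by (rule has_derivative_transform_within_open[OF _ S]) (simp add: adjoint_expand[OF L])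
qed

lemma gen_trans_apply: "gen_trans g k l p c = (g k l p (fst c), adjoint (g l k p) (snd c))"
  by (cases c) (simp add: sum_trans_def dual_trans_def)

locale flat_bundle = smooth_bundle B
  for B :: "('k, 'p::{t2_space, second_countable_topology}, 'e::euclidean_space,
      'v::topological_space, 'f::euclidean_space) vbundle" +
  fixes \<omega> :: "'k \<Rightarrow> 'p \<Rightarrow> 'e \<Rightarrow> 'f \<Rightarrow> 'f"
  assumes flat: "flat_connection B \<omega>"
begin

lemma con: "connection B \<omega>"
  using flat unfolding flat_connection_def by blast

lemma bil:
  assumes "k \<in> idx B" "p \<in> chart_dom B k"
  shows "bilinear (\<omega> k p)"
  using con assms unfolding connection_def by blast

lemma linear_con:
  assumes "k \<in> idx B" "p \<in> chart_dom B k"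
  shows "linear (\<omega> k p w)" "linear (\<lambda>w. \<omega> k p w v)"
  using bil[OF assms] unfolding bilinear_def by auto

lemma smooth_con: "k \<in> idx B \<Longrightarrow> smooth_on (coord B k ` chart_dom B k) (\<lambda>u. \<omega> k (par B k u) w v)"
  using con unfolding connection_def by blast

definition dcon :: "'k \<Rightarrow> 'p \<Rightarrow> 'e \<Rightarrow> 'f \<Rightarrow> 'e \<Rightarrow> 'f" where
  "dcon k p w v = frechet_derivative (\<lambda>u. \<omega> k (par B k u) w v) (at (coord B k p))"

lemma dcon:
  assumes "k \<in> idx B" "p \<in> chart_dom B k"
  shows "((\<lambda>u. \<omega> k (par B k u) w v) has_derivative dcon k p w v) (at (coord B k p))"
  unfolding dcon_def by (rule smooth_on_has_derivative[OF smooth_con]) (use assms in auto)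

lemma curvature_0:
  assumes "k \<in> idx B" "p \<in> chart_dom B k"
  shows "dcon k p w' v w - dcon k p w v w' + \<omega> k p w (\<omega> k p w' v) - \<omega> k p w' (\<omega> k p w v) = 0"
  using flat assms unfolding flat_connection_def curvature_def dcon_def by blast

lemma gauge:
  assumes "k \<in> idx B" "l \<in> idx B" "p \<in> chart_dom B k" "p \<in> chart_dom B l"
  shows "\<omega> l p (jac B k l p w) (vtrans B k l p v) = vtrans B k l p (\<omega> k p w v)
    - frechet_derivative (\<lambda>u. vtrans B k l (par B k u) v) (at (coord B k p)) w"
  using con assms unfolding connection_def by blast

lemma gen_connection_apply:
  "gen_connection \<omega> k p w c = (\<omega> k p w (fst c), - adjoint (\<omega> k p w) (snd c))"
  by (cases c) (simp add: gen_connection_def)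

lemma bilinear_gen_connection:
  assumes k: "k \<in> idx B" and p: "p \<in> chart_dom B k"
  shows "bilinear (gen_connection \<omega> k p)"
proof -
  note l = linear_con[OF k p]
  have a: "linear (\<lambda>w. adjoint (\<omega> k p w) f)" for f
    by (rule linearI; rule vector_eq_rdot[THEN iffD1])
       (simp_all add: adjoint_clauses[OF l(1)] inner_add_left inner_add_right
          linear_add[OF l(2)] linear_cmul[OF l(2)])
  show ?thesis
    unfolding bilinear_def gen_connection_apply
    by (intro conjI allI linearI)
       (simp_all add: linear_add[OF l(1)] linear_cmul[OF l(1)] linear_add[OF l(2)] linear_cmul[OF l(2)]
          linear_add[OF a] linear_cmul[OF a] linear_add[OF adjoint_linear[OF l(1)]]
          linear_cmul[OF adjoint_linear[OF l(1)]])
qed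

lemma smooth_gen_connection:
  assumes k: "k \<in> idx B"
  shows "smooth_on (coord B k ` chart_dom B k) (\<lambda>u. gen_connection \<omega> k (par B k u) w c)"
proof -
  note S = base.open_coord_dom[OF k]
  have "smooth_on (coord B k ` chart_dom B k) (\<lambda>u. adjoint (\<omega> k (par B k u) w) (snd c))"
    by (rule smooth_on_adjoint[OF S linear_con(1)[OF k] smooth_con[OF k] smooth_on_const])
       (rule base.coord_par(2)[OF k])
  then show ?thesis
    unfolding gen_connection_apply
    by (intro smooth_on_Pair[OF S] smooth_con[OF k] smooth_on_minus[OF S])
qed

lemma deriv_gen_connection:
  assumes k: "k \<in> idx B" and p: "p \<in> chart_dom B k"
  shows "((\<lambda>u. gen_connection \<omega> k (par B k u) w c) has_derivative
    (\<lambda>h. (dcon k p w (fst c) h, - adjoint (\<lambda>v. dcon k p w v h) (snd c)))) (at (coord B k p))"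
proof -
  note S = base.open_coord_dom[OF k]
  have "((\<lambda>u. adjoint (\<omega> k (par B k u) w) (snd c)) has_derivative
    (\<lambda>h. adjoint (\<lambda>v. dcon k p w v h) (snd c))) (at (coord B k p))"
    by (rule has_derivative_adjoint[OF S _ linear_con(1)[OF k] dcon[OF k p]])
       (use p base.coord_par(2)[OF k] in auto)
  then show ?thesis
    unfolding gen_connection_apply by (intro has_derivative_Pair has_derivative_minus dcon[OF k p])
qed

lemma linear_dcon:
  assumes k: "k \<in> idx B" and p: "p \<in> chart_dom B k"
  shows "linear (\<lambda>v. dcon k p w v h)" "linear (\<lambda>w. dcon k p w v h)" "linear (\<lambda>h. dcon k p w v h)"
proof -
  note S = base.open_coord_dom[OF k]
  have u: "coord B k p \<in> coord B k ` chart_dom B k" using p by simp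
  show "linear (\<lambda>v. dcon k p w v h)"
    by (rule linear_derivative_param[OF S u linear_con(1)[OF k base.coord_par(2)[OF k]] dcon[OF k p]])
  show "linear (\<lambda>w. dcon k p w v h)"
    by (rule linear_derivative_param[OF S u linear_con(2)[OF k base.coord_par(2)[OF k]] dcon[OF k p]])
  show "linear (\<lambda>h. dcon k p w v h)"
    using has_derivative_linear[OF dcon[OF k p]] .
qed

text \<open>The curvature of the dual connection is minus the transpose of the original one:
  transposition reverses products, and the sign in the dual form restores their order. The dual half
  is therefore checked by pairing with a vector.\<close>

lemma curvature_gen_connection:
  assumes k: "k \<in> idx B" and p: "p \<in> chart_dom B k"
  defines "D \<equiv> \<lambda>w c. frechet_derivative (\<lambda>u. gen_connection \<omega> k (par B k u) w c) (at (coord B k p))"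
  shows "D w' c w - D w c w' + gen_connection \<omega> k p w (gen_connection \<omega> k p w' c)
    - gen_connection \<omega> k p w' (gen_connection \<omega> k p w c) = 0"
proof -
  note l = linear_con[OF k p] and d = linear_dcon[OF k p]
  have D: "D w c h = (dcon k p w (fst c) h, - adjoint (\<lambda>v. dcon k p w v h) (snd c))" for w c h
    unfolding D_def frechet_derivative_eqI[OF deriv_gen_connection[OF k p]] ..
  have "- adjoint (\<lambda>v. dcon k p w' v w) f + adjoint (\<lambda>v. dcon k p w v w') f
      + adjoint (\<omega> k p w) (adjoint (\<omega> k p w') f) - adjoint (\<omega> k p w') (adjoint (\<omega> k p w) f) = 0" for f
  proof (rule vector_eq_rdot[THEN iffD1, rule_format])
    fix v
    have "f \<bullet> (dcon k p w' v w - dcon k p w v w' + \<omega> k p w (\<omega> k p w' v) - \<omega> k p w' (\<omega> k p w v)) = 0"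
      using curvature_0[OF k p] by simp
    then show "(- adjoint (\<lambda>v. dcon k p w' v w) f + adjoint (\<lambda>v. dcon k p w v w') f
      + adjoint (\<omega> k p w) (adjoint (\<omega> k p w') f) - adjoint (\<omega> k p w') (adjoint (\<omega> k p w) f)) \<bullet> v = 0 \<bullet> v"
      by (simp add: inner_add_left inner_diff_left inner_add_right inner_diff_right
          adjoint_clauses[OF l(1)] adjoint_clauses[OF d(1)])
  qed
  then show ?thesis
    using curvature_0[OF k p, of w' "fst c" w]
    by (simp add: D gen_connection_apply linear_neg[OF adjoint_linear[OF l(1)]] zero_prod_def)
qed

section \<open>Transition maps and gauge law on the sum of the bundle and its dual\<close>

lemma linear_gen_vtrans:
  assumes "k \<in> idx B" "l \<in> idx B" "p \<in> chart_dom B k" "p \<in> chart_dom B l"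
  shows "linear (gen_trans (vtrans B) k l p)"
proof -
  note l = linear_vtrans[OF assms] adjoint_linear[OF linear_vtrans[OF assms(2,1,4,3)]]
  show ?thesis
    unfolding gen_trans_apply
    by (rule linearI) (simp_all add: linear_add[OF l(1)] linear_add[OF l(2)]
        linear_cmul[OF l(1)] linear_cmul[OF l(2)])
qed

lemma gen_vtrans_cocycle:
  assumes k: "k \<in> idx B" and l: "l \<in> idx B" and m: "m \<in> idx B"
    and p: "p \<in> chart_dom B k" "p \<in> chart_dom B l" "p \<in> chart_dom B m"
  shows "gen_trans (vtrans B) l m p (gen_trans (vtrans B) k l p c) = gen_trans (vtrans B) k m p c"
proof -
  have "adjoint (vtrans B m l p) (adjoint (vtrans B l k p) f) = adjoint (vtrans B m k p) f" for f
    by (rule vector_eq_rdot[THEN iffD1])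
       (simp add: adjoint_clauses[OF linear_vtrans[OF m l p(3,2)]]
         adjoint_clauses[OF linear_vtrans[OF l k p(2,1)]]
         adjoint_clauses[OF linear_vtrans[OF m k p(3,1)]] vtrans_cocycle[OF m l p(3,2)])
  then show ?thesis
    by (simp add: gen_trans_apply vtrans_cocycle[OF k l p(1,2)])
qed

lemma gen_vtrans_self:
  assumes k: "k \<in> idx B" and p: "p \<in> chart_dom B k"
  shows "gen_trans (vtrans B) k k p c = c"
proof -
  have "adjoint (vtrans B k k p) f = f" for f
    by (rule vector_eq_rdot[THEN iffD1])
       (simp add: adjoint_clauses[OF linear_vtrans[OF k k p p]] vtrans_self[OF k p])
  then show ?thesis
    by (simp add: gen_trans_apply vtrans_self[OF k p])
qed

text \<open>The dual half of \<open>gen_trans\<close> is the adjoint of the transition map in the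
  opposite direction, here read in the coordinates of chart \<open>k\<close>.\<close>

lemma smooth_vtrans':
  assumes k: "k \<in> idx B" and l: "l \<in> idx B"
  shows "smooth_on (coord B k ` (chart_dom B k \<inter> chart_dom B l)) (\<lambda>u. vtrans B l k (par B k u) v)"
  by (rule base.smooth_chart_change[OF k l])
     (use smooth_vtrans[OF l k] base.open_dom k l in \<open>auto simp: Int_commute\<close>)

lemma smooth_gen_vtrans:
  assumes k: "k \<in> idx B" and l: "l \<in> idx B"
  shows "smooth_on (coord B k ` (chart_dom B k \<inter> chart_dom B l))
    (\<lambda>u. gen_trans (vtrans B) k l (par B k u) c)"
proof -
  let ?W = "chart_dom B k \<inter> chart_dom B l"
  note S = base.open_overlap[OF k l]
  have p: "par B k u \<in> chart_dom B k" "par B k u \<in> chart_dom B l" if "u \<in> coord B k ` ?W" for u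
    using base.par_image(2)[OF k that] by auto
  have "smooth_on (coord B k ` ?W) (\<lambda>u. adjoint (vtrans B l k (par B k u)) (snd c))"
    by (rule smooth_on_adjoint[OF S linear_vtrans[OF l k p(2,1)] smooth_vtrans'[OF k l] smooth_on_const])
  then show ?thesis
    unfolding gen_trans_apply by (intro smooth_on_Pair[OF S] smooth_vtrans[OF k l])
qed

text \<open>The dual half is the transpose of the gauge law for the opposite change, from
  \<open>l\<close> to \<open>k\<close>. That law differentiates in chart \<open>l\<close>, so its
  derivative term has to be moved to chart \<open>k\<close> first.\<close>

lemma gen_gauge:
  assumes k: "k \<in> idx B" and l: "l \<in> idx B" and p: "p \<in> chart_dom B k" "p \<in> chart_dom B l"
  shows "gen_connection \<omega> l p (jac B k l p w) (gen_trans (vtrans B) k l p c)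
    = gen_trans (vtrans B) k l p (gen_connection \<omega> k p w c)
      - frechet_derivative (\<lambda>u. gen_trans (vtrans B) k l (par B k u) c) (at (coord B k p)) w"
proof -
  let ?W = "chart_dom B k \<inter> chart_dom B l"
  note S = base.open_overlap[OF k l]
  have u: "coord B k p \<in> coord B k ` ?W" using p by auto
  have par: "par B k u \<in> chart_dom B k" "par B k u \<in> chart_dom B l" if "u \<in> coord B k ` ?W" for u
    using base.par_image(2)[OF k that] by auto
  define d where "d v = frechet_derivative (\<lambda>u. vtrans B k l (par B k u) v) (at (coord B k p))" for v
  define d' where "d' v = frechet_derivative (\<lambda>u. vtrans B l k (par B k u) v) (at (coord B k p))" for v
  have d: "((\<lambda>u. vtrans B k l (par B k u) v) has_derivative d v) (at (coord B k p))" for v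
    unfolding d_def by (rule smooth_on_has_derivative[OF smooth_vtrans[OF k l] u])
  have d': "((\<lambda>u. vtrans B l k (par B k u) v) has_derivative d' v) (at (coord B k p))" for v
    unfolding d'_def by (rule smooth_on_has_derivative[OF smooth_vtrans'[OF k l] u])
  have "((\<lambda>u. adjoint (vtrans B l k (par B k u)) (snd c)) has_derivative
      (\<lambda>h. adjoint (\<lambda>v. d' v h) (snd c))) (at (coord B k p))"
    by (rule has_derivative_adjoint[OF S u linear_vtrans[OF l k par(2,1)] d'])
  then have G: "frechet_derivative (\<lambda>u. gen_trans (vtrans B) k l (par B k u) c) (at (coord B k p)) w
      = (d (fst c) w, adjoint (\<lambda>v. d' v w) (snd c))"
    unfolding gen_trans_apply by (subst frechet_derivative_eqI[OF has_derivative_Pair[OF d]]) auto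
  have lind': "linear (\<lambda>v. d' v w)"
    by (rule linear_derivative_param[OF S u linear_vtrans[OF l k par(2,1)] d'])
  have g': "\<omega> k p w (vtrans B l k p v) = vtrans B l k p (\<omega> l p (jac B k l p w) v) - d' v w" for v
  proof -
    have u': "coord B l p \<in> coord B l ` (chart_dom B l \<inter> chart_dom B k)" using p by auto
    have "((\<lambda>u. vtrans B l k (par B k u) v) has_derivative (\<lambda>w.
        frechet_derivative (\<lambda>u. vtrans B l k (par B l u) v) (at (coord B l p)) (jac B k l p w)))
        (at (coord B k p))"
      by (rule base.deriv_chart_change[OF k l p smooth_on_has_derivative[OF smooth_vtrans[OF l k] u']])
    then have "d' v w = frechet_derivative (\<lambda>u. vtrans B l k (par B l u) v) (at (coord B l p)) (jac B k l p w)"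
      using has_derivative_unique[OF d'] by metis
    then show ?thesis
      using gauge[OF l k p(2,1), of "jac B k l p w" v] by (simp add: base.jac_jac[OF k l p])
  qed
  note lin = linear_con(1)[OF l p(2)] linear_con(1)[OF k p(1)] linear_vtrans[OF l k p(2,1)]
  have "- adjoint (\<omega> l p (jac B k l p w)) (adjoint (vtrans B l k p) f)
      = - adjoint (vtrans B l k p) (adjoint (\<omega> k p w) f) - adjoint (\<lambda>v. d' v w) f" for f
    by (rule vector_eq_rdot[THEN iffD1])
       (simp add: inner_diff_left inner_diff_right adjoint_clauses[OF lin(1)] adjoint_clauses[OF lin(2)]
         adjoint_clauses[OF lin(3)] adjoint_clauses[OF lind'] g')
  then show ?thesis
    unfolding G
    by (simp add: gen_trans_apply gen_connection_apply gauge[OF k l p] d_def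
        linear_neg[OF adjoint_linear[OF lin(3)]])
qed

text \<open>The equation is solved in the frame \<open>k\<close>, and the components in the other
  frames are defined by transition. The cocycle law makes this a section, and
  \<open>gen_gauge\<close> carries its flatness to every frame.\<close>

lemma ex_flat_section:
  assumes k: "k \<in> idx B" and p: "p \<in> chart_dom B k"
  obtains W s where "open W" "p \<in> W" "s \<in> flat_sections B \<omega> W" "s k p = c"
proof -
  let ?S = "coord B k ` chart_dom B k"
  define A where "A x = gen_connection \<omega> k (par B k x)" for x
  note S = base.open_coord_dom[OF k]
  have flatA: "frechet_derivative (\<lambda>u. A u w' v) (at x) w - frechet_derivative (\<lambda>u. A u w v) (at x) w'
        + A x w (A x w' v) - A x w' (A x w v) = 0" if "x \<in> ?S" for x w w' v
    using curvature_gen_connection[OF k base.coord_par(2)[OF k that]]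
    by (simp add: A_def base.coord_par(1)[OF k that])
  have bilA: "bilinear (A x)" if "x \<in> ?S" for x
    unfolding A_def by (rule bilinear_gen_connection[OF k base.coord_par(2)[OF k that]])
  have smA: "smooth_on ?S (\<lambda>x. A x w v)" for w v
    unfolding A_def by (rule smooth_gen_connection[OF k])
  have x0: "coord B k p \<in> ?S" using p by simp
  obtain r where r: "0 < r" "ball (coord B k p) r \<subseteq> ?S"
    and ex: "\<And>c. \<exists>f. smooth_on (ball (coord B k p) r) f \<and> f (coord B k p) = c \<and>
      (\<forall>x\<in>ball (coord B k p) r. (f has_derivative (\<lambda>h. - A x h (f x))) (at x))"
    using local_flat_solution[OF S x0 bilA smA flatA] by blast
  obtain f where f: "smooth_on (ball (coord B k p) r) f" "f (coord B k p) = c"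
    "\<And>x. x \<in> ball (coord B k p) r \<Longrightarrow> (f has_derivative (\<lambda>h. - A x h (f x))) (at x)"
    using ex[of c] by blast
  define W where "W = chart_dom B k \<inter> coord B k -` ball (coord B k p) r"
  have W: "open W" "W \<subseteq> chart_dom B k"
    unfolding W_def by (auto intro: continuous_open_preimage[OF base.continuous_coord base.open_dom] k)
  have fW: "u \<in> ball (coord B k p) r" if "u \<in> coord B k ` W" for u
    using that by (auto simp: W_def)
  define s where "s l q = gen_trans (vtrans B) k l q (f (coord B k q))" for l q
  have smk: "smooth_on (coord B k ` (W \<inter> chart_dom B l)) (\<lambda>u. s l (par B k u))" if l: "l \<in> idx B" for l
  proof -
    let ?V = "W \<inter> chart_dom B l"
    have V: "?V \<subseteq> chart_dom B k" "?V \<subseteq> chart_dom B k \<inter> chart_dom B l" using W by auto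
    have oV: "open (coord B k ` ?V)"
      using base.open_coord[OF k] W base.open_dom[OF l] V by blast
    have par: "par B k u \<in> chart_dom B k" "par B k u \<in> chart_dom B l" if "u \<in> coord B k ` ?V" for u
      using base.par_image(2)[OF k that V(1)] V by auto
    have "smooth_on (coord B k ` ?V) (\<lambda>u. gen_trans (vtrans B) k l (par B k u) (f u))"
    proof (rule smooth_on_apply[OF oV linear_gen_vtrans[OF k l par]])
      show "smooth_on (coord B k ` ?V) (\<lambda>u. gen_trans (vtrans B) k l (par B k u) b)" for b
        by (rule smooth_on_subset[OF smooth_gen_vtrans[OF k l]]) (use V in auto)
      show "smooth_on (coord B k ` ?V) f"
        by (rule smooth_on_subset[OF f(1)]) (use fW in blast)
    qed
    then show ?thesis
      by (rule smooth_on_cong[OF oV]) (use base.par_image(1)[OF k _ V(1)] in \<open>simp add: s_def\<close>)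
  qed
  have "s \<in> flat_sections B \<omega> W"
    unfolding flat_sections_def is_section_def
  proof (intro CollectI conjI ballI allI)
    fix l assume l: "l \<in> idx B"
    have "smooth_on (coord B l ` (W \<inter> chart_dom B l)) (\<lambda>u. s l (par B l u))"
      by (rule base.smooth_chart_change[OF l k _ _ smk[OF l]]) (use W base.open_dom[OF l] in auto)
    then show "smooth_on (coord B l ` (W \<inter> chart_dom B l)) (s l \<circ> par B l)"
      by (simp add: comp_def)
  next
    fix l m q assume l: "l \<in> idx B" and m: "m \<in> idx B" and q: "q \<in> W \<inter> chart_dom B l \<inter> chart_dom B m"
    then show "s m q = gen_trans (vtrans B) l m q (s l q)"
      using W by (auto simp: s_def gen_vtrans_cocycle[OF k l m])
  next
    fix l q w assume l: "l \<in> idx B" and q: "q \<in> W \<inter> chart_dom B l"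
    have qk: "q \<in> chart_dom B k" and ql: "q \<in> chart_dom B l" using q W by auto
    let ?V = "W \<inter> chart_dom B l" and ?x = "coord B k q"
    have V: "?V \<subseteq> chart_dom B k" "?V \<subseteq> chart_dom B k \<inter> chart_dom B l" using W by auto
    have oV: "open (coord B k ` ?V)"
      using base.open_coord[OF k] W base.open_dom[OF l] V by blast
    have x: "?x \<in> coord B k ` ?V" using q by auto
    have par: "par B k u \<in> chart_dom B k" "par B k u \<in> chart_dom B l" if "u \<in> coord B k ` ?V" for u
      using base.par_image(2)[OF k that V(1)] V by auto
    define dG where "dG c = frechet_derivative (\<lambda>u. gen_trans (vtrans B) k l (par B k u) c) (at ?x)" for c
    have dG: "((\<lambda>u. gen_trans (vtrans B) k l (par B k u) c) has_derivative dG c) (at ?x)" for c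
      unfolding dG_def by (rule smooth_on_has_derivative[OF smooth_gen_vtrans[OF k l]]) (use qk ql in auto)
    have "?x \<in> ball (coord B k p) r" by (rule fW) (use q in auto)
    from has_derivative_apply[OF oV x linear_gen_vtrans[OF k l par] dG f(3)[OF this]]
    have "((\<lambda>u. gen_trans (vtrans B) k l (par B k u) (f u)) has_derivative
      (\<lambda>w. dG (f ?x) w + gen_trans (vtrans B) k l q (- A ?x w (f ?x)))) (at ?x)"
      by (simp only: base.par_coord[OF k qk])
    then have "((\<lambda>u. s l (par B k u)) has_derivative
      (\<lambda>w. dG (f ?x) w + gen_trans (vtrans B) k l q (- A ?x w (f ?x)))) (at ?x)"
      by (rule has_derivative_transform_within_open[OF _ oV x])
         (use base.par_image(1)[OF k _ V(1)] in \<open>simp add: s_def\<close>)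
    from base.deriv_chart_change[OF l k ql qk this]
    have "frechet_derivative (\<lambda>u. s l (par B l u)) (at (coord B l q)) w =
      dG (f ?x) (jac B l k q w) + gen_trans (vtrans B) k l q (- A ?x (jac B l k q w) (f ?x))"
      by (simp add: frechet_derivative_eqI)
    moreover have "gen_connection \<omega> l q w (s l q) = gen_trans (vtrans B) k l q (A ?x (jac B l k q w) (f ?x))
      - dG (f ?x) (jac B l k q w)"
      using gen_gauge[OF k l qk ql, of "jac B l k q w" "f ?x"]
      by (simp add: base.jac_jac[OF l k ql qk] dG_def s_def A_def base.par_coord[OF k qk])
    ultimately show "nabla B (gen_connection \<omega>) s l q w = 0"
      by (simp add: nabla_def comp_def linear_neg[OF linear_gen_vtrans[OF k l qk ql]])
  qed
  moreover have "p \<in> W" using p r by (simp add: W_def)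
  moreover have "s k p = c"
    by (simp add: s_def f(2) gen_vtrans_self[OF k p])
  ultimately show ?thesis
    using W that by blast
qed

end

section \<open>Semi-flat structures in coordinates\<close>

lemma adjoint_map_prod:
  fixes a :: "'a::euclidean_space \<Rightarrow> 'b::euclidean_space"
    and b :: "'c::euclidean_space \<Rightarrow> 'd::euclidean_space"
  assumes "linear a" "linear b"
  shows "adjoint (map_prod a b) = map_prod (adjoint a) (adjoint b)"
  by (rule adjoint_unique) (auto simp: adjoint_clauses[OF assms(1)] adjoint_clauses[OF assms(2)])

lemma linear_map_prod:
  assumes "linear a" "linear b"
  shows "linear (map_prod a b)"
  by (rule linearI) (auto simp: linear_add[OF assms(1)] linear_add[OF assms(2)]
      linear_cmul[OF assms(1)] linear_cmul[OF assms(2)])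

lemma pairing_add_left: "pairing (a + b) c = pairing a c + pairing b c"
  and pairing_minus_left: "pairing (- a) c = - pairing a c"
  by (auto simp: pairing_def inner_add algebra_simps)

lemma pairing_add_right: "pairing a (b + c) = pairing a b + pairing a c"
  and pairing_minus_right: "pairing a (- c) = - pairing a c"
  and pairing_scaleR_right: "pairing a (r *\<^sub>R c) = r * pairing a c"
  by (auto simp: pairing_def inner_add algebra_simps)

text \<open>The second column of \<open>M_map\<close> has signs opposite to the corresponding blocks
  of \<open>J\<close>, whence \<open>- f\<close>. Orthogonality and \<open>J (J a) = - a\<close>
  make \<open>J\<close> skew for the pairing, so the required blocks are found by testing against
  elements of the tangent bundle and its dual.\<close>

lemma M_map_eq:
  fixes J :: "('f::euclidean_space \<times> 'e::euclidean_space) \<times> ('f \<times> 'e) \<Rightarrow> ('f \<times> 'e) \<times> ('f \<times> 'e)"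
  assumes lin: "linear J" and sq: "\<And>a. J (J a) = - a"
    and orth: "\<And>a b. pairing (J a) (J b) = pairing a b"
    and ad: "J ` {((v, 0), (f, 0)) | v f. True} = {((0, x), (0, \<xi>)) | x \<xi>. True}"
  shows "J ((v, 0), (- f, 0)) = ((0, fst (M_map J (v, f))), (0, snd (M_map J (v, f))))"
proof -
  have skew: "pairing (J a) b = - pairing a (J b)" for a b
    using orth[of a "J b"] by (simp add: sq pairing_minus_right)
  have ex: "\<exists>x \<xi>. J ((v, 0), (f, 0)) = ((0, x), (0, \<xi>))" for v f
    using ad by blast
  obtain x \<zeta> where x: "J ((v, 0), (- f, 0)) = ((0, x), (0, \<zeta>))"
    using ex by blast
  \<comment> \<open>The value for \<open>f = 0\<close> isolates the part of \<open>x\<close> that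
    depends on \<open>v\<close>, which is \<open>blk13 J v\<close>.\<close>
  obtain x1 \<zeta>1 where x1: "J ((v, 0), (0, 0)) = ((0, x1), (0, \<zeta>1))"
    using ex by blast
  note l = linear_add[OF lin, symmetric] linear_cmul[OF lin, symmetric]
  have lin22: "linear (blk22 J)" and lin12: "linear (blk12 J)" and lin31: "linear (blk31 J)"
    unfolding blk22_def blk12_def blk31_def
    by (rule linearI; simp add: fst_add[symmetric] fst_scaleR[symmetric] snd_add[symmetric]
        snd_scaleR[symmetric] l del: fst_add fst_scaleR snd_add snd_scaleR)+
  have "x = blk13 J v + adjoint (blk22 J) f"
  proof (rule vector_eq_ldot[THEN iffD1, rule_format])
    fix \<xi>
    have "\<xi> \<bullet> x = f \<bullet> blk22 J \<xi> - fst (snd (J ((0, 0), (0, \<xi>)))) \<bullet> v"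
      using skew[of "((v, 0), (- f, 0))" "((0, 0), (0, \<xi>))"]
      by (simp add: x pairing_def blk22_def inner_prod_def inner_commute)
    moreover have "\<xi> \<bullet> x1 = - (fst (snd (J ((0, 0), (0, \<xi>)))) \<bullet> v)"
      using skew[of "((v, 0), (0, 0))" "((0, 0), (0, \<xi>))"]
      by (simp add: x1 pairing_def inner_prod_def inner_commute)
    ultimately show "\<xi> \<bullet> x = \<xi> \<bullet> (blk13 J v + adjoint (blk22 J) f)"
      by (simp add: inner_add_right adjoint_clauses[OF lin22] blk13_def x1 inner_commute)
  qed
  moreover have "\<zeta> = - adjoint (blk31 J) v + adjoint (blk12 J) f"
  proof (rule vector_eq_ldot[THEN iffD1, rule_format])
    fix x'
    show "x' \<bullet> \<zeta> = x' \<bullet> (- adjoint (blk31 J) v + adjoint (blk12 J) f)"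
      using skew[of "((v, 0), (- f, 0))" "((0, x'), (0, 0))"]
      by (simp add: x pairing_def inner_prod_def inner_commute inner_add_right inner_diff_right
          adjoint_clauses[OF lin12] adjoint_clauses[OF lin31] blk12_def blk31_def)
  qed
  ultimately show ?thesis
    by (simp add: x M_map_def)
qed

locale semi_flat_bundle = flat_bundle B \<omega>
  for B :: "('k, 'p::{t2_space, second_countable_topology}, 'e::euclidean_space,
      'v::topological_space, 'f::euclidean_space) vbundle"
    and \<omega> :: "'k \<Rightarrow> 'p \<Rightarrow> 'e \<Rightarrow> 'f \<Rightarrow> 'f" +
  fixes J\<^sub>0 :: "'k \<Rightarrow> 'p \<Rightarrow> ('f \<times> 'e) \<times> ('f \<times> 'e) \<Rightarrow> ('f \<times> 'e) \<times> ('f \<times> 'e)"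
    and J :: "'k \<Rightarrow> 'v \<Rightarrow> ('e \<times> 'f) \<times> ('e \<times> 'f) \<Rightarrow> ('e \<times> 'f) \<times> ('e \<times> 'f)"
  assumes semi_flat: "semi_flat B \<omega> J\<^sub>0 J"
begin

abbreviation "WM \<equiv> sum_trans (vtrans B) (jac B)"

lemma J0_props:
  assumes "k \<in> idx B" "p \<in> chart_dom B k"
  shows "linear (J\<^sub>0 k p)" "J\<^sub>0 k p (J\<^sub>0 k p a) = - a" "pairing (J\<^sub>0 k p a) (J\<^sub>0 k p b) = pairing a b"
    "J\<^sub>0 k p ` {((v, 0), (f, 0)) | v f. True} = {((0, x), (0, \<xi>)) | x \<xi>. True}"
proof -
  have g: "gacs B WM J\<^sub>0" and a: "adapted B J\<^sub>0"
    using semi_flat unfolding semi_flat_def by simp_all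
  note g' = bspec[OF bspec[OF conjunct1[OF g[unfolded gacs_def]] assms(1)] assms(2)]
  show "linear (J\<^sub>0 k p)" "J\<^sub>0 k p (J\<^sub>0 k p a) = - a" "pairing (J\<^sub>0 k p a) (J\<^sub>0 k p b) = pairing a b"
    using g' by blast+
  show "J\<^sub>0 k p ` {((v, 0), (f, 0)) | v f. True} = {((0, x), (0, \<xi>)) | x \<xi>. True}"
    by (rule bspec[OF bspec[OF a[unfolded adapted_def] assms(1)] assms(2)])
qed

lemma smooth_J0: "k \<in> idx B \<Longrightarrow> smooth_on (coord B k ` chart_dom B k) (\<lambda>u. J\<^sub>0 k (par B k u) a)"
  using semi_flat unfolding semi_flat_def gacs_def by blast

lemma J0_equiv:
  assumes "k \<in> idx B" "l \<in> idx B" "p \<in> chart_dom B k" "p \<in> chart_dom B l"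
  shows "J\<^sub>0 l p (gen_trans WM k l p a) = gen_trans WM k l p (J\<^sub>0 k p a)"
  using semi_flat assms unfolding semi_flat_def gacs_def by blast

text \<open>\<open>F_map\<close> at \<open>e\<close> depends only on the base point and the fibre
  component. Separating these arguments lets it and its explicit inverse \<open>Fi\<close> be
  differentiated in coordinates.\<close>

definition Fc :: "'k \<Rightarrow> 'p \<Rightarrow> 'f \<Rightarrow> ('e \<times> 'f) \<times> ('e \<times> 'f) \<Rightarrow> ('f \<times> 'e) \<times> ('f \<times> 'e)" where
  "Fc k p y a = ((snd (fst a) + \<omega> k p (fst (fst a)) y, fst (fst a)),
     (snd (snd a), fst (snd a) - adjoint (\<lambda>x. \<omega> k p x y) (snd (snd a))))"

definition Fi :: "'k \<Rightarrow> 'p \<Rightarrow> 'f \<Rightarrow> ('f \<times> 'e) \<times> ('f \<times> 'e) \<Rightarrow> ('e \<times> 'f) \<times> ('e \<times> 'f)" where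
  "Fi k p y c = ((snd (fst c), fst (fst c) - \<omega> k p (snd (fst c)) y),
     (snd (snd c) + adjoint (\<lambda>x. \<omega> k p x y) (fst (snd c)), fst (snd c)))"

lemma Fi_Fc: "Fi k p y (Fc k p y a) = a" and Fc_Fi: "Fc k p y (Fi k p y c) = c"
  by (auto simp: Fi_def Fc_def)

lemma F_map_Fc:
  assumes "k \<in> idx B" "proj B e \<in> chart_dom B k"
  shows "F_map B \<omega> k e = Fc k (proj B e) (triv B k e)"
  using F_map_eq(2)[OF vb con assms] by (auto simp: Fc_def fun_eq_iff)

lemma J_eq:
  assumes "k \<in> idx B" "proj B e \<in> chart_dom B k"
  shows "J k e a = Fi k (proj B e) (triv B k e) (J\<^sub>0 k (proj B e) (Fc k (proj B e) (triv B k e) a))"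
proof -
  have "inv (F_map B \<omega> k e) = Fi k (proj B e) (triv B k e)"
    unfolding F_map_Fc[OF assms] by (rule inv_equality) (rule Fi_Fc Fc_Fi)+
  then show ?thesis
    using semi_flat assms unfolding semi_flat_def by (simp add: F_map_Fc[OF assms])
qed

lemma linear_Fc:
  assumes "k \<in> idx B" "p \<in> chart_dom B k"
  shows "linear (Fc k p y)"
proof -
  note l = linear_con(2)[OF assms, of y] adjoint_linear[OF linear_con(2)[OF assms, of y]]
  show ?thesis
    unfolding Fc_def by (rule linearI) (simp_all add: linear_add[OF l(1)] linear_add[OF l(2)]
        linear_cmul[OF l(1)] linear_cmul[OF l(2)] scaleR_add_right scaleR_diff_right)
qed

lemma linear_Fi:
  assumes "k \<in> idx B" "p \<in> chart_dom B k"
  shows "linear (Fi k p y)"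
proof -
  note l = linear_con(2)[OF assms, of y] adjoint_linear[OF linear_con(2)[OF assms, of y]]
  show ?thesis
    unfolding Fi_def by (rule linearI) (simp_all add: linear_add[OF l(1)] linear_add[OF l(2)]
        linear_cmul[OF l(1)] linear_cmul[OF l(2)] scaleR_add_right scaleR_diff_right)
qed

lemma J_props:
  assumes k: "k \<in> idx B" and e: "proj B e \<in> chart_dom B k"
  shows "linear (J k e)" "J k e (J k e a) = - a" "pairing (J k e a) (J k e b) = pairing a b"
proof -
  note J0 = J0_props[OF k e]
  have "linear (Fi k (proj B e) (triv B k e) \<circ> (J\<^sub>0 k (proj B e) \<circ> Fc k (proj B e) (triv B k e)))"
    by (intro linear_compose linear_Fi linear_Fc J0(1) k e)
  then show "linear (J k e)"
    by (simp add: comp_def J_eq[OF k e, abs_def])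
  show "J k e (J k e a) = - a"
    by (simp add: J_eq[OF k e] Fc_Fi J0(2) linear_neg[OF linear_Fi[OF k e]] Fi_Fc)
  have F: "pairing (Fc k (proj B e) (triv B k e) a) (Fc k (proj B e) (triv B k e) b) = pairing a b" for a b
    using pairing_F_map[OF vb con k e] by (simp add: F_map_Fc[OF k e])
  have "pairing (Fi k (proj B e) (triv B k e) a) (Fi k (proj B e) (triv B k e) b) = pairing a b" for a b
    using F[of "Fi k (proj B e) (triv B k e) a" "Fi k (proj B e) (triv B k e) b"] by (simp add: Fc_Fi)
  then show "pairing (J k e a) (J k e b) = pairing a b"
    by (simp add: J_eq[OF k e] J0(3) F)
qed

lemma J_skew:
  assumes "k \<in> idx B" "proj B e \<in> chart_dom B k"
  shows "pairing (J k e a) b = - pairing a (J k e b)"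
  using J_props(3)[OF assms, of a "J k e b"] by (simp add: J_props(2)[OF assms] pairing_minus_right)

text \<open>
  The lift to the total space of an element of \<open>V \<oplus> V\<^sup>\<or>\<close>, and the horizontal lift of an element of
  \<open>T\<^sub>M \<oplus> T\<^sub>M\<^sup>\<or>\<close>.  The sign of the covector part is the one that makes \<open>J\<close> correspond to \<open>M_map\<close>.
\<close>

definition lift0 :: "'k \<Rightarrow> 'p \<Rightarrow> 'f \<Rightarrow> 'f \<times> 'f \<Rightarrow> ('e \<times> 'f) \<times> ('e \<times> 'f)" where
  "lift0 k p y c = ((0, fst c), (- adjoint (\<lambda>x. \<omega> k p x y) (snd c), - snd c))"

definition lift1 :: "'k \<Rightarrow> 'p \<Rightarrow> 'f \<Rightarrow> 'e \<times> 'e \<Rightarrow> ('e \<times> 'f) \<times> ('e \<times> 'f)" where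
  "lift1 k p y m = ((fst m, - \<omega> k p (fst m) y), (snd m, 0))"

lemma lift0_Fi:
  assumes "k \<in> idx B" "p \<in> chart_dom B k"
  shows "lift0 k p y c = Fi k p y ((fst c, 0), (- snd c, 0))"
  by (simp add: lift0_def Fi_def linear_0[OF linear_con(2)[OF assms]] linear_neg[OF adjoint_linear[OF linear_con(2)[OF assms]]])

lemma lift1_Fi:
  assumes "k \<in> idx B" "p \<in> chart_dom B k"
  shows "lift1 k p y m = Fi k p y ((0, fst m), (0, snd m))"
  by (simp add: lift1_def Fi_def linear_0[OF adjoint_linear[OF linear_con(2)[OF assms]]])

lemma J_lift0:
  assumes "k \<in> idx B" "proj B e \<in> chart_dom B k"
  shows "J k e (lift0 k (proj B e) (triv B k e) c)
    = lift1 k (proj B e) (triv B k e) (M_map (J\<^sub>0 k (proj B e)) c)"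
  using M_map_eq[OF J0_props[OF assms], of "fst c" "snd c"]
  by (simp add: J_eq[OF assms] lift0_Fi[OF assms] Fc_Fi lift1_Fi[OF assms])

text \<open>Adaptedness says that \<open>J\<^sub>0\<close> carries the sum of V and its dual onto
  the complementary sum of the tangent bundle and its dual. Transported by the inverse of F, lifts
  and their images under \<open>J\<close> fill the fibre, so suitable flat sections realize every
  value.\<close>

lemma lifts_span:
  assumes k: "k \<in> idx B" and e: "proj B e \<in> chart_dom B k"
  obtains c d where "a = lift0 k (proj B e) (triv B k e) c + J k e (lift0 k (proj B e) (triv B k e) d)"
proof -
  let ?p = "proj B e" and ?y = "triv B k e"
  define b where "b = Fc k ?p ?y a"
  define v x f \<zeta> where "v = fst (fst b)" "x = snd (fst b)" "f = fst (snd b)" "\<zeta> = snd (snd b)"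
  then have a: "Fc k ?p ?y a = ((v, x), (f, \<zeta>))"
    by (simp add: b_def)
  have "((0, x), (0, \<zeta>)) \<in> J\<^sub>0 k ?p ` {((v, 0), (f, 0)) | v f. True}"
    unfolding J0_props(4)[OF k e] by simp
  then obtain v' f' where "J\<^sub>0 k ?p ((v', 0), (f', 0)) = ((0, x), (0, \<zeta>))"
    by (elim imageE CollectE exE) simp
  then have "J k e (lift0 k ?p ?y (v', - f')) = Fi k ?p ?y ((0, x), (0, \<zeta>))"
    by (simp add: J_eq[OF k e] lift0_Fi[OF k e] Fc_Fi)
  moreover have "a = Fi k ?p ?y (((v, 0), (f, 0)) + ((0, x), (0, \<zeta>)))"
    using Fi_Fc[of k ?p ?y a] by (simp add: a)
  ultimately have "a = lift0 k ?p ?y (v, - f) + J k e (lift0 k ?p ?y (v', - f'))"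
    unfolding linear_add[OF linear_Fi[OF k e]] by (simp add: lift0_Fi[OF k e])
  then show ?thesis by (rule that)
qed

section \<open>Compatibility with changes of chart\<close>

lemma jac_TX:
  assumes k: "k \<in> idx B" and l: "l \<in> idx B" and e: "proj B e \<in> chart_dom B k" "proj B e \<in> chart_dom B l"
  shows "jac TX k l e (w, u) = (jac B k l (proj B e) w,
    frechet_derivative (\<lambda>x. vtrans B k l (par B k x) (triv B k e)) (at (coord B k (proj B e))) w
      + vtrans B k l (proj B e) u)"
proof -
  let ?W = "chart_dom B k \<inter> chart_dom B l" and ?x = "coord B k (proj B e)" and ?y = "triv B k e"
  let ?S = "(coord B k ` ?W) \<times> (UNIV :: 'f set)"
  define dg where "dg v = frechet_derivative (\<lambda>x. vtrans B k l (par B k x) v) (at ?x)" for v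
  have S: "open ?S" using base.open_overlap[OF k l] by (simp add: open_Times)
  have z: "(?x, ?y) \<in> ?S" using e by auto
  have fst': "(fst has_derivative fst) (at (?x, ?y))"
    by (rule has_derivative_fst) (rule has_derivative_ident)
  have snd': "(snd has_derivative snd) (at (?x, ?y))"
    by (rule has_derivative_snd) (rule has_derivative_ident)
  have par: "par B k (fst z) \<in> chart_dom B k" "par B k (fst z) \<in> chart_dom B l" if "z \<in> ?S" for z
    using base.par_image(2)[OF k, of "fst z" ?W] that by auto
  have "((\<lambda>x. vtrans B k l (par B k x) v) has_derivative dg v) (at ?x)" for v
    unfolding dg_def by (rule smooth_on_has_derivative[OF smooth_vtrans[OF k l]]) (use e in auto)
  then have dg: "((\<lambda>z. vtrans B k l (par B k (fst z)) v) has_derivative (\<lambda>h. dg v (fst h))) (at (?x, ?y))" for v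
    using has_derivative_compose[OF fst', of "\<lambda>x. vtrans B k l (par B k x) v"] by simp
  have 1: "((\<lambda>z. vtrans B k l (par B k (fst z)) (snd z)) has_derivative
      (\<lambda>h. dg ?y (fst h) + vtrans B k l (proj B e) (snd h))) (at (?x, ?y))"
    using has_derivative_apply[OF S z linear_vtrans[OF k l par] dg snd']
    by (simp add: base.par_coord[OF k e(1)])
  have 2: "((\<lambda>z. coord B l (par B k (fst z))) has_derivative (\<lambda>h. jac B k l (proj B e) (fst h))) (at (?x, ?y))"
    using has_derivative_compose[OF fst', of "coord B l \<circ> par B k"] base.change_deriv[OF k l e]
    by simp
  have "((coord TX l \<circ> par TX k) has_derivative
      (\<lambda>h. (jac B k l (proj B e) (fst h), dg ?y (fst h) + vtrans B k l (proj B e) (snd h)))) (at (?x, ?y))"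
  proof (rule has_derivative_transform_within_open[OF has_derivative_Pair[OF 2 1] S z])
    fix z :: "'e \<times> 'f" assume "z \<in> ?S"
    moreover obtain x y where "z = (x, y)" by fastforce
    ultimately show "(coord B l (par B k (fst z)), vtrans B k l (par B k (fst z)) (snd z))
        = (coord TX l \<circ> par TX k) z"
      using proj_par_TX[OF k, of x y] triv_change[OF k, of x l y] by auto
  qed
  then show ?thesis
    by (simp add: jac_def[of TX] frechet_derivative_eqI dg_def)
qed

text \<open>The tangent half is the gauge law applied to the tautological section. The covector half
  of F is the adjoint of the inverse of its tangent half, so it follows by transposing the tangent
  statement for the opposite change.\<close>

lemma Fc_equiv:
  assumes k: "k \<in> idx B" and l: "l \<in> idx B" and e: "proj B e \<in> chart_dom B k" "proj B e \<in> chart_dom B l"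
  shows "Fc l (proj B e) (triv B l e) (gen_trans (jac TX) k l e a)
    = gen_trans WM k l (proj B e) (Fc k (proj B e) (triv B k e) a)"
proof -
  let ?p = "proj B e"
  define F1 where "F1 m w = (snd w + \<omega> m ?p (fst w) (triv B m e), fst w)" for m and w :: "'e \<times> 'f"
  define G1 where "G1 m c = (snd c, fst c - \<omega> m ?p (snd c) (triv B m e))" for m and c :: "'f \<times> 'e"
  have GF: "G1 m (F1 m w) = w" "F1 m (G1 m c) = c" for m w c
    by (simp_all add: F1_def G1_def)
  have vec: "F1 m (jac TX n m e w) = WM n m ?p (F1 n w)"
    if n: "n \<in> idx B" "?p \<in> chart_dom B n" and m: "m \<in> idx B" "?p \<in> chart_dom B m" for n m w
  proof -
    obtain x u where w: "w = (x, u)" by fastforce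
    show ?thesis
      using gauge[OF n(1) m(1) n(2) m(2), of x "triv B n e"]
      by (simp add: w F1_def jac_TX[OF n(1) m(1) n(2) m(2)] sum_trans_def
          vtrans_triv[OF n] linear_add[OF linear_vtrans[OF n(1) m(1) n(2) m(2)]])
  qed
  have linG: "linear (G1 m)" if "m \<in> idx B" "?p \<in> chart_dom B m" for m
    unfolding G1_def by (rule linearI) (simp_all add: linear_add[OF linear_con(2)[OF that]]
        linear_cmul[OF linear_con(2)[OF that]] scaleR_diff_right)
  have adjG: "adjoint (G1 m) \<theta> = (snd \<theta>, fst \<theta> - adjoint (\<lambda>x. \<omega> m ?p x (triv B m e)) (snd \<theta>))"
    if "m \<in> idx B" "?p \<in> chart_dom B m" for m \<theta>
  proof (rule vector_eq_rdot[THEN iffD1, rule_format])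
    fix c
    have "adjoint (G1 m) \<theta> \<bullet> c = \<theta> \<bullet> G1 m c"
      by (rule adjoint_clauses[OF linG[OF that]])
    then show "adjoint (G1 m) \<theta> \<bullet> c
        = (snd \<theta>, fst \<theta> - adjoint (\<lambda>x. \<omega> m ?p x (triv B m e)) (snd \<theta>)) \<bullet> c"
      by (simp add: adjoint_clauses[OF linear_con(2)[OF that]] G1_def inner_prod_def
          inner_diff_left inner_diff_right)
  qed
  have Fc: "Fc m ?p (triv B m e) b = (F1 m (fst b), adjoint (G1 m) (snd b))"
    if "m \<in> idx B" "?p \<in> chart_dom B m" for m b
    by (simp add: adjG[OF that] Fc_def F1_def)
  have TG: "jac TX l k e (G1 l c) = G1 k (WM l k ?p c)" for c
    using arg_cong[OF vec[OF l e(2) k e(1), of "G1 l c"], of "G1 k"] by (simp add: GF)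
  have lT: "linear (jac TX l k e)"
    using total.linear_jac[of l k e] k l e by simp
  have lW: "linear (WM l k ?p)"
    unfolding sum_trans_def by (intro linear_map_prod linear_vtrans base.linear_jac k l e)
  have "adjoint (G1 l) (adjoint (jac TX l k e) \<theta>) = adjoint (WM l k ?p) (adjoint (G1 k) \<theta>)" for \<theta>
    by (rule vector_eq_rdot[THEN iffD1])
       (simp add: adjoint_clauses[OF linG[OF l e(2)]] adjoint_clauses[OF linG[OF k e(1)]]
         adjoint_clauses[OF lT] adjoint_clauses[OF lW] TG)
  then show ?thesis
    by (simp add: Fc[OF l e(2)] Fc[OF k e(1)] gen_trans_apply vec[OF k e(1) l e(2)])
qed

lemma Fi_equiv:
  assumes "k \<in> idx B" "l \<in> idx B" "proj B e \<in> chart_dom B k" "proj B e \<in> chart_dom B l"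
  shows "Fi l (proj B e) (triv B l e) (gen_trans WM k l (proj B e) c)
    = gen_trans (jac TX) k l e (Fi k (proj B e) (triv B k e) c)"
  using arg_cong[OF Fc_equiv[OF assms, of "Fi k (proj B e) (triv B k e) c"],
      of "Fi l (proj B e) (triv B l e)"]
  by (simp add: Fi_Fc Fc_Fi)

lemma J_equiv:
  assumes "k \<in> idx B" "l \<in> idx B" "proj B e \<in> chart_dom B k" "proj B e \<in> chart_dom B l"
  shows "J l e (gen_trans (jac TX) k l e a) = gen_trans (jac TX) k l e (J k e a)"
  by (simp add: J_eq[OF assms(2,4)] J_eq[OF assms(1,3)] Fc_equiv[OF assms] J0_equiv[OF assms]
      Fi_equiv[OF assms])

lemma lift0_equiv:
  assumes k: "k \<in> idx B" and l: "l \<in> idx B" and e: "proj B e \<in> chart_dom B k" "proj B e \<in> chart_dom B l"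
  shows "lift0 l (proj B e) (triv B l e) (gen_trans (vtrans B) k l (proj B e) c)
    = gen_trans (jac TX) k l e (lift0 k (proj B e) (triv B k e) c)"
proof -
  let ?p = "proj B e"
  note lv = linear_vtrans[OF l k e(2,1)] and lj = base.linear_jac[OF l k e(2,1)]
  have "adjoint (WM l k ?p) (- snd c, 0) = (- adjoint (vtrans B l k ?p) (snd c), 0)"
    unfolding sum_trans_def adjoint_map_prod[OF lv lj]
    by (simp add: linear_neg[OF adjoint_linear[OF lv]] linear_0[OF adjoint_linear[OF lj]])
  then have "gen_trans WM k l ?p ((fst c, 0), (- snd c, 0))
      = ((vtrans B k l ?p (fst c), 0), (- adjoint (vtrans B l k ?p) (snd c), 0))"
    by (simp add: gen_trans_apply sum_trans_def[of "vtrans B" "jac B" k]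
        linear_0[OF base.linear_jac[OF k l e]])
  then show ?thesis
    unfolding lift0_Fi[OF l e(2)] lift0_Fi[OF k e(1)] Fi_equiv[OF k l e, symmetric]
    by (simp add: gen_trans_apply)
qed

section \<open>Smoothness on the total space\<close>

lemma open_TX: "k \<in> idx B \<Longrightarrow> open ((coord B k ` chart_dom B k) \<times> (UNIV :: 'f set))"
  using base.open_coord_dom by (simp add: open_Times)

lemma smooth_con_TX:
  assumes k: "k \<in> idx B"
  shows "smooth_on ((coord B k ` chart_dom B k) \<times> UNIV) (\<lambda>z. \<omega> k (par B k (fst z)) w (snd z))"
proof (rule smooth_on_apply[where L = "\<lambda>z. \<omega> k (par B k (fst z)) w" and g = snd, OF open_TX[OF k]])
  show "linear (\<omega> k (par B k (fst z)) w)" if "z \<in> (coord B k ` chart_dom B k) \<times> (UNIV :: 'f set)" for z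
    using that base.coord_par(2)[OF k] by (intro linear_con(1)[OF k]) auto
  show "smooth_on ((coord B k ` chart_dom B k) \<times> (UNIV :: 'f set)) (\<lambda>z. \<omega> k (par B k (fst z)) w b)" for b
    by (rule smooth_comp_fst[OF base.open_coord_dom[OF k] smooth_con[OF k]])
  show "smooth_on ((coord B k ` chart_dom B k) \<times> (UNIV :: 'f set)) snd"
    using smooth_on_snd[OF open_TX[OF k] smooth_on_ident[OF open_TX[OF k]]] .
qed

lemma smooth_Fc_Fi:
  assumes k: "k \<in> idx B"
  shows "smooth_on ((coord B k ` chart_dom B k) \<times> UNIV) (\<lambda>z. Fc k (par B k (fst z)) (snd z) a)"
    and "smooth_on ((coord B k ` chart_dom B k) \<times> UNIV) (\<lambda>z. Fi k (par B k (fst z)) (snd z) c)"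
proof -
  let ?S = "(coord B k ` chart_dom B k) \<times> (UNIV :: 'f set)"
  note S = open_TX[OF k]
  have adj: "smooth_on ?S (\<lambda>z. adjoint (\<lambda>x. \<omega> k (par B k (fst z)) x (snd z)) f)" for f
  proof (rule smooth_on_adjoint[OF S _ smooth_con_TX[OF k] smooth_on_const])
    show "linear (\<lambda>x. \<omega> k (par B k (fst z)) x (snd z))" if "z \<in> ?S" for z
      using that base.coord_par(2)[OF k] by (intro linear_con(2)[OF k]) auto
  qed
  show "smooth_on ?S (\<lambda>z. Fc k (par B k (fst z)) (snd z) a)"
    unfolding Fc_def
    by (intro smooth_on_Pair[OF S] smooth_on_add[OF S] smooth_on_diff[OF S] smooth_on_const
        smooth_con_TX[OF k] adj)
  show "smooth_on ?S (\<lambda>z. Fi k (par B k (fst z)) (snd z) c)"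
    unfolding Fi_def
    by (intro smooth_on_Pair[OF S] smooth_on_add[OF S] smooth_on_diff[OF S] smooth_on_const
        smooth_con_TX[OF k] adj)
qed

lemma smooth_J:
  assumes k: "k \<in> idx B"
  shows "smooth_on ((coord B k ` chart_dom B k) \<times> UNIV) (\<lambda>z. J k (par TX k z) a)"
proof -
  let ?S = "(coord B k ` chart_dom B k) \<times> (UNIV :: 'f set)"
  note S = open_TX[OF k]
  have par: "par B k (fst z) \<in> chart_dom B k" if "z \<in> ?S" for z
    using that base.coord_par(2)[OF k] by auto
  have 1: "smooth_on ?S (\<lambda>z. J\<^sub>0 k (par B k (fst z)) (Fc k (par B k (fst z)) (snd z) a))"
    by (rule smooth_on_apply[where L = "\<lambda>z. J\<^sub>0 k (par B k (fst z))", OF S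
        J0_props(1)[OF k par] smooth_comp_fst[OF base.open_coord_dom[OF k] smooth_J0[OF k]]
        smooth_Fc_Fi(1)[OF k]])
  have "smooth_on ?S (\<lambda>z. Fi k (par B k (fst z)) (snd z)
      (J\<^sub>0 k (par B k (fst z)) (Fc k (par B k (fst z)) (snd z) a)))"
    by (rule smooth_on_apply[where L = "\<lambda>z. Fi k (par B k (fst z)) (snd z)", OF S
        linear_Fi[OF k par] smooth_Fc_Fi(2)[OF k] 1])
  then show ?thesis
  proof (rule smooth_on_cong[OF S])
    fix z assume z: "z \<in> ?S"
    obtain x y where xy: "z = (x, y)" by fastforce
    have x: "x \<in> coord B k ` chart_dom B k" using z xy by auto
    have "proj B (par TX k z) \<in> chart_dom B k"
      using par[OF z] proj_par_TX[OF k x] by (simp add: xy)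
    from J_eq[OF k this]
    show "Fi k (par B k (fst z)) (snd z) (J\<^sub>0 k (par B k (fst z)) (Fc k (par B k (fst z)) (snd z) a))
        = J k (par TX k z) a"
      by (simp add: xy proj_par_TX[OF k x] triv_par_TX[OF k x])
  qed
qed

end

section \<open>Courant brackets of lifts\<close>

text \<open>
  With \<open>Q\<close> the derivative of a section \<open>t\<close>, this is the part of the Courant bracket of \<open>a\<close> and \<open>t\<close>
  that differentiates \<open>t\<close>.
\<close>

definition dorfman :: "('e::euclidean_space \<Rightarrow> 'e \<times> 'e) \<Rightarrow> 'e \<times> 'e \<Rightarrow> 'e \<times> 'e" where
  "dorfman Q a = Q (fst a) + (0, \<Sum>b\<in>Basis. pairing a (Q b) *\<^sub>R b)"

lemma fst_dorfman: "fst (dorfman Q a) = fst (Q (fst a))"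
  by (simp add: dorfman_def)

lemma snd_dorfman_Basis:
  "b \<in> Basis \<Longrightarrow> snd (dorfman Q a) \<bullet> b = snd (Q (fst a)) \<bullet> b + pairing a (Q b)"
  by (simp add: dorfman_def inner_add_left)

lemma d_loc_inner: "b \<in> Basis \<Longrightarrow> d_loc f u \<bullet> b = frechet_derivative f (at u) b"
  by (simp add: d_loc_def)

text \<open>The two Lie derivatives contribute \<eta> dX - \<xi> dY in full. The term 1/2 d removes
  half of this and supplies the same amount of d\<xi> Y - d\<eta> X, and the resulting half sums are
  exactly values of \<open>pairing\<close>.\<close>

lemma courant_loc_eq:
  assumes s: "(s has_derivative P) (at u)" and t: "(t has_derivative Q) (at u)"
  shows "courant_loc s t u = dorfman Q (s u) - dorfman P (t u)"
proof -
  have 1: "frechet_derivative (fst \<circ> s) (at u) = (\<lambda>w. fst (P w))"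
    "frechet_derivative (snd \<circ> s) (at u) = (\<lambda>w. snd (P w))"
    "frechet_derivative (fst \<circ> t) (at u) = (\<lambda>w. fst (Q w))"
    "frechet_derivative (snd \<circ> t) (at u) = (\<lambda>w. snd (Q w))"
    unfolding comp_def by (intro frechet_derivative_eqI has_derivative_fst has_derivative_snd s t)+
  have lin: "linear P" "linear Q"
    using s t by (auto intro: has_derivative_linear)
  have lin': "linear (\<lambda>w. fst (P w))" "linear (\<lambda>w. fst (Q w))"
    using linear_compose[OF lin(1) linear_fst] linear_compose[OF lin(2) linear_fst]
    by (simp_all add: comp_def)
  have 2: "frechet_derivative (\<lambda>z. snd (s z) \<bullet> fst (t z) - snd (t z) \<bullet> fst (s z)) (at u)
      = (\<lambda>w. (snd (s u) \<bullet> fst (Q w) + snd (P w) \<bullet> fst (t u))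
          - (snd (t u) \<bullet> fst (P w) + snd (Q w) \<bullet> fst (s u)))"
    by (intro frechet_derivative_eqI has_derivative_diff has_derivative_inner
        has_derivative_fst has_derivative_snd s t)
  have "snd (courant_loc s t u) = snd (dorfman Q (s u) - dorfman P (t u))"
  proof (rule euclidean_eqI)
    fix b :: 'a assume b: "b \<in> Basis"
    have "snd (courant_loc s t u) \<bullet> b
        = (snd (Q (fst (s u))) \<bullet> b + snd (t u) \<bullet> fst (P b)) - (snd (P (fst (t u))) \<bullet> b + snd (s u) \<bullet> fst (Q b))
          + 1/2 * ((snd (s u) \<bullet> fst (Q b) + snd (P b) \<bullet> fst (t u))
            - (snd (t u) \<bullet> fst (P b) + snd (Q b) \<bullet> fst (s u)))"
      by (simp add: courant_loc_def Let_def lie_form_loc_def 1 2[unfolded fun_eq_iff] inner_add_left inner_diff_left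
          d_loc_inner[OF b] adjoint_clauses[OF lin'(1)] adjoint_clauses[OF lin'(2)])
    also have "\<dots> = snd (dorfman Q (s u) - dorfman P (t u)) \<bullet> b"
      by (simp add: snd_dorfman_Basis[OF b] inner_diff_left pairing_def) (simp add: inner_commute field_simps)
    finally show "snd (courant_loc s t u) \<bullet> b = snd (dorfman Q (s u) - dorfman P (t u)) \<bullet> b" .
  qed
  moreover have "fst (courant_loc s t u) = fst (dorfman Q (s u) - dorfman P (t u))"
    by (simp add: courant_loc_def Let_def lie_bracket_loc_def 1 dorfman_def)
  ultimately show ?thesis
    by (simp add: prod_eq_iff)
qed

text \<open>The basis sum represents the functional w |-> \<open>pairing a (Q w)\<close>. Arbitrary
  \<open>w\<close> is needed because the base component of a basis vector of the total space may be
  0.\<close>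

lemma snd_dorfman:
  assumes "linear Q"
  shows "snd (dorfman Q a) \<bullet> w = snd (Q (fst a)) \<bullet> w + pairing a (Q w)"
proof -
  have "linear (\<lambda>w. pairing a (Q w))"
    by (rule linearI) (simp_all add: linear_add[OF assms] linear_cmul[OF assms]
        pairing_add_right pairing_scaleR_right)
  then have e: "pairing a (Q w) = (\<Sum>b\<in>Basis. (w \<bullet> b) *\<^sub>R pairing a (Q b))"
    by (rule linear_Basis_expand)
  have "(\<Sum>b\<in>Basis. pairing a (Q b) *\<^sub>R b) \<bullet> w = pairing a (Q w)"
    by (subst e) (simp add: inner_sum_left inner_sum_right inner_commute[of _ w] mult.commute)
  then show ?thesis
    by (simp add: dorfman_def inner_add_left)
qed

lemma dorfman_add_left: "dorfman (\<lambda>w. P w + Q w) a = dorfman P a + dorfman Q a"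
  by (simp add: dorfman_def pairing_add_right scaleR_add_left sum.distrib)

lemma dorfman_minus_left: "dorfman (\<lambda>w. - P w) a = - dorfman P a"
  by (simp add: dorfman_def pairing_minus_right sum_negf)

lemma dorfman_add_right: "linear Q \<Longrightarrow> dorfman Q (a + b) = dorfman Q a + dorfman Q b"
  by (simp add: dorfman_def linear_add pairing_add_left scaleR_add_left sum.distrib)

lemma dorfman_minus_right: "linear Q \<Longrightarrow> dorfman Q (- a) = - dorfman Q a"
  by (simp add: dorfman_def linear_neg pairing_minus_left sum_negf)

lemma dorfman_diff_left: "dorfman (\<lambda>w. P w - Q w) a = dorfman P a - dorfman Q a"
  using dorfman_add_left[of P "\<lambda>w. - Q w" a] by (simp add: dorfman_minus_left)

lemma dorfman_diff_right: "linear Q \<Longrightarrow> dorfman Q (a - b) = dorfman Q a - dorfman Q b"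
  using dorfman_add_right[of Q a "- b"] by (simp add: dorfman_minus_right)

lemma has_derivative_comp_fst:
  assumes "(g has_derivative g') (at x)"
  shows "((\<lambda>z. g (fst z)) has_derivative (\<lambda>h. g' (fst h))) (at (x, y))"
  by (rule has_derivative_compose[OF has_derivative_fst[OF has_derivative_ident]])
     (simp add: assms)

section \<open>Derivatives and brackets of lifts in an arbitrary frame\<close>

context semi_flat_bundle
begin

text \<open>The derivative, at base point and fibre component, of the lift of a parallel
  \<open>c\<close>: minus the connection form applied to \<open>c\<close> has been substituted for
  the derivative of \<open>c\<close>.\<close>

definition dlift0 :: "'k \<Rightarrow> 'p \<Rightarrow> 'f \<Rightarrow> 'f \<times> 'f \<Rightarrow> 'e \<times> 'f \<Rightarrow> ('e \<times> 'f) \<times> ('e \<times> 'f)" where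
  "dlift0 k p y c h = ((0, - \<omega> k p (fst h) (fst c)),
     (- (adjoint (\<lambda>a. dcon k p a y (fst h) + \<omega> k p a (snd h)) (snd c)
        + adjoint (\<lambda>a. \<omega> k p a y) (adjoint (\<omega> k p (fst h)) (snd c))),
      - adjoint (\<omega> k p (fst h)) (snd c)))"

definition dlift1 :: "'k \<Rightarrow> 'p \<Rightarrow> 'f \<Rightarrow> 'e \<times> 'e \<Rightarrow> ('e \<Rightarrow> 'e \<times> 'e) \<Rightarrow> 'e \<times> 'f
    \<Rightarrow> ('e \<times> 'f) \<times> ('e \<times> 'f)" where
  "dlift1 k p y m D h = ((fst (D (fst h)), - (dcon k p (fst m) y (fst h) + \<omega> k p (fst m) (snd h)
        + \<omega> k p (fst (D (fst h))) y)),
      (snd (D (fst h)), 0))"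

context
  fixes k :: 'k and p :: 'p and y :: 'f
  assumes k: "k \<in> idx B" and p: "p \<in> chart_dom B k"
begin

lemma linear_dcon_con: "linear (\<lambda>a. dcon k p a y' w + \<omega> k p a u)"
  by (rule linearI) (simp_all add: linear_add[OF linear_dcon(2)[OF k p]] linear_add[OF linear_con(2)[OF k p]]
      linear_cmul[OF linear_dcon(2)[OF k p]] linear_cmul[OF linear_con(2)[OF k p]] scaleR_add_right)

lemmas lift_rules = linear_0[OF linear_con(1)[OF k p]] linear_0[OF linear_con(2)[OF k p]]
  linear_add[OF linear_con(1)[OF k p]] linear_add[OF linear_con(2)[OF k p]]
  linear_diff[OF linear_con(2)[OF k p]]
  linear_neg[OF linear_con(1)[OF k p]] linear_neg[OF linear_con(2)[OF k p]]
  linear_0[OF linear_dcon(1)[OF k p]] linear_0[OF linear_dcon(2)[OF k p]] linear_0[OF linear_dcon(3)[OF k p]]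
  adjoint_clauses[OF linear_con(1)[OF k p]] adjoint_clauses[OF linear_con(2)[OF k p]]
  adjoint_clauses[OF linear_dcon_con]

text \<open>Pairing with test vectors moves all adjoints to the other side, which leaves expressions
  in the connection form that can be compared termwise.\<close>

lemma dlift0_inner:
  "fst (snd (dlift0 k p y c h)) \<bullet> a
    = - (snd c \<bullet> dcon k p a y (fst h) + snd c \<bullet> \<omega> k p a (snd h) + snd c \<bullet> \<omega> k p (fst h) (\<omega> k p a y))"
  "snd (snd (dlift0 k p y c h)) \<bullet> u = - (snd c \<bullet> \<omega> k p (fst h) u)"
  "fst (dlift0 k p y c h) = (0, - \<omega> k p (fst h) (fst c))"
  by (simp_all add: dlift0_def inner_add_left inner_diff_left inner_add_right lift_rules)

lemma lift0_inner:
  "fst (snd (lift0 k p y c)) \<bullet> a = - (snd c \<bullet> \<omega> k p a y)"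
  "snd (snd (lift0 k p y c)) \<bullet> u = - (snd c \<bullet> u)"
  "fst (lift0 k p y c) = (0, fst c)"
  by (simp_all add: lift0_def lift_rules)

text \<open>In a flat frame \<open>lift0\<close> of a parallel section is constant, and
  \<open>lift1\<close> is a pair of a field and a form pulled back from the base, so all three
  bracket formulas are evident there. They are verified here in an arbitrary frame.\<close>

lemma dorfman_lift0_lift0:
  "dorfman (dlift0 k p y d) (lift0 k p y c) - dorfman (dlift0 k p y c) (lift0 k p y d) = 0"
proof -
  have "snd (dorfman (dlift0 k p y d) (lift0 k p y c) - dorfman (dlift0 k p y c) (lift0 k p y d)) \<bullet> b = 0"
    if b: "b \<in> Basis" for b
    unfolding snd_diff inner_diff_left snd_dorfman_Basis[OF b]
    by (simp add: dlift0_inner lift0_inner pairing_def inner_prod_def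
        inner_add_left inner_add_right inner_diff_right lift_rules)
      (simp add: inner_commute field_simps)
  then have "snd (dorfman (dlift0 k p y d) (lift0 k p y c) - dorfman (dlift0 k p y c) (lift0 k p y d)) = 0"
    by (intro euclidean_eqI[where y = 0]) (simp only: inner_zero_left)
  moreover have "fst (dorfman (dlift0 k p y d) (lift0 k p y c) - dorfman (dlift0 k p y c) (lift0 k p y d)) = 0"
    by (simp add: fst_dorfman dlift0_def lift0_def lift_rules zero_prod_def)
  ultimately show ?thesis
    by (simp add: prod_eq_iff)
qed

text \<open>Flatness enters the bracket computations here. With a horizontal lift involved, the
  derivative of the connection form occurs with two directions exchanged: in the covector part for
  \<open>lift0\<close> with \<open>lift1\<close>, in the vertical part for two
  \<open>lift1\<close>.\<close>

lemma curvature_swap: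
  "dcon k p a v w = dcon k p w v a + \<omega> k p a (\<omega> k p w v) - \<omega> k p w (\<omega> k p a v)"
  using curvature_0[OF k p, of a v w] by (simp add: algebra_simps)

lemma dorfman_lift0_lift1:
  assumes D: "linear D"
  shows "dorfman (dlift1 k p y m D) (lift0 k p y c) - dorfman (dlift0 k p y c) (lift1 k p y m) = 0"
    (is "?l = 0")
proof -
  have "snd ?l \<bullet> b = 0" if b: "b \<in> Basis" for b
  proof -
    have cs: "snd c \<bullet> dcon k p (fst b) y (fst m) = snd c \<bullet> dcon k p (fst m) y (fst b)
        + snd c \<bullet> \<omega> k p (fst b) (\<omega> k p (fst m) y) - snd c \<bullet> \<omega> k p (fst m) (\<omega> k p (fst b) y)"
      by (subst curvature_swap) (simp add: inner_add_right inner_diff_right)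
    show ?thesis
      unfolding snd_diff inner_diff_left snd_dorfman_Basis[OF b]
      by (simp add: dlift0_inner dlift1_def lift0_inner lift1_def
          pairing_def inner_prod_def linear_0[OF D]
          inner_add_left inner_add_right inner_diff_right lift_rules)
        (simp add: cs inner_commute[of _ "snd c"] field_simps)
  qed
  then have "snd ?l = 0"
    by (intro euclidean_eqI[where y = 0]) (simp only: inner_zero_left)
  moreover have "fst ?l = 0"
    by (simp add: fst_dorfman dlift0_def dlift1_def lift0_def lift1_def linear_0[OF D] lift_rules
        zero_prod_def)
  ultimately show ?thesis
    by (simp add: prod_eq_iff)
qed

lemma dorfman_lift1_lift1:
  assumes D: "linear D" and D': "linear D'"
  shows "dorfman (dlift1 k p y n D') (lift1 k p y m) - dorfman (dlift1 k p y m D) (lift1 k p y n)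
    = lift1 k p y (dorfman D' m - dorfman D n)" (is "?l = ?r")
proof -
  have "snd ?l \<bullet> b = snd ?r \<bullet> b" if b: "b \<in> Basis" for b
    unfolding snd_diff inner_diff_left snd_dorfman_Basis[OF b]
    by (simp add: inner_diff_left snd_dorfman[OF D] snd_dorfman[OF D'] dlift1_def lift1_def
        pairing_def inner_prod_def)
  then have "snd ?l = snd ?r"
    by (rule euclidean_eqI)
  moreover have "fst ?l = fst ?r"
    using curvature_swap[of "fst n" y "fst m"]
    by (simp add: fst_dorfman dlift1_def lift1_def lift_rules algebra_simps)
  ultimately show ?thesis
    by (simp add: prod_eq_iff)
qed

lemma con_deriv_TX:
  "((\<lambda>z. \<omega> k (par B k (fst z)) a (snd z)) has_derivative
    (\<lambda>h. dcon k p a y (fst h) + \<omega> k p a (snd h))) (at (coord B k p, y))"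
proof -
  let ?S = "(coord B k ` chart_dom B k) \<times> (UNIV :: 'f set)"
  have z: "(coord B k p, y) \<in> ?S" using p by simp
  have d: "((\<lambda>z. \<omega> k (par B k (fst z)) a v) has_derivative (\<lambda>h. dcon k p a v (fst h)))
      (at (coord B k p, y))" for v
    by (rule has_derivative_comp_fst[OF dcon[OF k p]])
  have l: "linear (\<omega> k (par B k (fst z)) a)" if "z \<in> ?S" for z
    using that base.coord_par(2)[OF k] by (intro linear_con(1)[OF k]) auto
  have "(snd has_derivative snd) (at (coord B k p, y))"
    by (rule has_derivative_snd[OF has_derivative_ident])
  from has_derivative_apply[where L = "\<lambda>z. \<omega> k (par B k (fst z)) a", OF open_TX[OF k] z l d this]
  show ?thesis
    by (simp add: base.par_coord[OF k p])
qed

lemma deriv_lift0: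
  assumes c: "((\<lambda>u. c (par B k u)) has_derivative (\<lambda>w. - gen_connection \<omega> k p w (c p))) (at (coord B k p))"
  shows "((\<lambda>z. lift0 k (par B k (fst z)) (snd z) (c (par B k (fst z)))) has_derivative
    dlift0 k p y (c p)) (at (coord B k p, y))"
proof -
  let ?S = "(coord B k ` chart_dom B k) \<times> (UNIV :: 'f set)"
  let ?z = "(coord B k p, y)"
  have z: "?z \<in> ?S" using p by simp
  have "((\<lambda>z. c (par B k (fst z))) has_derivative (\<lambda>h. - gen_connection \<omega> k p (fst h) (c p))) (at ?z)"
    by (rule has_derivative_comp_fst[OF c])
  from has_derivative_fst[OF this] has_derivative_snd[OF this]
  have c1: "((\<lambda>z. fst (c (par B k (fst z)))) has_derivative (\<lambda>h. - \<omega> k p (fst h) (fst (c p)))) (at ?z)"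
    and c2: "((\<lambda>z. snd (c (par B k (fst z)))) has_derivative (\<lambda>h. adjoint (\<omega> k p (fst h)) (snd (c p)))) (at ?z)"
    by (simp_all add: gen_connection_apply)
  have l: "linear (\<lambda>a. \<omega> k (par B k (fst z)) a (snd z))" if "z \<in> ?S" for z
    using that base.coord_par(2)[OF k] by (intro linear_con(2)[OF k]) auto
  have a: "((\<lambda>z. adjoint (\<lambda>a. \<omega> k (par B k (fst z)) a (snd z)) f) has_derivative
      (\<lambda>h. adjoint (\<lambda>a. dcon k p a y (fst h) + \<omega> k p a (snd h)) f)) (at ?z)" for f
    by (rule has_derivative_adjoint[OF open_TX[OF k] z l con_deriv_TX])
  have "((\<lambda>z. adjoint (\<lambda>a. \<omega> k (par B k (fst z)) a (snd z)) (snd (c (par B k (fst z))))) has_derivative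
      (\<lambda>h. adjoint (\<lambda>a. dcon k p a y (fst h) + \<omega> k p a (snd h)) (snd (c p))
        + adjoint (\<lambda>a. \<omega> k p a y) (adjoint (\<omega> k p (fst h)) (snd (c p))))) (at ?z)"
    using has_derivative_apply[where L = "\<lambda>z. adjoint (\<lambda>a. \<omega> k (par B k (fst z)) a (snd z))",
        OF open_TX[OF k] z adjoint_linear[OF l] a c2]
    by (simp add: base.par_coord[OF k p])
  from has_derivative_Pair[OF has_derivative_Pair[OF has_derivative_const c1]
      has_derivative_Pair[OF has_derivative_minus[OF this] has_derivative_minus[OF c2]]]
  show ?thesis
    unfolding lift0_def dlift0_def[abs_def] .
qed

lemma deriv_lift1:
  assumes m: "((\<lambda>u. m (par B k u)) has_derivative D) (at (coord B k p))"
  shows "((\<lambda>z. lift1 k (par B k (fst z)) (snd z) (m (par B k (fst z)))) has_derivative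
    dlift1 k p y (m p) D) (at (coord B k p, y))"
proof -
  let ?S = "(coord B k ` chart_dom B k) \<times> (UNIV :: 'f set)"
  let ?z = "(coord B k p, y)"
  have z: "?z \<in> ?S" using p by simp
  have d: "((\<lambda>z. m (par B k (fst z))) has_derivative (\<lambda>h. D (fst h))) (at ?z)"
    by (rule has_derivative_comp_fst[OF m])
  note m1 = has_derivative_fst[OF d] and m2 = has_derivative_snd[OF d]
  have l: "linear (\<lambda>a. \<omega> k (par B k (fst z)) a (snd z))" if "z \<in> ?S" for z
    using that base.coord_par(2)[OF k] by (intro linear_con(2)[OF k]) auto
  have "((\<lambda>z. \<omega> k (par B k (fst z)) (fst (m (par B k (fst z)))) (snd z)) has_derivative
      (\<lambda>h. dcon k p (fst (m p)) y (fst h) + \<omega> k p (fst (m p)) (snd h) + \<omega> k p (fst (D (fst h))) y)) (at ?z)"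
    using has_derivative_apply[where L = "\<lambda>z a. \<omega> k (par B k (fst z)) a (snd z)",
        OF open_TX[OF k] z l con_deriv_TX m1]
    by (simp add: base.par_coord[OF k p])
  from has_derivative_Pair[OF has_derivative_Pair[OF m1 has_derivative_minus[OF this]]
      has_derivative_Pair[OF m2 has_derivative_const]]
  show ?thesis
    unfolding lift1_def dlift1_def[abs_def] .
qed

end

end

section \<open>Integrability\<close>

lemma smooth_on_pairing:
  assumes S: "open S" and f: "smooth_on S f" and g: "smooth_on S g"
  shows "smooth_on S (\<lambda>x. pairing (f x) (g x))"
proof -
  have "smooth_on S (\<lambda>x. (- (1/2)) *\<^sub>R (snd (f x) \<bullet> fst (g x) + snd (g x) \<bullet> fst (f x)))"
    by (intro smooth_on_scaleR[OF S smooth_on_const] smooth_on_add[OF S] smooth_on_inner[OF S]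
        smooth_on_fst[OF S] smooth_on_snd[OF S] f g)
  then show ?thesis
    by (simp add: pairing_def)
qed

lemma smooth_courant_loc:
  assumes S: "open S" and s: "smooth_on S s" and t: "smooth_on S t"
  shows "smooth_on S (courant_loc s t)"
proof -
  have lin: "linear (frechet_derivative f (at u))" if "smooth_on S f" "u \<in> S" for f :: "'a \<Rightarrow> 'a \<times> 'a" and u
    using smooth_on_has_derivative[OF that] by (rule has_derivative_linear)
  have d: "smooth_on S (\<lambda>u. dorfman (frechet_derivative f (at u)) (g u))"
    if f: "smooth_on S f" and g: "smooth_on S g" for f g :: "'a \<Rightarrow> 'a \<times> 'a"
    unfolding dorfman_def
    by (intro smooth_on_add[OF S] smooth_on_Pair[OF S] smooth_on_sum[OF S] smooth_on_scaleR[OF S]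
        smooth_on_const smooth_on_pairing[OF S g smooth_on_frechet[OF f]]
        smooth_on_apply[OF S lin[OF f] smooth_on_frechet[OF f] smooth_on_fst[OF S g]])
  have "smooth_on S (\<lambda>u. dorfman (frechet_derivative t (at u)) (s u) - dorfman (frechet_derivative s (at u)) (t u))"
    by (intro smooth_on_diff[OF S] d s t)
  then show ?thesis
    by (rule smooth_on_cong[OF S])
       (rule courant_loc_eq[OF smooth_on_has_derivative[OF s] smooth_on_has_derivative[OF t], symmetric])
qed

context charts
begin

lemma courant_eq:
  assumes k: "k \<in> idx A" and p: "p \<in> chart_dom A k"
    and s: "((\<lambda>u. s k (par A k u)) has_derivative P) (at (coord A k p))"
    and t: "((\<lambda>u. t k (par A k u)) has_derivative Q) (at (coord A k p))"
  shows "courant A s t k p = dorfman Q (s k p) - dorfman P (t k p)"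
  using courant_loc_eq[OF s t] by (simp add: courant_def comp_def par_coord[OF k p])

lemma gen_jac_linear:
  assumes "k \<in> idx A" "l \<in> idx A" "p \<in> chart_dom A k" "p \<in> chart_dom A l"
  shows "linear (gen_trans (jac A) k l p)"
  unfolding sum_trans_def dual_trans_def
  by (intro linear_map_prod linear_jac adjoint_linear assms)

lemma continuous_gen_jac:
  assumes k: "k \<in> idx A" and l: "l \<in> idx A"
  shows "continuous_on (coord A l ` (chart_dom A l \<inter> chart_dom A k)) (\<lambda>u. gen_trans (jac A) k l (par A l u) c)"
proof -
  let ?S = "coord A l ` (chart_dom A l \<inter> chart_dom A k)"
  note S = open_overlap[OF l k]
  have par: "par A l u \<in> chart_dom A l" "par A l u \<in> chart_dom A k" if "u \<in> ?S" for u
    using par_image(2)[OF l that] by auto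
  have "smooth_on ?S (\<lambda>u. adjoint (jac A l k (par A l u)) (snd c))"
    by (rule smooth_on_adjoint[OF S linear_jac[OF l k par] smooth_jac[OF l k] smooth_on_const])
  then have "smooth_on ?S (\<lambda>u. (jac A k l (par A l u) (fst c), adjoint (jac A l k (par A l u)) (snd c)))"
    by (intro smooth_on_Pair[OF S] smooth_jac'[OF l k])
  then show ?thesis
    by (simp add: sum_trans_def dual_trans_def map_prod_def case_prod_unfold smooth_on_imp_continuous_on)
qed

end

context semi_flat_bundle
begin

section \<open>Lifts of flat sections\<close>

definition msec :: "('k \<Rightarrow> 'p \<Rightarrow> 'f \<times> 'f) \<Rightarrow> 'k \<Rightarrow> 'p \<Rightarrow> 'e \<times> 'e" where
  "msec s k p = M_map (J\<^sub>0 k p) (s k p)"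

definition L0 :: "('k \<Rightarrow> 'p \<Rightarrow> 'f \<times> 'f) \<Rightarrow> 'k \<Rightarrow> 'v \<Rightarrow> ('e \<times> 'f) \<times> ('e \<times> 'f)" where
  "L0 s k e = lift0 k (proj B e) (triv B k e) (s k (proj B e))"

definition L1 :: "('k \<Rightarrow> 'p \<Rightarrow> 'f \<times> 'f) \<Rightarrow> 'k \<Rightarrow> 'v \<Rightarrow> ('e \<times> 'f) \<times> ('e \<times> 'f)" where
  "L1 s k e = J k e (L0 s k e)"

definition DL0 :: "('k \<Rightarrow> 'p \<Rightarrow> 'f \<times> 'f) \<Rightarrow> 'k \<Rightarrow> 'v \<Rightarrow> 'e \<times> 'f \<Rightarrow> ('e \<times> 'f) \<times> ('e \<times> 'f)" where
  "DL0 s k e = dlift0 k (proj B e) (triv B k e) (s k (proj B e))"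

definition DL1 :: "('k \<Rightarrow> 'p \<Rightarrow> 'f \<times> 'f) \<Rightarrow> 'k \<Rightarrow> 'v \<Rightarrow> 'e \<times> 'f \<Rightarrow> ('e \<times> 'f) \<times> ('e \<times> 'f)" where
  "DL1 s k e = dlift1 k (proj B e) (triv B k e) (msec s k (proj B e))
     (frechet_derivative (\<lambda>u. msec s k (par B k u)) (at (coord B k (proj B e))))"

lemma L1_eq:
  assumes "k \<in> idx B" "proj B e \<in> chart_dom B k"
  shows "L1 s k e = lift1 k (proj B e) (triv B k e) (msec s k (proj B e))"
  by (simp add: L1_def L0_def msec_def J_lift0[OF assms])

lemma J_L1:
  assumes "k \<in> idx B" "proj B e \<in> chart_dom B k"
  shows "J k e (L1 s k e) = - L0 s k e"
  by (simp add: L1_def J_props(2)[OF assms])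

lemma TX_overlap_image:
  "k \<in> idx B \<Longrightarrow> coord TX k ` (proj B -` W \<inter> chart_dom TX k) = (coord B k ` (W \<inter> chart_dom B k)) \<times> UNIV"
  using TX_image[of k "W \<inter> chart_dom B k"] by (simp add: vimage_Int)

context
  fixes s W
  assumes W: "open W" and s: "s \<in> flat_sections B \<omega> W"
begin

lemma smooth_flat: "k \<in> idx B \<Longrightarrow> smooth_on (coord B k ` (W \<inter> chart_dom B k)) (\<lambda>u. s k (par B k u))"
  using s unfolding flat_sections_def is_section_def by (simp add: comp_def)

lemma flat_trans:
  assumes "k \<in> idx B" "l \<in> idx B" "p \<in> W" "p \<in> chart_dom B k" "p \<in> chart_dom B l"
  shows "s l p = gen_trans (vtrans B) k l p (s k p)"
  using s assms unfolding flat_sections_def is_section_def by blast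

lemma deriv_flat:
  assumes k: "k \<in> idx B" and p: "p \<in> W" "p \<in> chart_dom B k"
  shows "((\<lambda>u. s k (par B k u)) has_derivative (\<lambda>w. - gen_connection \<omega> k p w (s k p))) (at (coord B k p))"
proof -
  have "nabla B (gen_connection \<omega>) s k p w = 0" for w
    using s k p unfolding flat_sections_def by blast
  then have "frechet_derivative (\<lambda>u. s k (par B k u)) (at (coord B k p)) = (\<lambda>w. - gen_connection \<omega> k p w (s k p))"
    by (simp add: nabla_def comp_def fun_eq_iff eq_neg_iff_add_eq_0)
  then show ?thesis
    using smooth_on_has_derivative[OF smooth_flat[OF k], of "coord B k p"] p by simp
qed

lemma smooth_J0_emb:
  assumes k: "k \<in> idx B"
  shows "smooth_on (coord B k ` (W \<inter> chart_dom B k))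
    (\<lambda>u. J\<^sub>0 k (par B k u) ((fst (s k (par B k u)), 0), (- snd (s k (par B k u)), 0)))"
proof (rule smooth_on_apply[where L = "\<lambda>u. J\<^sub>0 k (par B k u)"])
  show S: "open (coord B k ` (W \<inter> chart_dom B k))"
    by (rule base.open_coord_Int[OF k W])
  show "linear (J\<^sub>0 k (par B k u))" if "u \<in> coord B k ` (W \<inter> chart_dom B k)" for u
    using base.par_image(3)[OF k that] by (intro J0_props(1)[OF k]) auto
  show "smooth_on (coord B k ` (W \<inter> chart_dom B k)) (\<lambda>u. J\<^sub>0 k (par B k u) b)" for b
    by (rule smooth_on_subset[OF smooth_J0[OF k]]) auto
  show "smooth_on (coord B k ` (W \<inter> chart_dom B k))
      (\<lambda>u. ((fst (s k (par B k u)), 0), (- snd (s k (par B k u)), 0)))"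
    by (intro smooth_on_Pair[OF S] smooth_on_minus[OF S] smooth_on_fst[OF S] smooth_on_snd[OF S]
        smooth_on_const smooth_flat[OF k])
qed

text \<open>By \<open>M_map_eq\<close> these are two components of \<open>J\<^sub>0\<close> applied
  to a smooth section, so the adjoints of the blocks need not be treated one by one.\<close>

lemma smooth_msec:
  assumes k: "k \<in> idx B"
  shows "smooth_on (coord B k ` (W \<inter> chart_dom B k)) (\<lambda>u. msec s k (par B k u))"
proof -
  let ?S = "coord B k ` (W \<inter> chart_dom B k)"
  have S: "open ?S"
    by (rule base.open_coord_Int[OF k W])
  let ?g = "\<lambda>u. J\<^sub>0 k (par B k u) ((fst (s k (par B k u)), 0), (- snd (s k (par B k u)), 0))"
  have "smooth_on ?S (\<lambda>u. (snd (fst (?g u)), snd (snd (?g u))))"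
    by (intro smooth_on_Pair[OF S] smooth_on_fst[OF S] smooth_on_snd[OF S] smooth_J0_emb[OF k])
  then show ?thesis
  proof (rule smooth_on_cong[OF S])
    fix u assume "u \<in> ?S"
    then have p: "par B k u \<in> chart_dom B k"
      using base.par_image(3)[OF k] by blast
    show "(snd (fst (?g u)), snd (snd (?g u))) = msec s k (par B k u)"
      using M_map_eq[OF J0_props[OF k p], of "fst (s k (par B k u))" "snd (s k (par B k u))"]
      by (simp add: msec_def)
  qed
qed

lemma deriv_msec:
  assumes k: "k \<in> idx B" and p: "p \<in> W" "p \<in> chart_dom B k"
  shows "((\<lambda>u. msec s k (par B k u)) has_derivative
    frechet_derivative (\<lambda>u. msec s k (par B k u)) (at (coord B k p))) (at (coord B k p))"
  by (rule smooth_on_has_derivative[OF smooth_msec[OF k]]) (use p in auto)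

lemma open_TX_W: "k \<in> idx B \<Longrightarrow> open ((coord B k ` (W \<inter> chart_dom B k)) \<times> (UNIV :: 'f set))"
  using base.open_coord_Int[OF _ W] by (simp add: open_Times)

lemma L0_par:
  assumes k: "k \<in> idx B" and z: "z \<in> (coord B k ` (W \<inter> chart_dom B k)) \<times> UNIV"
  shows "L0 s k (par TX k z) = lift0 k (par B k (fst z)) (snd z) (s k (par B k (fst z)))"
    and "L1 s k (par TX k z) = lift1 k (par B k (fst z)) (snd z) (msec s k (par B k (fst z)))"
    and "proj B (par TX k z) \<in> chart_dom B k"
proof -
  obtain x y where xy: "z = (x, y)" by fastforce
  have x: "x \<in> coord B k ` chart_dom B k" using z xy by auto
  show e: "proj B (par TX k z) \<in> chart_dom B k"
    by (simp add: xy proj_par_TX[OF k x] base.coord_par(2)[OF k x])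
  show "L0 s k (par TX k z) = lift0 k (par B k (fst z)) (snd z) (s k (par B k (fst z)))"
    by (simp add: L0_def xy proj_par_TX[OF k x] triv_par_TX[OF k x])
  show "L1 s k (par TX k z) = lift1 k (par B k (fst z)) (snd z) (msec s k (par B k (fst z)))"
    unfolding L1_eq[OF k e] by (simp add: xy proj_par_TX[OF k x] triv_par_TX[OF k x])
qed

lemma deriv_L:
  assumes k: "k \<in> idx B" and e: "proj B e \<in> W" "proj B e \<in> chart_dom B k"
  shows "((\<lambda>z. L0 s k (par TX k z)) has_derivative DL0 s k e) (at (coord TX k e))"
    and "((\<lambda>z. L1 s k (par TX k z)) has_derivative DL1 s k e) (at (coord TX k e))"
proof -
  have z: "coord TX k e \<in> (coord B k ` (W \<inter> chart_dom B k)) \<times> UNIV"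
    using e by auto
  show "((\<lambda>z. L0 s k (par TX k z)) has_derivative DL0 s k e) (at (coord TX k e))"
    unfolding DL0_def
    by (rule has_derivative_transform_within_open[OF _ open_TX_W[OF k] z])
       (use deriv_lift0[where c = "s k", OF k e(2) deriv_flat[OF k e]] L0_par(1)[OF k] in auto)
  show "((\<lambda>z. L1 s k (par TX k z)) has_derivative DL1 s k e) (at (coord TX k e))"
    unfolding DL1_def
    by (rule has_derivative_transform_within_open[OF _ open_TX_W[OF k] z])
       (use deriv_lift1[where m = "msec s k", OF k e(2) deriv_msec[OF k e]] L0_par(2)[OF k] in auto)
qed

lemma linear_DL:
  assumes "k \<in> idx B" "proj B e \<in> W" "proj B e \<in> chart_dom B k"
  shows "linear (DL0 s k e)" "linear (DL1 s k e)"
  using deriv_L[OF assms] by (auto intro: has_derivative_linear)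

lemma L_trans:
  assumes k: "k \<in> idx B" and l: "l \<in> idx B"
    and e: "proj B e \<in> W" "proj B e \<in> chart_dom B k" "proj B e \<in> chart_dom B l"
  shows "L0 s l e = gen_trans (jac TX) k l e (L0 s k e)"
    and "L1 s l e = gen_trans (jac TX) k l e (L1 s k e)"
proof -
  show 0: "L0 s l e = gen_trans (jac TX) k l e (L0 s k e)"
    unfolding L0_def flat_trans[OF k l e] by (rule lift0_equiv[OF k l e(2,3)])
  show "L1 s l e = gen_trans (jac TX) k l e (L1 s k e)"
    unfolding L1_def 0 by (rule J_equiv[OF k l e(2,3)])
qed

lemma smooth_L:
  assumes k: "k \<in> idx B"
  shows "smooth_on ((coord B k ` (W \<inter> chart_dom B k)) \<times> UNIV) (\<lambda>z. L0 s k (par TX k z))"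
    and "smooth_on ((coord B k ` (W \<inter> chart_dom B k)) \<times> UNIV) (\<lambda>z. L1 s k (par TX k z))"
proof -
  let ?S = "(coord B k ` (W \<inter> chart_dom B k)) \<times> (UNIV :: 'f set)"
  note S = open_TX_W[OF k] and S0 = base.open_coord_Int[OF k W]
  have sub: "?S \<subseteq> (coord B k ` chart_dom B k) \<times> UNIV" by auto
  have par: "par B k (fst z) \<in> chart_dom B k" if "z \<in> ?S" for z
    using that base.coord_par(2)[OF k] by auto
  have emb: "smooth_on ?S (\<lambda>z. ((fst (s k (par B k (fst z))), 0), (- snd (s k (par B k (fst z))), 0)))"
    using smooth_comp_fst[OF S0 smooth_flat[OF k]]
    by (intro smooth_on_Pair[OF S] smooth_on_minus[OF S] smooth_on_fst[OF S] smooth_on_snd[OF S]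
        smooth_on_const)
  have "smooth_on ?S (\<lambda>z. Fi k (par B k (fst z)) (snd z)
      ((fst (s k (par B k (fst z))), 0), (- snd (s k (par B k (fst z))), 0)))"
    by (rule smooth_on_apply[where L = "\<lambda>z. Fi k (par B k (fst z)) (snd z)", OF S
        linear_Fi[OF k par] smooth_on_subset[OF smooth_Fc_Fi(2)[OF k] sub] emb])
  then show 0: "smooth_on ?S (\<lambda>z. L0 s k (par TX k z))"
    by (rule smooth_on_cong[OF S]) (simp add: L0_par(1)[OF k] lift0_Fi[OF k par])
  show "smooth_on ?S (\<lambda>z. L1 s k (par TX k z))"
    unfolding L1_def
    by (rule smooth_on_apply[where L = "\<lambda>z. J k (par TX k z)", OF S
        J_props(1)[OF k L0_par(3)[OF k]] smooth_on_subset[OF smooth_J[OF k] sub] 0])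
qed

lemma eigen_lift: "eigen_section TX J (proj B -` W) (\<lambda>k e. (L0 s k e, - L1 s k e))"
  unfolding eigen_section_def is_section_def
proof (intro conjI ballI)
  fix k assume "k \<in> idx TX"
  then have k: "k \<in> idx B" by simp
  show "smooth_on (coord TX k ` (proj B -` W \<inter> chart_dom TX k)) ((\<lambda>e. (L0 s k e, - L1 s k e)) \<circ> par TX k)"
    unfolding TX_overlap_image[OF k] comp_def
    by (intro smooth_on_Pair smooth_on_minus smooth_L[OF k] open_TX_W[OF k])
next
  fix k l e assume "k \<in> idx TX" "l \<in> idx TX" "e \<in> proj B -` W \<inter> chart_dom TX k \<inter> chart_dom TX l"
  then have h: "k \<in> idx B" "l \<in> idx B" "proj B e \<in> W" "proj B e \<in> chart_dom B k" "proj B e \<in> chart_dom B l"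
    by auto
  have "linear (gen_trans (jac TX) k l e)"
    using h by (intro total.gen_jac_linear) auto
  then show "(L0 s l e, - L1 s l e)
      = sum_trans (gen_trans (jac TX)) (gen_trans (jac TX)) k l e (L0 s k e, - L1 s k e)"
    using L_trans[OF h] by (simp add: sum_trans_def[of "gen_trans (jac TX)"] linear_neg)
next
  fix k e assume "k \<in> idx TX" "e \<in> proj B -` W \<inter> chart_dom TX k"
  then have h: "k \<in> idx B" "proj B e \<in> chart_dom B k" by auto
  show "map_prod (J k e) (J k e) (L0 s k e, - L1 s k e)
      = (- snd (L0 s k e, - L1 s k e), fst (L0 s k e, - L1 s k e))"
    by (simp add: L1_def linear_neg[OF J_props(1)[OF h]] J_props(2)[OF h])
qed

end

text \<open>Two neighbourhoods are kept apart because the two eigensections of a bracket are later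
  expanded independently near the same point.\<close>

context
  fixes s t W W' k e
  assumes W: "open W" and s: "s \<in> flat_sections B \<omega> W"
    and W': "open W'" and t: "t \<in> flat_sections B \<omega> W'"
    and k: "k \<in> idx B" and e: "proj B e \<in> W" "proj B e \<in> W'" "proj B e \<in> chart_dom B k"
begin

lemma dorfman_L00: "dorfman (DL0 t k e) (L0 s k e) = dorfman (DL0 s k e) (L0 t k e)"
  using dorfman_lift0_lift0[OF k e(3)] unfolding DL0_def L0_def by simp

lemma dorfman_L01: "dorfman (DL1 t k e) (L0 s k e) = dorfman (DL0 s k e) (L1 t k e)"
  using dorfman_lift0_lift1[OF k e(3) has_derivative_linear[OF deriv_msec[OF W' t k e(2,3)]]]
  unfolding DL0_def L0_def DL1_def L1_eq[OF k e(3)] by simp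

lemma dorfman_L11:
  "dorfman (DL1 t k e) (L1 s k e) - dorfman (DL1 s k e) (L1 t k e)
    = lift1 k (proj B e) (triv B k e) (courant B (msec s) (msec t) k (proj B e))"
  unfolding DL1_def L1_eq[OF k e(3)]
    base.courant_eq[where s = "msec s" and t = "msec t", OF k e(3) deriv_msec[OF W s k e(1,3)] deriv_msec[OF W' t k e(2,3)]]
  by (rule dorfman_lift1_lift1[OF k e(3) has_derivative_linear[OF deriv_msec[OF W s k e(1,3)]]
      has_derivative_linear[OF deriv_msec[OF W' t k e(2,3)]]])

end

section \<open>Integrability forces the brackets on the base to vanish\<close>

lemma lift1_eq_0:
  assumes "lift1 k p y m = 0"
  shows "m = 0"
  using assms by (cases m) (simp add: lift1_def zero_prod_def)

lemma courant_msec_0: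
  assumes int: "integrable_gacs TX J" and W: "open W"
    and s: "s \<in> flat_sections B \<omega> W" and t: "t \<in> flat_sections B \<omega> W"
    and k: "k \<in> idx B" and p: "p \<in> W" "p \<in> chart_dom B k"
  shows "courant B (msec s) (msec t) k p = 0"
proof -
  obtain e where e: "proj B e = p" using ex_fibre_point[OF k p(2)] by blast
  have h: "proj B e \<in> W" "proj B e \<in> chart_dom B k" using e p by simp_all
  have hX: "k \<in> idx TX" "e \<in> chart_dom TX k" using k h by simp_all
  note ds = deriv_L[OF W s k h] and dt = deriv_L[OF W t k h]
  note ns = has_derivative_minus[OF ds(2)] and nt = has_derivative_minus[OF dt(2)]
  note lin = linear_DL[OF W s k h] linear_DL[OF W t k h]
  let ?S = "\<lambda>k e. (L0 s k e, - L1 s k e)" and ?T = "\<lambda>k e. (L0 t k e, - L1 t k e)"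
  have "open (proj B -` W)"
    using continuous_proj W by (simp add: open_vimage)
  then have "eigen_section TX J (proj B -` W) (courant_complex TX ?S ?T)"
    using int eigen_lift[OF W s] eigen_lift[OF W t] unfolding integrable_gacs_def by blast
  then have eig: "J k e (fst (courant_complex TX ?S ?T k e)) = - snd (courant_complex TX ?S ?T k e)"
    unfolding eigen_section_def using k h by (auto simp: map_prod_def split_beta prod_eq_iff)
  have c: "courant TX (L0 s) (L0 t) k e = dorfman (DL0 t k e) (L0 s k e) - dorfman (DL0 s k e) (L0 t k e)"
    "courant TX (\<lambda>k e. - L1 s k e) (\<lambda>k e. - L1 t k e) k e
      = dorfman (\<lambda>w. - DL1 t k e w) (- L1 s k e) - dorfman (\<lambda>w. - DL1 s k e w) (- L1 t k e)"
    "courant TX (L0 s) (\<lambda>k e. - L1 t k e) k e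
      = dorfman (\<lambda>w. - DL1 t k e w) (L0 s k e) - dorfman (DL0 s k e) (- L1 t k e)"
    "courant TX (\<lambda>k e. - L1 s k e) (L0 t) k e
      = dorfman (DL0 t k e) (- L1 s k e) - dorfman (\<lambda>w. - DL1 s k e w) (L0 t k e)"
    by (rule total.courant_eq[OF hX]; rule ds dt ns nt)+
  have "snd (courant_complex TX ?S ?T k e) = 0"
    using dorfman_L01[OF W s W t k h(1) h] dorfman_L01[OF W t W s k h(1) h]
    by (simp add: courant_complex_def Let_def c dorfman_minus_left dorfman_minus_right lin)
  moreover have "fst (courant_complex TX ?S ?T k e)
      = - lift1 k (proj B e) (triv B k e) (courant B (msec s) (msec t) k (proj B e))"
    using dorfman_L00[OF W s W t k h(1) h] dorfman_L11[OF W s W t k h(1) h]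
    by (simp add: courant_complex_def Let_def c dorfman_minus_left dorfman_minus_right lin)
  \<comment> \<open>Since the imaginary part is zero, the eigenvalue equation says that
    \<open>J\<close> kills the real part. One more \<open>J\<close> reduces injectivity to
    \<open>J_props(2)\<close>.\<close>
  ultimately have "J k e (J k e (- lift1 k (proj B e) (triv B k e) (courant B (msec s) (msec t) k (proj B e)))) = 0"
    using eig by (simp add: linear_0[OF J_props(1)[OF k h(2)]])
  then have "lift1 k (proj B e) (triv B k e) (courant B (msec s) (msec t) k (proj B e)) = 0"
    by (simp add: J_props(2)[OF k h(2)])
  then show ?thesis
    using lift1_eq_0 e by blast
qed

section \<open>Eigensections near a point\<close>

lemma flat_sections_subset:
  assumes "s \<in> flat_sections B \<omega> W" "W' \<subseteq> W"
  shows "s \<in> flat_sections B \<omega> W'"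
proof -
  have "smooth_on (coord B k ` (W' \<inter> chart_dom B k)) (s k \<circ> par B k)" if "k \<in> idx B" for k
    using assms that unfolding flat_sections_def is_section_def
    by (blast intro: smooth_on_subset)
  then show ?thesis
    using assms unfolding flat_sections_def is_section_def by blast
qed

lemma eigen_sectionD:
  assumes "eigen_section TX J U s" and k: "k \<in> idx B"
  shows "smooth_on (coord TX k ` (U \<inter> chart_dom TX k)) (\<lambda>z. s k (par TX k z))"
    and "\<And>l e. l \<in> idx B \<Longrightarrow> e \<in> U \<Longrightarrow> proj B e \<in> chart_dom B k \<Longrightarrow> proj B e \<in> chart_dom B l \<Longrightarrow>
      fst (s l e) = gen_trans (jac TX) k l e (fst (s k e)) \<and>
      snd (s l e) = gen_trans (jac TX) k l e (snd (s k e))"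
    and "\<And>e. e \<in> U \<Longrightarrow> proj B e \<in> chart_dom B k \<Longrightarrow> J k e (fst (s k e)) = - snd (s k e)"
proof -
  note a = assms(1)[unfolded eigen_section_def is_section_def]
  show "smooth_on (coord TX k ` (U \<inter> chart_dom TX k)) (\<lambda>z. s k (par TX k z))"
    using a k by (simp add: comp_def)
  show "fst (s l e) = gen_trans (jac TX) k l e (fst (s k e)) \<and>
      snd (s l e) = gen_trans (jac TX) k l e (snd (s k e))"
    if "l \<in> idx B" "e \<in> U" "proj B e \<in> chart_dom B k" "proj B e \<in> chart_dom B l" for l e
  proof -
    have "s l e = sum_trans (gen_trans (jac TX)) (gen_trans (jac TX)) k l e (s k e)"
      by (rule conjunct2[OF conjunct1[OF a], rule_format]) (use k that in auto)
    then show ?thesis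
      by (simp add: sum_trans_def[of "gen_trans (jac TX)"])
  qed
  show "J k e (fst (s k e)) = - snd (s k e)" if "e \<in> U" "proj B e \<in> chart_dom B k" for e
  proof -
    have "map_prod (J k e) (J k e) (s k e) = (- snd (s k e), fst (s k e))"
      by (rule conjunct2[OF a, rule_format]) (use k that in auto)
    from arg_cong[OF this, of fst] show ?thesis
      by simp
  qed
qed

text \<open>
  Near a point, an eigensection is \<open>a - i J a\<close> where \<open>a\<close> differs from lifts of flat sections by
  a section vanishing at the point, with derivative \<open>R\<close> there.
\<close>

lemma eigen_expansion:
  assumes U: "open U" and eig: "eigen_section TX J U s"
    and k: "k \<in> idx B" and e: "e \<in> U" "proj B e \<in> chart_dom B k"
  obtains W s1 s2 R where "open W" "proj B e \<in> W" "s1 \<in> flat_sections B \<omega> W" "s2 \<in> flat_sections B \<omega> W"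
    "\<And>m. m \<in> idx B \<Longrightarrow> proj B e \<in> chart_dom B m \<Longrightarrow> fst (s m e) = L0 s1 m e + L1 s2 m e"
    "\<And>m. m \<in> idx B \<Longrightarrow> proj B e \<in> chart_dom B m \<Longrightarrow> - snd (s m e) = L1 s1 m e - L0 s2 m e"
    "\<And>m. m \<in> idx B \<Longrightarrow> proj B e \<in> chart_dom B m \<Longrightarrow> ((\<lambda>z. fst (s m (par TX m z))) has_derivative
        (\<lambda>w. DL0 s1 m e w + DL1 s2 m e w + R m w)) (at (coord TX m e))"
    "\<And>m. m \<in> idx B \<Longrightarrow> proj B e \<in> chart_dom B m \<Longrightarrow> ((\<lambda>z. - snd (s m (par TX m z))) has_derivative
        (\<lambda>w. DL1 s1 m e w - DL0 s2 m e w + J m e (R m w))) (at (coord TX m e))"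
    "\<And>l w. l \<in> idx B \<Longrightarrow> proj B e \<in> chart_dom B l \<Longrightarrow>
        R l w = gen_trans (jac TX) k l e (R k (jac TX l k e w))"
proof -
  obtain c d where cd: "fst (s k e) = lift0 k (proj B e) (triv B k e) c + J k e (lift0 k (proj B e) (triv B k e) d)"
    using lifts_span[OF k e(2)] .
  obtain W1 s1 where 1: "open W1" "proj B e \<in> W1" "s1 \<in> flat_sections B \<omega> W1" "s1 k (proj B e) = c"
    using ex_flat_section[OF k e(2)] .
  obtain W2 s2 where 2: "open W2" "proj B e \<in> W2" "s2 \<in> flat_sections B \<omega> W2" "s2 k (proj B e) = d"
    using ex_flat_section[OF k e(2)] .
  define W where "W = W1 \<inter> W2"
  have W: "open W" "proj B e \<in> W" and s1: "s1 \<in> flat_sections B \<omega> W" and s2: "s2 \<in> flat_sections B \<omega> W"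
    using 1 2 flat_sections_subset by (auto simp: W_def)
  define V where "V = U \<inter> proj B -` W"
  have V: "open V" "e \<in> V"
    using U W e continuous_proj by (auto simp: V_def open_vimage)
  have ek: "fst (s k e) = L0 s1 k e + L1 s2 k e"
    by (simp add: cd L0_def L1_def 1 2)
  \<comment> \<open>The remainder vanishes at \<open>e\<close> in chart \<open>k\<close> by the
    choice of the flat sections, and then in every chart because it transforms linearly.\<close>
  define D where "D m e' = fst (s m e') - (L0 s1 m e' + L1 s2 m e')" for m e'
  define R where "R m = frechet_derivative (\<lambda>z. D m (par TX m z)) (at (coord TX m e))" for m
  have D_trans: "D l e' = gen_trans (jac TX) k l e' (D k e')"
    if l: "l \<in> idx B" and e': "e' \<in> V" "proj B e' \<in> chart_dom B k" "proj B e' \<in> chart_dom B l" for l e'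
  proof -
    have "linear (gen_trans (jac TX) k l e')"
      using k l e' by (intro total.gen_jac_linear) auto
    moreover have "e' \<in> U" "proj B e' \<in> W" using e' by (auto simp: V_def)
    ultimately show ?thesis
      using eigen_sectionD(2)[OF eig k l _ e'(2,3)] L_trans[OF W(1) s1 k l _ e'(2,3)]
        L_trans[OF W(1) s2 k l _ e'(2,3)]
      by (simp add: D_def linear_diff linear_add)
  qed
  have De: "D m e = 0" if m: "m \<in> idx B" "proj B e \<in> chart_dom B m" for m
  proof -
    have "linear (gen_trans (jac TX) k m e)"
      using k e m by (intro total.gen_jac_linear) auto
    then show ?thesis
      using D_trans[OF m(1) V(2) e(2) m(2)] by (simp add: D_def[of k] ek linear_0)
  qed
  have open_V: "open (coord TX m ` (V \<inter> chart_dom TX m))" if "m \<in> idx B" for m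
    using total.open_coord_Int[of m V] that V by simp
  have dfst: "((\<lambda>z. fst (s m (par TX m z))) has_derivative
      frechet_derivative (\<lambda>z. fst (s m (par TX m z))) (at (coord TX m e))) (at (coord TX m e))"
    if m: "m \<in> idx B" "proj B e \<in> chart_dom B m" for m
  proof (rule smooth_on_has_derivative)
    show "smooth_on (coord TX m ` (U \<inter> chart_dom TX m)) (\<lambda>z. fst (s m (par TX m z)))"
      by (rule smooth_on_fst[OF _ eigen_sectionD(1)[OF eig m(1)]])
         (use total.open_coord_Int[of m U] m U in simp)
    show "coord TX m e \<in> coord TX m ` (U \<inter> chart_dom TX m)"
      using e m by (intro imageI) auto
  qed
  have dD: "((\<lambda>z. D m (par TX m z)) has_derivative R m) (at (coord TX m e))"
    if m: "m \<in> idx B" "proj B e \<in> chart_dom B m" for m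
  proof -
    note d = has_derivative_diff[OF dfst[OF m] has_derivative_add[OF deriv_L(1)[OF W(1) s1 m(1) W(2) m(2)]
        deriv_L(2)[OF W(1) s2 m(1) W(2) m(2)]]]
    show ?thesis
      unfolding R_def using d by (simp only: D_def frechet_derivative_eqI[OF d])
  qed
  show thesis
  proof (rule that[OF W s1 s2])
    fix m assume m: "m \<in> idx B" "proj B e \<in> chart_dom B m"
    show v: "fst (s m e) = L0 s1 m e + L1 s2 m e"
      using De[OF m] by (simp add: D_def)
    have Jm: "linear (J m e)" by (rule J_props(1)[OF m])
    show "- snd (s m e) = L1 s1 m e - L0 s2 m e"
      using eigen_sectionD(3)[OF eig m(1) e(1) m(2)]
      by (simp add: v linear_add[OF Jm] J_L1[OF m] L1_def[of s1])
    have "((\<lambda>z. (L0 s1 m (par TX m z) + L1 s2 m (par TX m z)) + D m (par TX m z)) has_derivative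
        (\<lambda>w. (DL0 s1 m e w + DL1 s2 m e w) + R m w)) (at (coord TX m e))"
      by (intro has_derivative_add deriv_L(1)[OF W(1) s1 m(1) W(2) m(2)]
          deriv_L(2)[OF W(1) s2 m(1) W(2) m(2)] dD[OF m])
    then show "((\<lambda>z. fst (s m (par TX m z))) has_derivative
        (\<lambda>w. DL0 s1 m e w + DL1 s2 m e w + R m w)) (at (coord TX m e))"
      by (simp add: D_def)
    let ?S = "coord TX m ` (V \<inter> chart_dom TX m)"
    have z: "coord TX m e \<in> ?S" using V m by (intro imageI) auto
    have par: "par TX m z \<in> V" "proj B (par TX m z) \<in> chart_dom B m" if "z \<in> ?S" for z
      using total.par_image(2)[of m z "V \<inter> chart_dom TX m"] m that by auto
    have sub: "?S \<subseteq> (coord B m ` chart_dom B m) \<times> UNIV"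
      by auto
    \<comment> \<open>As \<open>D m\<close> vanishes at \<open>e\<close>, the derivative of
      \<open>J\<close> does not appear, and the same \<open>R m\<close> governs the imaginary part
      of the eigensection.\<close>
    have "((\<lambda>z. J m (par TX m z) (D m (par TX m z))) has_derivative
        (\<lambda>w. J m (par TX m (coord TX m e)) (R m w))) (at (coord TX m e))"
    proof (rule has_derivative_apply_vanishing[where L = "\<lambda>z. J m (par TX m z)", OF open_V[OF m(1)] z _ _ dD[OF m]])
      show "linear (J m (par TX m z))" if "z \<in> ?S" for z
        by (rule J_props(1)[OF m(1) par(2)[OF that]])
      show "continuous_on ?S (\<lambda>z. J m (par TX m z) b)" for b
        by (rule continuous_on_subset[OF smooth_on_imp_continuous_on[OF smooth_J[OF m(1)]] sub])
      show "D m (par TX m (coord TX m e)) = 0"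
        using total.par_coord[of m e] m De[OF m] by simp
    qed
    then have JD: "((\<lambda>z. J m (par TX m z) (D m (par TX m z))) has_derivative (\<lambda>w. J m e (R m w))) (at (coord TX m e))"
      using total.par_coord[of m e] m by simp
    have "((\<lambda>z. (L1 s1 m (par TX m z) - L0 s2 m (par TX m z)) + J m (par TX m z) (D m (par TX m z)))
        has_derivative (\<lambda>w. DL1 s1 m e w - DL0 s2 m e w + J m e (R m w))) (at (coord TX m e))"
      by (intro has_derivative_add has_derivative_diff JD deriv_L(2)[OF W(1) s1 m(1) W(2) m(2)]
          deriv_L(1)[OF W(1) s2 m(1) W(2) m(2)])
    then show "((\<lambda>z. - snd (s m (par TX m z))) has_derivative
        (\<lambda>w. DL1 s1 m e w - DL0 s2 m e w + J m e (R m w))) (at (coord TX m e))"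
    proof (rule has_derivative_transform_within_open[OF _ open_V[OF m(1)] z])
      fix z assume "z \<in> ?S"
      then have q: "par TX m z \<in> V" "proj B (par TX m z) \<in> chart_dom B m" by (rule par)+
      then have "par TX m z \<in> U" by (simp add: V_def)
      from eigen_sectionD(3)[OF eig m(1) this q(2)]
      have "- snd (s m (par TX m z)) = J m (par TX m z)
          ((L0 s1 m (par TX m z) + L1 s2 m (par TX m z)) + D m (par TX m z))"
        by (simp add: D_def)
      then show "(L1 s1 m (par TX m z) - L0 s2 m (par TX m z)) + J m (par TX m z) (D m (par TX m z))
          = - snd (s m (par TX m z))"
        by (simp add: linear_add[OF J_props(1)[OF m(1) q(2)]] J_L1[OF m(1) q(2)] L1_def[of s1])
    qed
  next
    fix l w assume l: "l \<in> idx B" "proj B e \<in> chart_dom B l"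
    have X: "k \<in> idx TX" "l \<in> idx TX" "e \<in> chart_dom TX k" "e \<in> chart_dom TX l"
      using k l e by auto
    let ?S = "coord TX l ` (V \<inter> (chart_dom TX l \<inter> chart_dom TX k))"
    let ?c = "coord TX l e"
    have S: "open ?S"
      by (rule total.open_coord[OF X(2)]) (use V(1) total.open_dom[OF X(1)] total.open_dom[OF X(2)] in auto)
    have z: "?c \<in> ?S" using V X by (intro imageI) auto
    have par: "par TX l z \<in> V" "par TX l z \<in> chart_dom TX l" "par TX l z \<in> chart_dom TX k"
      if "z \<in> ?S" for z
      using total.par_image(2)[OF X(2) that] by auto
    have "((\<lambda>u. D k (par TX l u)) has_derivative (\<lambda>w. R k (jac TX l k e w))) (at ?c)"
      by (rule total.deriv_chart_change[OF X(2,1,4,3) dD[OF k e(2)]])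
    \<comment> \<open>The second derivatives of the change of chart would be multiplied by
      \<open>D k e = 0\<close>. Hence \<open>R\<close> obeys a purely algebraic law.\<close>
    then have "((\<lambda>u. gen_trans (jac TX) k l (par TX l u) (D k (par TX l u))) has_derivative
        (\<lambda>w. gen_trans (jac TX) k l (par TX l ?c) (R k (jac TX l k e w)))) (at ?c)"
    proof (rule has_derivative_apply_vanishing[where L = "\<lambda>u. gen_trans (jac TX) k l (par TX l u)", OF S z, rotated 2])
      show "linear (gen_trans (jac TX) k l (par TX l u))" if "u \<in> ?S" for u
        by (rule total.gen_jac_linear[OF X(1,2) par(3,2)[OF that]])
      show "continuous_on ?S (\<lambda>u. gen_trans (jac TX) k l (par TX l u) b)" for b
        by (rule continuous_on_subset[OF total.continuous_gen_jac[OF X(1,2)]]) auto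
      show "D k (par TX l ?c) = 0"
        using total.par_coord[OF X(2,4)] De[OF k e(2)] by simp
    qed
    then have "((\<lambda>u. D l (par TX l u)) has_derivative
        (\<lambda>w. gen_trans (jac TX) k l (par TX l ?c) (R k (jac TX l k e w)))) (at ?c)"
    proof (rule has_derivative_transform_within_open[OF _ S z])
      fix u assume "u \<in> ?S"
      from par[OF this] show "gen_trans (jac TX) k l (par TX l u) (D k (par TX l u)) = D l (par TX l u)"
        using D_trans[OF l(1)] by simp
    qed
    from has_derivative_unique[OF dD[OF l] this]
    show "R l w = gen_trans (jac TX) k l e (R k (jac TX l k e w))"
      using total.par_coord[OF X(2,4)] by metis
  qed
qed

end

section \<open>Vanishing brackets on the base force integrability\<close>

context semi_flat_bundle
begin

text \<open>The basis sums in \<open>dorfman\<close> are the part that depends on more than the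
  direction of differentiation. Orthogonality of \<open>J\<close> cancels them in the first
  combination, skewness in the second.\<close>

lemma dorfman_J:
  assumes "k \<in> idx B" "proj B e \<in> chart_dom B k"
  shows "dorfman R a - dorfman (\<lambda>w. J k e (R w)) (J k e a) = R (fst a) - J k e (R (fst (J k e a)))"
    and "dorfman (\<lambda>w. J k e (R w)) a + dorfman R (J k e a) = J k e (R (fst a)) + R (fst (J k e a))"
proof -
  show "dorfman R a - dorfman (\<lambda>w. J k e (R w)) (J k e a) = R (fst a) - J k e (R (fst (J k e a)))"
    by (simp add: dorfman_def J_props(3)[OF assms])
  have "pairing (J k e a) b + pairing a (J k e b) = 0" for b
    using J_skew[OF assms] by simp
  then have "(\<Sum>b\<in>Basis. pairing a (J k e (R b)) *\<^sub>R b) + (\<Sum>b\<in>Basis. pairing (J k e a) (R b) *\<^sub>R b) = 0"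
    by (simp add: sum.distrib[symmetric] scaleR_add_left[symmetric] add.commute)
  then have "(0, \<Sum>b\<in>Basis. pairing a (J k e (R b)) *\<^sub>R b) + (0, \<Sum>b\<in>Basis. pairing (J k e a) (R b) *\<^sub>R b)
      = (0 :: ('e \<times> 'f) \<times> ('e \<times> 'f))"
    by (simp add: zero_prod_def)
  then show "dorfman (\<lambda>w. J k e (R w)) a + dorfman R (J k e a) = J k e (R (fst a)) + R (fst (J k e a))"
    unfolding dorfman_def by (simp add: add.assoc add.left_commute)
qed

text \<open>The real part of (1 - i J) R(v), where v is the tangent part of a - i J a: the
  derivative of the remainder of one eigensection along the other. Its imaginary part is minus
  \<open>J\<close> of it, by \<open>J_nij\<close>.\<close>

definition nij :: "'k \<Rightarrow> 'v \<Rightarrow> ('e \<times> 'f \<Rightarrow> ('e \<times> 'f) \<times> ('e \<times> 'f)) \<Rightarrow> ('e \<times> 'f) \<times> ('e \<times> 'f)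
    \<Rightarrow> ('e \<times> 'f) \<times> ('e \<times> 'f)" where
  "nij m e R a = R (fst a) - J m e (R (fst (J m e a)))"

lemma J_nij:
  assumes "m \<in> idx B" "proj B e \<in> chart_dom B m"
  shows "J m e (nij m e R a) = J m e (R (fst a)) + R (fst (J m e a))"
  by (simp add: nij_def linear_diff[OF J_props(1)[OF assms]] J_props(2)[OF assms])

text \<open>The Jacobian applied to the tangent part of \<open>a\<close> is undone by the opposite
  one inside \<open>R'\<close>, and the outer transition map commutes with \<open>J\<close>.\<close>

lemma nij_equiv:
  assumes k: "k \<in> idx B" "proj B e \<in> chart_dom B k" and l: "l \<in> idx B" "proj B e \<in> chart_dom B l"
    and R: "\<And>w. R' w = gen_trans (jac TX) k l e (R (jac TX l k e w))"
  shows "nij l e R' (gen_trans (jac TX) k l e a) = gen_trans (jac TX) k l e (nij k e R a)"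
proof -
  have X: "k \<in> idx TX" "l \<in> idx TX" "e \<in> chart_dom TX k" "e \<in> chart_dom TX l"
    using k l by auto
  have R': "R' (fst (gen_trans (jac TX) k l e b)) = gen_trans (jac TX) k l e (R (fst b))" for b
    by (simp add: R gen_trans_apply total.jac_jac[OF X])
  show ?thesis
    by (simp add: nij_def J_equiv[OF k(1) l(1) k(2) l(2)] R' linear_diff[OF total.gen_jac_linear[OF X]])
qed

context
  assumes flat_brackets: "\<And>W s t k p. open W \<Longrightarrow> s \<in> flat_sections B \<omega> W \<Longrightarrow> t \<in> flat_sections B \<omega> W \<Longrightarrow>
    k \<in> idx B \<Longrightarrow> p \<in> W \<Longrightarrow> p \<in> chart_dom B k \<Longrightarrow> courant B (msec s) (msec t) k p = 0"
begin

lemma dorfman_L11_0: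
  assumes W: "open W" "proj B e \<in> W" "s \<in> flat_sections B \<omega> W"
    and W': "open W'" "proj B e \<in> W'" "t \<in> flat_sections B \<omega> W'"
    and m: "m \<in> idx B" "proj B e \<in> chart_dom B m"
  shows "dorfman (DL1 t m e) (L1 s m e) = dorfman (DL1 s m e) (L1 t m e)"
proof -
  have "courant B (msec s) (msec t) m (proj B e) = 0"
    \<comment> \<open>The hypothesis speaks of two flat sections over one open set, so both are
      restricted to the intersection.\<close>
    by (rule flat_brackets[of "W \<inter> W'"])
       (use W W' m in \<open>auto intro: flat_sections_subset\<close>)
  then have "lift1 m (proj B e) (triv B m e) (courant B (msec s) (msec t) m (proj B e)) = 0"
    using linear_0[OF linear_con(2)[OF m]] by (simp add: lift1_def zero_prod_def)
  then show ?thesis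
    using dorfman_L11[OF W(1,3) W'(1,3) m(1) W(2) W'(2) m(2)] by simp
qed

text \<open>The bracket of \<open>a - i J a\<close> and \<open>b - i J b\<close> is \<open>c - i J c\<close> for the \<open>c\<close> displayed here.\<close>

lemma courant_complex_eigen:
  assumes U: "open U" and s: "eigen_section TX J U s" and t: "eigen_section TX J U t"
    and k: "k \<in> idx B" and e: "e \<in> U" "proj B e \<in> chart_dom B k"
  obtains R R' where
    "\<And>m. m \<in> idx B \<Longrightarrow> proj B e \<in> chart_dom B m \<Longrightarrow>
       fst (courant_complex TX s t m e) = nij m e (R' m) (fst (s m e)) - nij m e (R m) (fst (t m e))"
    "\<And>m. m \<in> idx B \<Longrightarrow> proj B e \<in> chart_dom B m \<Longrightarrow>
       snd (courant_complex TX s t m e) = - J m e (fst (courant_complex TX s t m e))"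
    "\<And>l w. l \<in> idx B \<Longrightarrow> proj B e \<in> chart_dom B l \<Longrightarrow>
        R l w = gen_trans (jac TX) k l e (R k (jac TX l k e w))"
    "\<And>l w. l \<in> idx B \<Longrightarrow> proj B e \<in> chart_dom B l \<Longrightarrow>
        R' l w = gen_trans (jac TX) k l e (R' k (jac TX l k e w))"
proof -
  obtain W s1 s2 R where W: "open W" "proj B e \<in> W"
    and s1: "s1 \<in> flat_sections B \<omega> W" and s2: "s2 \<in> flat_sections B \<omega> W"
    and va: "\<And>m. m \<in> idx B \<Longrightarrow> proj B e \<in> chart_dom B m \<Longrightarrow> fst (s m e) = L0 s1 m e + L1 s2 m e"
    and va': "\<And>m. m \<in> idx B \<Longrightarrow> proj B e \<in> chart_dom B m \<Longrightarrow> - snd (s m e) = L1 s1 m e - L0 s2 m e"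
    and da: "\<And>m. m \<in> idx B \<Longrightarrow> proj B e \<in> chart_dom B m \<Longrightarrow> ((\<lambda>z. fst (s m (par TX m z))) has_derivative
        (\<lambda>w. DL0 s1 m e w + DL1 s2 m e w + R m w)) (at (coord TX m e))"
    and da': "\<And>m. m \<in> idx B \<Longrightarrow> proj B e \<in> chart_dom B m \<Longrightarrow> ((\<lambda>z. - snd (s m (par TX m z))) has_derivative
        (\<lambda>w. DL1 s1 m e w - DL0 s2 m e w + J m e (R m w))) (at (coord TX m e))"
    and R: "\<And>l w. l \<in> idx B \<Longrightarrow> proj B e \<in> chart_dom B l \<Longrightarrow>
        R l w = gen_trans (jac TX) k l e (R k (jac TX l k e w))"
    apply (rule eigen_expansion[OF U s k e])
    subgoal premises prems for W s1 s2 R by (rule prems(1)[OF prems(2-)])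
    done
  obtain W' t1 t2 R' where W': "open W'" "proj B e \<in> W'"
    and t1: "t1 \<in> flat_sections B \<omega> W'" and t2: "t2 \<in> flat_sections B \<omega> W'"
    and vb: "\<And>m. m \<in> idx B \<Longrightarrow> proj B e \<in> chart_dom B m \<Longrightarrow> fst (t m e) = L0 t1 m e + L1 t2 m e"
    and vb': "\<And>m. m \<in> idx B \<Longrightarrow> proj B e \<in> chart_dom B m \<Longrightarrow> - snd (t m e) = L1 t1 m e - L0 t2 m e"
    and db: "\<And>m. m \<in> idx B \<Longrightarrow> proj B e \<in> chart_dom B m \<Longrightarrow> ((\<lambda>z. fst (t m (par TX m z))) has_derivative
        (\<lambda>w. DL0 t1 m e w + DL1 t2 m e w + R' m w)) (at (coord TX m e))"
    and db': "\<And>m. m \<in> idx B \<Longrightarrow> proj B e \<in> chart_dom B m \<Longrightarrow> ((\<lambda>z. - snd (t m (par TX m z))) has_derivative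
        (\<lambda>w. DL1 t1 m e w - DL0 t2 m e w + J m e (R' m w))) (at (coord TX m e))"
    and R': "\<And>l w. l \<in> idx B \<Longrightarrow> proj B e \<in> chart_dom B l \<Longrightarrow>
        R' l w = gen_trans (jac TX) k l e (R' k (jac TX l k e w))"
    apply (rule eigen_expansion[OF U t k e])
    subgoal premises prems for W s1 s2 R by (rule prems(1)[OF prems(2-)])
    done
  have main: "fst (courant_complex TX s t m e) = nij m e (R' m) (fst (s m e)) - nij m e (R m) (fst (t m e))
    \<and> snd (courant_complex TX s t m e) = - J m e (fst (courant_complex TX s t m e))"
    if m: "m \<in> idx B" "proj B e \<in> chart_dom B m" for m
  proof -
    have X: "m \<in> idx TX" "e \<in> chart_dom TX m" using m by simp_all
    define a b where ab: "a = fst (s m e)" "b = fst (t m e)"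
    have Ja: "- snd (s m e) = J m e a" and Jb: "- snd (t m e) = J m e b"
      using eigen_sectionD(3)[OF s m(1) e(1) m(2)] eigen_sectionD(3)[OF t m(1) e(1) m(2)]
      by (simp_all add: ab)
    have w: "a = L0 s1 m e + L1 s2 m e" "b = L0 t1 m e + L1 t2 m e"
      "J m e a = L1 s1 m e - L0 s2 m e" "J m e b = L1 t1 m e - L0 t2 m e"
      using va[OF m] vb[OF m] va'[OF m] vb'[OF m] Ja Jb by (simp_all add: ab)
    note lin = linear_DL[OF W(1) s1 m(1) W(2) m(2)] linear_DL[OF W(1) s2 m(1) W(2) m(2)]
      linear_DL[OF W'(1) t1 m(1) W'(2) m(2)] linear_DL[OF W'(1) t2 m(1) W'(2) m(2)]
    have swap: "dorfman (DL0 t' m e) (L0 s' m e) = dorfman (DL0 s' m e) (L0 t' m e)"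
      "dorfman (DL1 t' m e) (L0 s' m e) = dorfman (DL0 s' m e) (L1 t' m e)"
      "dorfman (DL0 t' m e) (L1 s' m e) = dorfman (DL1 s' m e) (L0 t' m e)"
      "dorfman (DL1 t' m e) (L1 s' m e) = dorfman (DL1 s' m e) (L1 t' m e)"
      if "s' \<in> flat_sections B \<omega> W" "t' \<in> flat_sections B \<omega> W'" for s' t'
      using dorfman_L00[OF W(1) that(1) W'(1) that(2) m(1) W(2) W'(2) m(2)]
        dorfman_L01[OF W(1) that(1) W'(1) that(2) m(1) W(2) W'(2) m(2)]
        dorfman_L01[OF W'(1) that(2) W(1) that(1) m(1) W'(2) W(2) m(2)]
        dorfman_L11_0[OF W that(1) W' that(2) m]
      by simp_all
    note swaps = swap[OF s1 t1] swap[OF s1 t2] swap[OF s2 t1] swap[OF s2 t2]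
    note dorf = dorfman_add_left dorfman_diff_left dorfman_add_right[OF lin(1)] dorfman_add_right[OF lin(2)]
      dorfman_add_right[OF lin(3)] dorfman_add_right[OF lin(4)] dorfman_add_right[OF lin(5)]
      dorfman_add_right[OF lin(6)] dorfman_add_right[OF lin(7)] dorfman_add_right[OF lin(8)]
      dorfman_diff_right[OF lin(1)] dorfman_diff_right[OF lin(2)]
      dorfman_diff_right[OF lin(3)] dorfman_diff_right[OF lin(4)] dorfman_diff_right[OF lin(5)]
      dorfman_diff_right[OF lin(6)] dorfman_diff_right[OF lin(7)] dorfman_diff_right[OF lin(8)]
    let ?JR = "\<lambda>w. J m e (R m w)" and ?JR' = "\<lambda>w. J m e (R' m w)"
    let ?P = "\<lambda>w. DL0 s1 m e w + DL1 s2 m e w" and ?P' = "\<lambda>w. DL1 s1 m e w - DL0 s2 m e w"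
    let ?Q = "\<lambda>w. DL0 t1 m e w + DL1 t2 m e w" and ?Q' = "\<lambda>w. DL1 t1 m e w - DL0 t2 m e w"
    \<comment> \<open>At \<open>e\<close> the values of the eigensections are those of their flat
      parts. By bilinearity, the symmetry relations for pairs of lifts therefore cancel everything
      in the four real brackets that does not contain \<open>R m\<close> or
      \<open>R' m\<close>.\<close>
    have Z: "dorfman ?Q a = dorfman ?P b" "dorfman ?Q' a = dorfman ?P (J m e b)"
      "dorfman ?Q (J m e a) = dorfman ?P' b" "dorfman ?Q' (J m e a) = dorfman ?P' (J m e b)"
      unfolding w(3,4) unfolding w(1,2) by (simp_all add: dorf swaps)
    have lin': "linear (\<lambda>w. ?P w + R m w)" "linear (\<lambda>w. ?Q w + R' m w)"
      "linear (\<lambda>w. ?P' w + ?JR w)" "linear (\<lambda>w. ?Q' w + ?JR' w)"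
      by (rule has_derivative_linear[OF da[OF m]] has_derivative_linear[OF db[OF m]]
          has_derivative_linear[OF da'[OF m]] has_derivative_linear[OF db'[OF m]])+
    have ds: "((\<lambda>z. snd (s m (par TX m z))) has_derivative (\<lambda>w. - (?P' w + ?JR w))) (at (coord TX m e))"
      using has_derivative_minus[OF da'[OF m]] by simp
    have dt: "((\<lambda>z. snd (t m (par TX m z))) has_derivative (\<lambda>w. - (?Q' w + ?JR' w))) (at (coord TX m e))"
      using has_derivative_minus[OF db'[OF m]] by simp
    have snd_eq: "snd (s m e) = - J m e a" "snd (t m e) = - J m e b"
      using Ja Jb by (metis minus_minus)+
    have c1: "courant TX (\<lambda>k p. fst (s k p)) (\<lambda>k p. fst (t k p)) m e = dorfman (R' m) a - dorfman (R m) b"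
      using total.courant_eq[where s = "\<lambda>k p. fst (s k p)" and t = "\<lambda>k p. fst (t k p)",
          OF X da[OF m] db[OF m]] Z(1)
      unfolding ab[symmetric] dorfman_add_left[of ?P "R m"] dorfman_add_left[of ?Q "R' m"] by simp
    have c2: "courant TX (\<lambda>k p. snd (s k p)) (\<lambda>k p. snd (t k p)) m e
        = dorfman ?JR' (J m e a) - dorfman ?JR (J m e b)"
      using total.courant_eq[where s = "\<lambda>k p. snd (s k p)" and t = "\<lambda>k p. snd (t k p)",
          OF X ds dt] Z(4)
      unfolding snd_eq dorfman_minus_left dorfman_minus_right[OF lin'(3)] dorfman_minus_right[OF lin'(4)]
      unfolding dorfman_add_left[of ?P' ?JR] dorfman_add_left[of ?Q' ?JR'] by simp
    have c3: "courant TX (\<lambda>k p. fst (s k p)) (\<lambda>k p. snd (t k p)) m e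
        = - (dorfman ?JR' a - dorfman (R m) (J m e b))"
      using total.courant_eq[where s = "\<lambda>k p. fst (s k p)" and t = "\<lambda>k p. snd (t k p)",
          OF X da[OF m] dt] Z(2)
      unfolding snd_eq ab[symmetric] dorfman_minus_left dorfman_minus_right[OF lin'(1)]
      unfolding dorfman_add_left[of ?P "R m"] dorfman_add_left[of ?Q' ?JR'] by simp
    have c4: "courant TX (\<lambda>k p. snd (s k p)) (\<lambda>k p. fst (t k p)) m e
        = - (dorfman (R' m) (J m e a) - dorfman ?JR b)"
      using total.courant_eq[where s = "\<lambda>k p. snd (s k p)" and t = "\<lambda>k p. fst (t k p)",
          OF X ds db[OF m]] Z(3)
      unfolding snd_eq ab[symmetric] dorfman_minus_left dorfman_minus_right[OF lin'(2)]
      unfolding dorfman_add_left[of ?P' ?JR] dorfman_add_left[of ?Q "R' m"] by simp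
    have "fst (courant_complex TX s t m e)
        = (dorfman (R' m) a - dorfman ?JR' (J m e a)) - (dorfman (R m) b - dorfman ?JR (J m e b))"
      by (simp add: courant_complex_def Let_def c1 c2)
    then have f: "fst (courant_complex TX s t m e) = nij m e (R' m) a - nij m e (R m) b"
      unfolding dorfman_J(1)[OF m] nij_def .
    have "snd (courant_complex TX s t m e)
        = - ((dorfman ?JR' a + dorfman (R' m) (J m e a)) - (dorfman ?JR b + dorfman (R m) (J m e b)))"
      by (simp add: courant_complex_def Let_def c3 c4)
    also have "\<dots> = - (J m e (nij m e (R' m) a) - J m e (nij m e (R m) b))"
      unfolding dorfman_J(2)[OF m] J_nij[OF m] ..
    finally have "snd (courant_complex TX s t m e) = - J m e (fst (courant_complex TX s t m e))"
      by (simp add: f linear_diff[OF J_props(1)[OF m]])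
    with f show ?thesis by (simp add: ab)
  qed
  show thesis
    by (rule that[of R' R]) (use main R R' in blast)+
qed

lemma integrable: "integrable_gacs TX J"
  unfolding integrable_gacs_def
proof (intro allI impI)
  fix U s t
  assume U: "open U" and s: "eigen_section TX J U s" and t: "eigen_section TX J U t"
  show "eigen_section TX J U (courant_complex TX s t)"
    unfolding eigen_section_def is_section_def
  proof (intro conjI ballI)
    fix k assume "k \<in> idx TX"
    then have k: "k \<in> idx B" by simp
    let ?S = "coord TX k ` (U \<inter> chart_dom TX k)"
    have S: "open ?S" using total.open_coord_Int[of k U] k U by simp
    note sm = eigen_sectionD(1)[OF s k] eigen_sectionD(1)[OF t k]
    note sm' = smooth_on_fst[OF S sm(1)] smooth_on_snd[OF S sm(1)]
      smooth_on_fst[OF S sm(2)] smooth_on_snd[OF S sm(2)]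
    let ?c = "\<lambda>f g z. courant_loc (\<lambda>z. f (s k (par TX k z))) (\<lambda>z. g (t k (par TX k z))) z"
    have "smooth_on ?S (\<lambda>z. (?c fst fst z - ?c snd snd z, ?c fst snd z + ?c snd fst z))"
      by (intro smooth_on_Pair[OF S] smooth_on_diff[OF S] smooth_on_add[OF S] smooth_courant_loc[OF S] sm')
    then show "smooth_on ?S (courant_complex TX s t k \<circ> par TX k)"
    proof (rule smooth_on_cong[OF S])
      fix z assume "z \<in> ?S"
      then have "coord TX k (par TX k z) = z"
        using total.coord_par(1)[of k z] k by auto
      then show "(?c fst fst z - ?c snd snd z, ?c fst snd z + ?c snd fst z)
          = (courant_complex TX s t k \<circ> par TX k) z"
        by (simp add: courant_complex_def Let_def courant_def comp_def del: TX_simps)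
    qed
  next
    fix k l e assume "k \<in> idx TX" "l \<in> idx TX" "e \<in> U \<inter> chart_dom TX k \<inter> chart_dom TX l"
    then have k: "k \<in> idx B" "proj B e \<in> chart_dom B k" and l: "l \<in> idx B" "proj B e \<in> chart_dom B l"
      and e: "e \<in> U" by auto
    have lin: "linear (gen_trans (jac TX) k l e)"
      using k l by (intro total.gen_jac_linear) auto
    obtain R R' where
      f: "\<And>m. m \<in> idx B \<Longrightarrow> proj B e \<in> chart_dom B m \<Longrightarrow>
         fst (courant_complex TX s t m e) = nij m e (R' m) (fst (s m e)) - nij m e (R m) (fst (t m e))"
      and g: "\<And>m. m \<in> idx B \<Longrightarrow> proj B e \<in> chart_dom B m \<Longrightarrow>
         snd (courant_complex TX s t m e) = - J m e (fst (courant_complex TX s t m e))"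
      and R: "\<And>l w. l \<in> idx B \<Longrightarrow> proj B e \<in> chart_dom B l \<Longrightarrow>
          R l w = gen_trans (jac TX) k l e (R k (jac TX l k e w))"
      and R': "\<And>l w. l \<in> idx B \<Longrightarrow> proj B e \<in> chart_dom B l \<Longrightarrow>
          R' l w = gen_trans (jac TX) k l e (R' k (jac TX l k e w))"
      apply (rule courant_complex_eigen[OF U s t k(1) e k(2)])
      subgoal premises prems for R R' by (rule prems(1)[OF prems(2-)])
      done
    have sl: "fst (s l e) = gen_trans (jac TX) k l e (fst (s k e))"
      and tl: "fst (t l e) = gen_trans (jac TX) k l e (fst (t k e))"
      using eigen_sectionD(2)[OF s k(1) l(1) e k(2) l(2)] eigen_sectionD(2)[OF t k(1) l(1) e k(2) l(2)] by simp_all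
    \<comment> \<open>The transformation law of the bracket is read off from its expression through
      \<open>nij\<close>, whose ingredients all transform algebraically.\<close>
    have 1: "fst (courant_complex TX s t l e) = gen_trans (jac TX) k l e (fst (courant_complex TX s t k e))"
      unfolding f[OF l] f[OF k] sl tl
        nij_equiv[where R = "R k" and R' = "R l", OF k l R[OF l]]
        nij_equiv[where R = "R' k" and R' = "R' l", OF k l R'[OF l]]
      by (rule linear_diff[OF lin, symmetric])
    have 2: "snd (courant_complex TX s t l e) = gen_trans (jac TX) k l e (snd (courant_complex TX s t k e))"
      unfolding g[OF l] g[OF k] 1 J_equiv[OF k(1) l(1) k(2) l(2)] by (rule linear_neg[OF lin, symmetric])
    show "courant_complex TX s t l e
        = sum_trans (gen_trans (jac TX)) (gen_trans (jac TX)) k l e (courant_complex TX s t k e)"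
      by (simp add: sum_trans_def[of "gen_trans (jac TX)"] prod_eq_iff[of "courant_complex TX s t l e"] 1 2)
  next
    fix k e assume "k \<in> idx TX" "e \<in> U \<inter> chart_dom TX k"
    then have k: "k \<in> idx B" "proj B e \<in> chart_dom B k" and e: "e \<in> U" by auto
    have g: "snd (courant_complex TX s t k e) = - J k e (fst (courant_complex TX s t k e))"
      by (rule courant_complex_eigen[OF U s t k(1) e k(2)]) (simp add: k)
    show "map_prod (J k e) (J k e) (courant_complex TX s t k e)
        = (- snd (courant_complex TX s t k e), fst (courant_complex TX s t k e))"
      by (simp add: prod_eq_iff[of "map_prod _ _ _"] g linear_neg[OF J_props(1)[OF k]] J_props(2)[OF k])
  qed
qed

end

section \<open>Sections of the image sheaf\<close>

text \<open>The component functions of a section of \<open>M_sheaf\<close> are prescribed only on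
  \<open>U\<close> and the chart domains. The bracket at a point depends on their values and
  derivatives there, so they may be replaced by \<open>msec\<close>.\<close>

lemma courant_M_sheaf:
  assumes U: "open U" and s: "s \<in> flat_sections B \<omega> U" and t: "t \<in> flat_sections B \<omega> U"
    and \<sigma>: "\<And>k p. k \<in> idx B \<Longrightarrow> p \<in> U \<inter> chart_dom B k \<Longrightarrow> \<sigma> k p = M_map (J\<^sub>0 k p) (s k p)"
    and \<tau>: "\<And>k p. k \<in> idx B \<Longrightarrow> p \<in> U \<inter> chart_dom B k \<Longrightarrow> \<tau> k p = M_map (J\<^sub>0 k p) (t k p)"
    and k: "k \<in> idx B" and p: "p \<in> U" "p \<in> chart_dom B k"
  shows "courant B \<sigma> \<tau> k p = courant B (msec s) (msec t) k p"
proof -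
  have S: "open (coord B k ` (U \<inter> chart_dom B k))" by (rule base.open_coord_Int[OF k U])
  have x: "coord B k p \<in> coord B k ` (U \<inter> chart_dom B k)" using p by simp
  have par: "par B k u \<in> U \<inter> chart_dom B k" if "u \<in> coord B k ` (U \<inter> chart_dom B k)" for u
    using base.par_image(2)[OF k that] by simp
  have ds: "((\<lambda>u. \<sigma> k (par B k u)) has_derivative
      frechet_derivative (\<lambda>u. msec s k (par B k u)) (at (coord B k p))) (at (coord B k p))"
    by (rule has_derivative_transform_within_open[OF deriv_msec[OF U s k p] S x])
       (simp add: msec_def \<sigma>[OF k par])
  have dt: "((\<lambda>u. \<tau> k (par B k u)) has_derivative
      frechet_derivative (\<lambda>u. msec t k (par B k u)) (at (coord B k p))) (at (coord B k p))"
    by (rule has_derivative_transform_within_open[OF deriv_msec[OF U t k p] S x])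
       (simp add: msec_def \<tau>[OF k par])
  show ?thesis
    unfolding base.courant_eq[where s = \<sigma> and t = \<tau>, OF k p(2) ds dt]
      base.courant_eq[where s = "msec s" and t = "msec t", OF k p(2) deriv_msec[OF U s k p] deriv_msec[OF U t k p]]
    using p by (simp add: msec_def \<sigma>[OF k] \<tau>[OF k])
qed

lemma integrable_iff:
  "integrable_gacs TX J \<longleftrightarrow>
    (\<forall>U \<sigma> \<tau>. open U \<longrightarrow> \<sigma> \<in> M_sheaf B \<omega> J\<^sub>0 U \<longrightarrow> \<tau> \<in> M_sheaf B \<omega> J\<^sub>0 U \<longrightarrow>
      (\<forall>k\<in>idx B. \<forall>p\<in>U \<inter> chart_dom B k. courant B \<sigma> \<tau> k p = 0))"
proof
  assume int: "integrable_gacs TX J"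
  show "\<forall>U \<sigma> \<tau>. open U \<longrightarrow> \<sigma> \<in> M_sheaf B \<omega> J\<^sub>0 U \<longrightarrow> \<tau> \<in> M_sheaf B \<omega> J\<^sub>0 U \<longrightarrow>
      (\<forall>k\<in>idx B. \<forall>p\<in>U \<inter> chart_dom B k. courant B \<sigma> \<tau> k p = 0)"
  proof (intro allI impI ballI)
    fix U \<sigma> \<tau> k p
    assume U: "open U" and \<sigma>: "\<sigma> \<in> M_sheaf B \<omega> J\<^sub>0 U" and \<tau>: "\<tau> \<in> M_sheaf B \<omega> J\<^sub>0 U"
      and k: "k \<in> idx B" and p: "p \<in> U \<inter> chart_dom B k"
    obtain s where s: "s \<in> flat_sections B \<omega> U"
      "\<And>k p. k \<in> idx B \<Longrightarrow> p \<in> U \<inter> chart_dom B k \<Longrightarrow> \<sigma> k p = M_map (J\<^sub>0 k p) (s k p)"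
      using \<sigma> unfolding M_sheaf_def by blast
    obtain t where t: "t \<in> flat_sections B \<omega> U"
      "\<And>k p. k \<in> idx B \<Longrightarrow> p \<in> U \<inter> chart_dom B k \<Longrightarrow> \<tau> k p = M_map (J\<^sub>0 k p) (t k p)"
      using \<tau> unfolding M_sheaf_def by blast
    have p': "p \<in> U" "p \<in> chart_dom B k" using p by auto
    show "courant B \<sigma> \<tau> k p = 0"
      using courant_M_sheaf[OF U s(1) t(1) s(2) t(2) k p'] courant_msec_0[OF int U s(1) t(1) k p']
      by simp
  qed
next
  assume H: "\<forall>U \<sigma> \<tau>. open U \<longrightarrow> \<sigma> \<in> M_sheaf B \<omega> J\<^sub>0 U \<longrightarrow> \<tau> \<in> M_sheaf B \<omega> J\<^sub>0 U \<longrightarrow>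
      (\<forall>k\<in>idx B. \<forall>p\<in>U \<inter> chart_dom B k. courant B \<sigma> \<tau> k p = 0)"
  show "integrable_gacs TX J"
  proof (rule integrable)
    fix W s t k p
    assume W: "open W" and s: "s \<in> flat_sections B \<omega> W" and t: "t \<in> flat_sections B \<omega> W"
      and k: "k \<in> idx B" and p: "p \<in> W" "p \<in> chart_dom B k"
    have "msec s \<in> M_sheaf B \<omega> J\<^sub>0 W" "msec t \<in> M_sheaf B \<omega> J\<^sub>0 W"
      using s t unfolding M_sheaf_def msec_def by blast+
    then show "courant B (msec s) (msec t) k p = 0"
      using H W k p by blast
  qed
qed

end

theorem theorem7p3:
  fixes B :: "('k, 'p::{t2_space, second_countable_topology}, real^'n,
      'v::topological_space, real^'n) vbundle"
    and \<omega> :: "'k \<Rightarrow> 'p \<Rightarrow> real^'n \<Rightarrow> real^'n \<Rightarrow> real^'n"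
    and J\<^sub>0 :: "'k \<Rightarrow> 'p \<Rightarrow> ((real^'n) \<times> (real^'n)) \<times> ((real^'n) \<times> (real^'n))
      \<Rightarrow> ((real^'n) \<times> (real^'n)) \<times> ((real^'n) \<times> (real^'n))"
    and J :: "'k \<Rightarrow> 'v \<Rightarrow> ((real^'n) \<times> (real^'n)) \<times> ((real^'n) \<times> (real^'n))
      \<Rightarrow> ((real^'n) \<times> (real^'n)) \<times> ((real^'n) \<times> (real^'n))"
  assumes "smooth_vector_bundle B"
    and "flat_connection B \<omega>"
    and "semi_flat B \<omega> J\<^sub>0 J"
  shows "integrable_gacs (total_atlas B) J \<longleftrightarrow>
    (\<forall>U \<sigma> \<tau>. open U \<longrightarrow> \<sigma> \<in> M_sheaf B \<omega> J\<^sub>0 U \<longrightarrow> \<tau> \<in> M_sheaf B \<omega> J\<^sub>0 U \<longrightarrow>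
      (\<forall>k\<in>idx B. \<forall>p\<in>U \<inter> chart_dom B k. courant B \<sigma> \<tau> k p = 0))"
  proof -
  interpret semi_flat_bundle B \<omega> J\<^sub>0 J
    by unfold_locales (rule assms)+
  show ?thesis
    by (rule integrable_iff)
qed

end
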